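(* Let $m,n>1$ be rational integers, at least one of which is even, and let $x,y\in\mathbb{Z}[i]$. The only non-trivial solutions $(x,y,m,n)$ of the Catalan equation $$x^m-y^n=1$$ are $$(-2,\,3i,\,3,\,2),\quad (-2,\,-3i,\,3,\,2),\quad (3,\,2,\,2,\,3),\quad (-3,\,2,\,2,\,3),$$ $$(i-1,\,i-2,\,5,\,2),\quad (-i-1,\,-i-2,\,5,\,2),\quad (-1-2i,\,-i+1,\,2,\,5),\quad (-1+2i,\,i+1,\,2,\,5),$$ $$(i-1,\,2-i,\,5,\,2),\quad (-i-1,\,2+i,\,5,\,2),\quad (2i+1,\,1-i,\,2,\,5),\quad (-2i+1,\,1+i,\,2,\,5).$$
   Context: $\mathbb{Z}[i]$ is the ring of Gaussian integers. A solution $(x,y,m,n)$ of $x^m-y^n=1$ is called non-trivial if $xy\neq 0$. *)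

theory Defs
  imports Complex_Main
begin

definition gaussian_ints :: "complex set" where
  "gaussian_ints = {z. \<exists>a b :: int. z = of_int a + of_int b * \<i>}"

definition nontrivial_catalan_solution :: "complex \<Rightarrow> complex \<Rightarrow> nat \<Rightarrow> nat \<Rightarrow> bool" where
  "nontrivial_catalan_solution x y m n \<longleftrightarrow> x ^ m - y ^ n = 1 \<and> x * y \<noteq> 0"

end

theory Submission
  imports Defs "HOL-Number_Theory.Number_Theory" "HOL-Computational_Algebra.Squarefree"
begin

text \<open>After factoring differences of squares and multiplying by \<open>i\<close>, everything reduces to
  \<open>x\<^sup>2 = y\<^sup>q + 1\<close> with \<open>q\<close> an odd prime. Let \<open>\<lambda> = 1 + i\<close>.

  If \<open>y\<close> is odd, then \<open>x + 1 = b\<^sup>q\<close>, \<open>x - 1 = a\<^sup>q\<close>, so \<open>b - a = 2u\<close> for a unit \<open>u\<close>, and a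
  \<open>\<lambda>\<close>-adic study of the expansion of \<open>(1 + c)\<^sup>q + (1 - c)\<^sup>q\<close> leaves only \<open>x = 0\<close>.

  If \<open>2\<close> divides \<open>y\<close>, quadratic reciprocity for the repunits \<open>(t\<^sup>k - 1)/(t - 1)\<close>, \<open>t = -y\<close>, shows
  that every integer prime to \<open>q\<close> and to the norm of \<open>y + 1\<close> has Jacobi symbol 1 modulo that norm.
  Hence \<open>y + 1\<close> is a square \<open>z\<^sup>2\<close> or divisible by \<open>q\<close>. The first is excluded by the Pell equation
  \<open>X\<^sup>2 - (z\<^sup>2 - 1) Y\<^sup>2 = 1\<close>. In the second, up to the sign of \<open>x\<close>, one has \<open>x = 2a\<^sup>q - 1\<close>, \<open>y = aB\<close>,
  \<open>B\<^sup>q = 4(a\<^sup>q - 1)\<close>, and \<open>a\<^sup>2\<^sup>q - B\<^sup>q = (a\<^sup>q - 2)\<^sup>2\<close> makes \<open>a\<^sup>2 - B\<close> a square when \<open>q > 3\<close>, which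
  contradicts the size of \<open>B\<close>; for \<open>q = 3\<close> a descent on \<open>w\<^sup>2 = 3z\<^sup>4 - 3z\<^sup>2e\<^sup>2 + e\<^sup>4\<close> remains.

  If \<open>\<lambda>\<close> divides \<open>y\<close> exactly, the same symbols modulo the repunits of index congruent to 2, 5 and 10
  modulo \<open>q\<close> contradict multiplicativity unless \<open>q = 5\<close>. In that case
  \<open>4(a\<^sup>4 + a\<^sup>3 + a\<^sup>2 + a + 1) + (a - 1)\<^sup>4 = 5(a\<^sup>2 + 1)\<^sup>2\<close> leads to
  \<open>l\<^sup>2 = p\<^sup>4 + 50p\<^sup>2d\<^sup>2 + 125d\<^sup>4\<close>, where a 2-descent gives \<open>d = 0\<close>, that is \<open>a = \<plusminus>i\<close>.\<close>

section \<open>Gaussian integers as a Euclidean ring\<close>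

text \<open>An obstacle absent over the integers is that q may split in Z[i]. The factors y + 1 and
  (y^q + 1)/(y + 1) share only divisors of q. If they share none, y + 1 is a unit times a square;
  but besides q itself they may share just one of two conjugate primes of norm q. Then the norm of y
  + 1 is q times a square, so its Jacobi symbols are Legendre symbols modulo q, and these are not
  all 1. For y divisible by 2, reciprocity serves to exclude this case.

  When only 1 + i divides y, repunits of index at least 2 are congruent to i modulo 2, and
  reciprocity between two of them costs a sign exactly when one index is below 4 and the other is
  not. Large indices congruent to 2, 5, 10 modulo q have symbols multiplicative in the index,
  whereas the signs attached to 2, 5, 10 themselves are not. Index 5 must be prime to q, which is
  why q = 5 survives.

  Both quartics are 2-coverings of elliptic curves, and each descent passes to a 2-isogenous curve
  and back. The one for q = 5 comes from putting e = p + 5d and f = p - 5d into (e^5 - f^5)/(e -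
  f).\<close>

datatype gint = Gint (gRe: int) (gIm: int)

lemma gint_eq_iff: "z = w \<longleftrightarrow> gRe z = gRe w \<and> gIm z = gIm w"
  by (cases z; cases w) auto

instantiation gint :: comm_ring_1
begin

definition "0 = Gint 0 0"
definition "1 = Gint 1 0"
definition "z + w = Gint (gRe z + gRe w) (gIm z + gIm w)"
definition "- z = Gint (- gRe z) (- gIm z)"
definition "z - w = Gint (gRe z - gRe w) (gIm z - gIm w)"
definition "z * w = Gint (gRe z * gRe w - gIm z * gIm w) (gRe z * gIm w + gIm z * gRe w)"

instance
  by standard
    (auto simp: zero_gint_def one_gint_def plus_gint_def uminus_gint_def minus_gint_def
      times_gint_def algebra_simps)

end

lemma gRe_gIm_simps [simp]:
  "gRe 0 = 0" "gIm 0 = 0" "gRe 1 = 1" "gIm 1 = 0"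
  "gRe (z + w) = gRe z + gRe w" "gIm (z + w) = gIm z + gIm w"
  "gRe (z - w) = gRe z - gRe w" "gIm (z - w) = gIm z - gIm w"
  "gRe (- z) = - gRe z" "gIm (- z) = - gIm z"
  "gRe (z * w) = gRe z * gRe w - gIm z * gIm w"
  "gIm (z * w) = gRe z * gIm w + gIm z * gRe w"
  by (simp_all add: zero_gint_def one_gint_def plus_gint_def uminus_gint_def minus_gint_def
      times_gint_def)

lemma gRe_gIm_of_nat [simp]: "gRe (of_nat n) = int n" "gIm (of_nat n) = 0"
  by (induction n) auto

lemma gRe_gIm_numeral [simp]: "gRe (numeral n) = numeral n" "gIm (numeral n) = 0"
  by (metis gRe_gIm_of_nat of_nat_numeral)+

lemma gRe_gIm_of_int [simp]: "gRe (of_int n) = n" "gIm (of_int n) = 0"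
  by (cases n rule: int_cases2; simp)+

definition gi :: gint where "gi = Gint 0 1"

lemma gi_simps [simp]: "gRe gi = 0" "gIm gi = 1"
  by (simp_all add: gi_def)

lemma gi_sq: "gi\<^sup>2 = -1" and gi_mult: "gi * gi = -1"
  by (simp_all add: gint_eq_iff power2_eq_square)

definition gcnj :: "gint \<Rightarrow> gint" where "gcnj z = Gint (gRe z) (- gIm z)"

definition gnorm :: "gint \<Rightarrow> int" where "gnorm z = (gRe z)\<^sup>2 + (gIm z)\<^sup>2"

lemma gcnj_simps [simp]: "gRe (gcnj z) = gRe z" "gIm (gcnj z) = - gIm z"
  by (simp_all add: gcnj_def)

lemma gcnj_mult: "gcnj (z * w) = gcnj z * gcnj w"
  by (simp add: gint_eq_iff)

lemma mult_gcnj: "z * gcnj z = of_int (gnorm z)"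
  by (simp add: gint_eq_iff gnorm_def power2_eq_square algebra_simps)

lemma gnorm_mult: "gnorm (z * w) = gnorm z * gnorm w"
  by (simp add: gnorm_def power2_eq_square algebra_simps)

lemma gnorm_simps [simp]: "gnorm 0 = 0" "gnorm 1 = 1" "gnorm (- z) = gnorm z"
  "gnorm (gcnj z) = gnorm z" "gnorm gi = 1"
  by (simp_all add: gnorm_def)

lemma gnorm_power: "gnorm (z ^ n) = gnorm z ^ n"
  by (induction n) (simp_all add: gnorm_mult)

lemma gnorm_of_int [simp]: "gnorm (of_int n) = n\<^sup>2"
  by (simp add: gnorm_def)

lemma gnorm_numeral [simp]: "gnorm (numeral n) = (numeral n)\<^sup>2"
  by (simp add: gnorm_def)

lemma gnorm_nonneg [simp]: "gnorm z \<ge> 0"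
  by (simp add: gnorm_def)

lemma gnorm_eq_0_iff [simp]: "gnorm z = 0 \<longleftrightarrow> z = 0"
  by (auto simp: gnorm_def gint_eq_iff sum_power2_eq_zero_iff)

lemma gnorm_pos_iff [simp]: "gnorm z > 0 \<longleftrightarrow> z \<noteq> 0"
  using gnorm_nonneg[of z] gnorm_eq_0_iff[of z] by linarith

instance gint :: idom
proof
  fix a b :: gint
  assume "a \<noteq> 0" "b \<noteq> 0"
  then show "a * b \<noteq> 0"
    by (metis gnorm_eq_0_iff gnorm_mult mult_eq_0_iff)
qed

instance gint :: ring_char_0
proof
  show "inj (of_nat :: nat \<Rightarrow> gint)"
    by (auto simp: inj_def gint_eq_iff)
qed

text \<open>Rounding to the nearest integer: plain \<open>div\<close> could leave both coordinates
  of a remainder close to the divisor, and the norm need not decrease.\<close>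

definition round_div :: "int \<Rightarrow> int \<Rightarrow> int" where
  "round_div a b = (2 * a + b) div (2 * b)"

lemma round_div_mult: "b > 0 \<Longrightarrow> round_div (a * b) b = a"
proof -
  assume b: "b > 0"
  have "(2 * (a * b) + b) div (2 * b) = a + b div (2 * b)"
    using b div_mult_self1[of "2 * b" b a] by (simp add: algebra_simps)
  moreover have "b div (2 * b) = 0"
    using b by (intro div_pos_pos_trivial) auto
  ultimately show ?thesis
    unfolding round_div_def by simp
qed

lemma round_div_bound: "b > 0 \<Longrightarrow> 2 * \<bar>a - b * round_div a b\<bar> \<le> b"
proof -
  assume b: "b > 0"
  let ?m = "(2 * a + b) mod (2 * b)"
  have "2 * b * round_div a b + ?m = 2 * a + b"
    unfolding round_div_def by (rule mult_div_mod_eq)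
  moreover have "0 \<le> ?m" "?m < 2 * b"
    using b by auto
  ultimately show ?thesis
    by (auto simp: algebra_simps abs_if)
qed

instantiation gint :: idom_modulo
begin

definition "z div w = Gint (round_div (gRe (z * gcnj w)) (gnorm w))
  (round_div (gIm (z * gcnj w)) (gnorm w))"
definition "z mod w = z - z div w * (w :: gint)"

instance
proof
  fix a b :: gint
  show "a div 0 = 0"
    by (simp add: divide_gint_def round_div_def zero_gint_def)
  show "(a * b) div b = a" if "b \<noteq> 0"
  proof -
    have "gRe (a * b * gcnj b) = gRe a * gnorm b" "gIm (a * b * gcnj b) = gIm a * gnorm b"
      unfolding mult.assoc mult_gcnj by simp_all
    then show ?thesis
      using that by (simp add: divide_gint_def round_div_mult gint_eq_iff)
  qed
  show "a div b * b + a mod b = a"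
    by (simp add: modulo_gint_def)
qed

end

instantiation gint :: euclidean_ring
begin

definition "euclidean_size z = nat (gnorm z)"

instance
proof
  fix a b :: gint
  show "euclidean_size (0 :: gint) = 0"
    by (simp add: euclidean_size_gint_def)
  show "euclidean_size (a mod b) < euclidean_size b" if "b \<noteq> 0"
  proof -
    \<comment> \<open>Multiplied by the conjugate of \<open>b\<close>, the remainder has coordinates
      at most half the norm of \<open>b\<close>, hence norm at most half the square of that norm;
      one factor cancels.\<close>
    let ?n = "gnorm b" and ?t = "a * gcnj b"
    let ?r = "?t - of_int ?n * (a div b)"
    have n: "?n > 0"
      using that by simp
    have "(a mod b) * gcnj b = ?r"
      unfolding modulo_gint_def mult_gcnj[symmetric] by (simp add: algebra_simps)
    then have *: "gnorm (a mod b) * ?n = gnorm ?r"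
      by (metis gnorm_mult gnorm_simps(4))
    have "2 * \<bar>gRe ?r\<bar> \<le> ?n" "2 * \<bar>gIm ?r\<bar> \<le> ?n"
      using round_div_bound[OF n] by (simp_all add: divide_gint_def)
    then have "(2 * \<bar>gRe ?r\<bar>)\<^sup>2 \<le> ?n\<^sup>2" "(2 * \<bar>gIm ?r\<bar>)\<^sup>2 \<le> ?n\<^sup>2"
      by (intro power_mono; simp)+
    then have "2 * gnorm ?r \<le> ?n\<^sup>2"
      unfolding gnorm_def[of ?r] by (simp add: power_mult_distrib)
    then have "2 * gnorm (a mod b) * ?n \<le> ?n * ?n"
      using * by (simp add: power2_eq_square)
    then have "2 * gnorm (a mod b) \<le> ?n"
      using n by simp
    then show ?thesis
      using n gnorm_nonneg[of "a mod b"] unfolding euclidean_size_gint_def by linarith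
  qed
  show "euclidean_size a \<le> euclidean_size (a * b)" if "b \<noteq> 0"
  proof -
    have "gnorm b \<ge> 1"
      using that by (simp add: int_one_le_iff_zero_less)
    then have "gnorm a * 1 \<le> gnorm a * gnorm b"
      by (intro mult_left_mono) auto
    then show ?thesis
      by (simp add: euclidean_size_gint_def gnorm_mult)
  qed
qed

end

lemma gunit_iff_gnorm: "is_unit (z :: gint) \<longleftrightarrow> gnorm z = 1"
proof
  assume "is_unit z"
  then obtain w where "1 = z * w" ..
  then have "gnorm z * gnorm w = 1" and "z \<noteq> 0"
    by (auto simp flip: gnorm_mult)
  then show "gnorm z = 1"
    by (simp add: pos_zmult_eq_1_iff)
next
  assume "gnorm z = 1"
  then show "is_unit z"
    by (intro dvdI[of 1 z "gcnj z"]) (simp add: mult_gcnj)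
qed

lemma gunit_cases:
  assumes "is_unit (u :: gint)"
  obtains "u = 1" | "u = -1" | "u = gi" | "u = -gi"
proof -
  have n: "(gRe u)\<^sup>2 + (gIm u)\<^sup>2 = 1"
    using assms by (simp add: gunit_iff_gnorm gnorm_def)
  have "(gRe u)\<^sup>2 \<le> 1" "(gIm u)\<^sup>2 \<le> 1"
    using n zero_le_power2[of "gRe u"] zero_le_power2[of "gIm u"] by linarith+
  then have "\<bar>gRe u\<bar> \<le> 1" "\<bar>gIm u\<bar> \<le> 1"
    by (simp_all add: abs_square_le_1)
  then have "gRe u \<in> {-1,0,1}" "gIm u \<in> {-1,0,1}"
    by auto
  with n show ?thesis
    using that by (auto simp: gint_eq_iff)
qed

lemma gunit_iff: "is_unit (u :: gint) \<longleftrightarrow> u = 1 \<or> u = -1 \<or> u = gi \<or> u = -gi"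
  by (metis gunit_cases gunit_iff_gnorm gnorm_simps(2,3,5))

instantiation gint :: normalization_semidom
begin

text \<open>The four half-open quadrants are permuted by multiplication with \<open>gi\<close>; the
  normal form is the associate with positive real and nonnegative imaginary part.\<close>

definition "unit_factor z = (if z = 0 then 0 else
  if gRe z > 0 \<and> gIm z \<ge> 0 then 1 else
  if gRe z \<le> 0 \<and> gIm z > 0 then gi else
  if gRe z < 0 \<and> gIm z \<le> 0 then -1 else -gi)"

definition "normalize z = gcnj (unit_factor z) * z"

instance
proof
  fix a b :: gint
  show "unit_factor (0 :: gint) = 0"
    by (simp add: unit_factor_gint_def)
  show "unit_factor a = a" if "is_unit a"
    using that by (cases a rule: gunit_cases) (simp_all add: unit_factor_gint_def gint_eq_iff)
  show unit: "is_unit (unit_factor a)" if "a \<noteq> 0"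
    by (simp add: gunit_iff unit_factor_gint_def that)
  show "unit_factor (a * b) = a * unit_factor b" if "is_unit a"
    using that by (cases a rule: gunit_cases; hypsubst)
      (simp_all add: unit_factor_gint_def gint_eq_iff, presburger+)
  show "unit_factor a * normalize a = a"
  proof (cases "a = 0")
    case False
    then show ?thesis
      unfolding normalize_gint_def mult.assoc[symmetric] mult_gcnj
      using unit gunit_iff_gnorm by simp
  qed (simp add: unit_factor_gint_def)
  show "normalize (0 :: gint) = 0"
    by (simp add: normalize_gint_def)
qed

end

instance gint :: normalization_euclidean_semiring ..

instantiation gint :: euclidean_ring_gcd
begin

definition "gcd_gint = (Euclidean_Algorithm.gcd :: gint \<Rightarrow> _)"
definition "lcm_gint = (Euclidean_Algorithm.lcm :: gint \<Rightarrow> _)"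
definition "Gcd_gint = (Euclidean_Algorithm.Gcd :: gint set \<Rightarrow> _)"
definition "Lcm_gint = (Euclidean_Algorithm.Lcm :: gint set \<Rightarrow> _)"

instance
  by standard (simp_all add: gcd_gint_def lcm_gint_def Gcd_gint_def Lcm_gint_def)

end

subsection \<open>Powers, units and parity\<close>

text \<open>The unit group has order 4, so an odd power map permutes it. This lets units be absorbed
  into q-th powers.\<close>

lemma gint_unit_root:
  assumes "is_unit (u :: gint)" "odd q"
  obtains v where "is_unit v" "u = v ^ q"
proof -
  obtain k where q: "q = 2 * k + 1"
    using \<open>odd q\<close> by (auto elim: oddE)
  have pw: "gi ^ (2 * k + 1) = (-1) ^ k * gi" "(- gi) ^ (2 * k + 1) = - ((-1) ^ k * gi)"
    by (simp_all add: power_mult gi_sq)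
  from assms(1) show ?thesis
  proof (cases u rule: gunit_cases)
    case 1
    then show ?thesis using that[of 1] by simp
  next
    case 2
    then show ?thesis using that[of "-1"] assms(2) by simp
  next
    case 3
    then show ?thesis
      using that[of gi] that[of "-gi"] pw q by (cases "even k") (auto simp: gunit_iff)
  next
    case 4
    then show ?thesis
      using that[of gi] that[of "-gi"] pw q by (cases "even k") (auto simp: gunit_iff)
  qed
qed

text \<open>The root is \<open>gcd a c\<close>: up to units its n-th power is gcd(a^n, ab) = a
  gcd(a^(n-1), b) = a.\<close>

lemma coprime_mult_eq_power:
  fixes a b c :: "'a :: factorial_semiring_gcd"
  assumes "coprime a b" "a * b = c ^ n" "n > 0"
  obtains u d where "is_unit u" "a = u * d ^ n"
proof -
  have "normalize (gcd a c ^ n) = gcd (a ^ n) (a * b)"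
    using assms(2) by (simp add: gcd_exp_weak)
  also have "a ^ n = a * a ^ (n - 1)"
    using \<open>n > 0\<close> by (cases n) auto
  also have "gcd (a * a ^ (n - 1)) (a * b) = normalize (a * gcd (a ^ (n - 1)) b)"
    by (rule gcd_mult_left)
  also have "gcd (a ^ (n - 1)) b = 1"
    using assms(1) by (simp flip: coprime_iff_gcd_eq_1)
  finally have "normalize a = normalize (gcd a c ^ n)"
    by simp
  then obtain u where "is_unit u" "a = u * gcd a c ^ n"
    by (rule associatedE1)
  then show ?thesis
    using that by blast
qed

lemma coprime_mult_eq_odd_power:
  fixes a b c :: gint
  assumes "coprime a b" "a * b = c ^ q" "odd q"
  obtains d where "a = d ^ q"
proof -
  obtain u d where u: "is_unit u" "a = u * d ^ q"
    using coprime_mult_eq_power[OF assms(1,2)] assms(3) by (auto dest: odd_pos)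
  obtain v where "u = v ^ q"
    using gint_unit_root[OF u(1) assms(3)] by blast
  with u that[of "v * d"] show ?thesis
    by (simp add: power_mult_distrib)
qed

lemma gunit_odd_power_eq_1:
  assumes "is_unit (u :: gint)" "odd q" "u ^ q = 1"
  shows "u = 1"
proof -
  obtain k where q: "q = 2 * k + 1"
    using assms(2) by (auto elim: oddE)
  have "gi ^ (2 * k + 1) = (-1) ^ k * gi" "(- gi) ^ (2 * k + 1) = - ((-1) ^ k * gi)"
    by (simp_all add: power_mult gi_sq)
  with assms q show ?thesis
    by (cases u rule: gunit_cases; cases "even k") (auto simp: gint_eq_iff)
qed

lemma odd_power_inject_gint:
  assumes "(a :: gint) ^ q = b ^ q" "odd q"
  shows "a = b"
proof (cases "b = 0")
  case True
  then show ?thesis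
    using assms by (metis odd_pos power_eq_0_iff zero_power)
next
  case False
  have "b dvd a"
    using assms pow_divides_pow_iff[of q b a] by (simp add: odd_pos)
  then obtain u where u: "a = b * u" ..
  then have "u ^ q = 1"
    using assms(1) False by (simp add: power_mult_distrib)
  moreover from this have "is_unit u"
    using assms(2) by (metis dvd_refl is_unit_power_iff odd_pos not_gr_zero)
  ultimately show ?thesis
    using gunit_odd_power_eq_1[OF _ assms(2)] u by simp
qed

lemma prime_elem_if_gnorm_prime:
  assumes "prime (nat (gnorm z))"
  shows "prime_elem z"
proof -
  have p: "prime (gnorm z)"
    using assms by (subst prime_int_nat_transfer) simp
  have "irreducible z"
  proof (rule irreducibleI)
    show "z \<noteq> 0"
      using p by auto
    show "\<not> is_unit z"
      using p by (auto simp: gunit_iff_gnorm)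
    fix a b
    assume "z = a * b"
    then have "gnorm z = gnorm a * gnorm b"
      by (simp add: gnorm_mult)
    moreover have "irreducible (gnorm z)"
      using p by (simp only: prime_def prime_elem_imp_irreducible)
    ultimately have "is_unit (gnorm a) \<or> is_unit (gnorm b)"
      by (intro irreducibleD)
    then have "gnorm a = 1 \<or> gnorm b = 1"
      using gnorm_nonneg[of a] gnorm_nonneg[of b] by auto
    then show "is_unit a \<or> is_unit b"
      by (simp add: gunit_iff_gnorm)
  qed
  then show ?thesis
    by (simp add: prime_elem_iff_irreducible)
qed

lemma numeral_dvd_gint_iff:
  "(numeral n :: gint) dvd z \<longleftrightarrow> numeral n dvd gRe z \<and> numeral n dvd gIm z"
proof
  assume "(numeral n :: gint) dvd z"
  then obtain w where "z = numeral n * w" ..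
  then show "numeral n dvd gRe z \<and> numeral n dvd gIm z"
    by simp
next
  assume "numeral n dvd gRe z \<and> numeral n dvd gIm z"
  then obtain a b where "gRe z = numeral n * a" "gIm z = numeral n * b"
    by (auto elim!: dvdE)
  then have "z = numeral n * Gint a b"
    by (simp add: gint_eq_iff)
  then show "(numeral n :: gint) dvd z"
    by simp
qed

lemma gnorm_dvd: "z dvd w \<Longrightarrow> gnorm z dvd gnorm w"
  by (auto simp: gnorm_mult)

section \<open>The ramified prime 1 + i\<close>

definition gl :: gint where "gl = Gint 1 1"

lemma gl_simps [simp]: "gRe gl = 1" "gIm gl = 1"
  by (simp_all add: gl_def)

lemma gl_neq_0 [simp]: "gl \<noteq> 0"
  by (simp add: gint_eq_iff)

lemma gl_dvd_iff: "gl dvd z \<longleftrightarrow> even (gRe z + gIm z)"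
proof
  assume "gl dvd z"
  then obtain w where "z = gl * w" ..
  then show "even (gRe z + gIm z)"
    by simp
next
  assume "even (gRe z + gIm z)"
  then obtain k where "gRe z + gIm z = 2 * k" ..
  then have "z = gl * Gint k (gIm z - k)"
    by (simp add: gint_eq_iff)
  then show "gl dvd z" ..
qed

lemma prime_elem_gl: "prime_elem gl"
  by (intro prime_elem_if_gnorm_prime) (simp add: gnorm_def)

lemma gl_dvd_mult_iff [simp]: "gl dvd a * b \<longleftrightarrow> gl dvd a \<or> gl dvd b"
  using prime_elem_gl by (simp add: prime_elem_dvd_mult_iff)

lemma gl_dvd_power_iff [simp]: "gl dvd a ^ n \<longleftrightarrow> gl dvd a \<and> n > 0"
  by (induction n) (auto simp: gl_dvd_iff)

lemma gl_dvd_add_iff: "gl dvd a + b \<longleftrightarrow> (gl dvd a \<longleftrightarrow> gl dvd b)"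
  and gl_dvd_diff_iff: "gl dvd a - b \<longleftrightarrow> (gl dvd a \<longleftrightarrow> gl dvd b)"
  and gl_dvd_minus_iff [simp]: "gl dvd - a \<longleftrightarrow> gl dvd a"
  unfolding gl_dvd_iff by (simp; presburger)+

lemma gl_dvd_simps [simp]: "\<not> gl dvd 1" "\<not> gl dvd gi" "gl dvd 0"
  "gl dvd numeral n \<longleftrightarrow> even (numeral n :: int)" "gl dvd of_nat k \<longleftrightarrow> even k"
  by (simp_all add: gl_dvd_iff)

lemma gl_sq: "gl\<^sup>2 = 2 * gi" and two_eq_gl: "2 = gl * (1 - gi)" "2 = - gi * gl\<^sup>2"
  and gl_pow4: "gl ^ 4 = - 4"
  by (simp_all add: gint_eq_iff power2_eq_square eval_nat_numeral)

text \<open>An odd element is congruent to 1 or i modulo 2. The square of 1 + 2w is 1 + 4w(w + 1),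
  and \<open>gl\<close> divides w(w + 1) because its residue field has two elements.\<close>

lemma odd_square_gint:
  assumes "\<not> gl dvd z"
  obtains e k where "e = 1 \<or> e = -1" "z\<^sup>2 = e * (1 + 4 * gl * k)"
proof -
  obtain w e where w: "e = 1 \<or> e = -1" "z\<^sup>2 = e * (1 + 2 * w)\<^sup>2"
  proof (cases "even (gIm z)")
    case True
    then have "z - 1 = 2 * Gint ((gRe z - 1) div 2) (gIm z div 2)"
      using assms by (auto simp: gl_dvd_iff gint_eq_iff)
    then have "z = 1 + 2 * Gint ((gRe z - 1) div 2) (gIm z div 2)"
      by (simp add: algebra_simps)
    then show ?thesis
      using that[of 1 "Gint ((gRe z - 1) div 2) (gIm z div 2)"] by simp
  next
    case False
    then have "z = gi * (1 + 2 * Gint ((gIm z - 1) div 2) (- (gRe z div 2)))"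
      using assms by (auto simp: gl_dvd_iff gint_eq_iff)
    then show ?thesis
      using that[of "-1"] by (metis mult_minus_left mult_1 gi_sq power_mult_distrib)
  qed
  have "gl dvd w * (w + 1)"
    by (auto simp: gl_dvd_add_iff)
  then obtain k where k: "w * (w + 1) = gl * k" ..
  have "(1 + 2 * w)\<^sup>2 = 1 + 4 * (w * (w + 1))"
    by (simp add: power2_eq_square algebra_simps)
  also have "\<dots> = 1 + 4 * gl * k"
    unfolding k by (simp add: algebra_simps)
  finally have "z\<^sup>2 = e * (1 + 4 * gl * k)"
    using w(2) by simp
  with w(1) that show ?thesis
    by blast
qed

lemma odd_fourth_gint:
  assumes "\<not> gl dvd z"
  obtains k where "z ^ 4 = 1 + 8 * gl * k"
proof -
  obtain e k where k: "e = 1 \<or> e = -1" "z\<^sup>2 = e * (1 + 4 * gl * k)"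
    using odd_square_gint[OF assms] by blast
  have "z ^ 4 = (z\<^sup>2)\<^sup>2"
    by simp
  also have "\<dots> = (1 + 4 * gl * k)\<^sup>2"
    unfolding k(2) using k(1) by (auto simp: power_mult_distrib)
  also have "\<dots> = 1 + 8 * gl * (k + 2 * gl * k\<^sup>2)"
    by (simp add: power2_eq_square algebra_simps)
  finally show ?thesis
    using that by blast
qed

lemma parallelogram_gnorm: "gnorm (a - b) + gnorm (a + b) = 2 * gnorm a + 2 * gnorm b"
  by (simp add: gnorm_def power2_eq_square algebra_simps)

lemma gnorm_ge_1: "z \<noteq> 0 \<Longrightarrow> gnorm z \<ge> 1"
  using gnorm_pos_iff[of z] by linarith

lemma gl_dvd_gnorm: "gl dvd z \<longleftrightarrow> even (gnorm z)"
  by (simp add: gl_dvd_iff gnorm_def)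

text \<open>The quotient (a^n - b^n)/(a - b), written so that it makes sense for a = b too. With b =
  1 it is the repunit of length n in base a.\<close>

fun gsum :: "gint \<Rightarrow> gint \<Rightarrow> nat \<Rightarrow> gint" where
  "gsum a b 0 = 0"
| "gsum a b (Suc n) = a * gsum a b n + b ^ n"

lemma diff_mult_gsum: "(a - b) * gsum a b n = a ^ n - b ^ n"
proof (induction n)
  case (Suc n)
  have "(a - b) * gsum a b (Suc n) = a * ((a - b) * gsum a b n) + (a - b) * b ^ n"
    by (simp add: algebra_simps)
  then show ?case
    unfolding Suc.IH by (simp add: algebra_simps)
qed simp

lemma gsum_cong_linear: "\<exists>W. gsum a b (Suc n) = of_nat (Suc n) * b ^ n + (a - b) * W"
proof (induction n)
  case (Suc n)
  then obtain W where "gsum a b (Suc n) = of_nat (Suc n) * b ^ n + (a - b) * W" ..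
  then have "gsum a b (Suc (Suc n)) = a * (of_nat (Suc n) * b ^ n + (a - b) * W) + b ^ Suc n"
    by simp
  also have "\<dots> = of_nat (Suc (Suc n)) * b ^ Suc n
      + (a - b) * (of_nat (Suc n) * b ^ n + a * W)"
    by (simp add: algebra_simps)
  finally show ?case
    by blast
qed auto

lemma gsum_cong_quadratic:
  "\<exists>W. gsum t 1 n = of_nat n + of_nat (n choose 2) * (t - 1) + (t - 1)\<^sup>2 * W"
proof (induction n)
  case (Suc n)
  then obtain W where W: "gsum t 1 n = of_nat n + of_nat (n choose 2) * (t - 1) + (t - 1)\<^sup>2 * W" ..
  have "Suc n choose 2 = (n choose 2) + n"
    by (simp add: numeral_2_eq_2)
  then have "gsum t 1 (Suc n) = of_nat (Suc n) + of_nat (Suc n choose 2) * (t - 1)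
     + (t - 1)\<^sup>2 * (t * W + of_nat (n choose 2))"
    by (simp add: W power2_eq_square algebra_simps)
  then show ?case
    by blast
qed (auto intro!: exI[of _ 0] simp: numeral_2_eq_2)

lemma gsum_odd: "\<not> gl dvd a \<Longrightarrow> \<not> gl dvd b \<Longrightarrow> gl dvd gsum a b n \<longleftrightarrow> even n"
  by (induction n) (auto simp: gl_dvd_add_iff)

text \<open>Reduction modulo the prime \<open>2 - i\<close> of norm 5, which sends \<open>i\<close> to 2.\<close>

definition red5 :: "gint \<Rightarrow> int" where "red5 z = gRe z + 2 * gIm z"

definition pi5 :: gint where "pi5 = Gint 2 (-1)"

lemma red5_simps [simp]: "red5 (z + w) = red5 z + red5 w" "red5 (z - w) = red5 z - red5 w"
  "red5 (- z) = - red5 z" "red5 1 = 1" "red5 0 = 0" "red5 (numeral n) = numeral n" "red5 gi = 2"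
  by (simp_all add: red5_def)

lemma red5_mult: "[red5 (z * w) = red5 z * red5 w] (mod 5)"
proof -
  have "red5 z * red5 w - red5 (z * w) = 5 * (gIm z * gIm w)"
    by (simp add: red5_def algebra_simps)
  then show ?thesis
    by (metis cong_iff_dvd_diff cong_sym dvd_triv_left)
qed

lemma red5_power: "[red5 (z ^ n) = red5 z ^ n] (mod 5)"
proof (induction n)
  case (Suc n)
  then show ?case
    using cong_trans[OF red5_mult[of z "z ^ n"] cong_scalar_left] by simp
qed simp

lemma pi5_dvd_iff: "pi5 dvd z \<longleftrightarrow> 5 dvd red5 z"
proof
  assume "pi5 dvd z"
  then obtain w where "z = pi5 * w" ..
  then have "red5 z = 5 * gIm w"
    by (simp add: red5_def pi5_def)
  then show "5 dvd red5 z"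
    by simp
next
  assume "5 dvd red5 z"
  then obtain k where "gRe z + 2 * gIm z = 5 * k"
    unfolding red5_def ..
  then have "z = pi5 * Gint (2 * k - gIm z) k"
    by (simp add: pi5_def gint_eq_iff)
  then show "pi5 dvd z" ..
qed

lemma five_eq: "5 = pi5 * gcnj pi5"
  by (simp add: pi5_def gcnj_def gint_eq_iff)

lemma prime_elem_pi5: "prime_elem pi5" "prime_elem (gcnj pi5)"
  by (intro prime_elem_if_gnorm_prime; simp add: gnorm_def pi5_def gcnj_def)+

section \<open>Coprimality through prime elements\<close>

lemma gint_coprimeI:
  fixes a b :: gint
  assumes "a \<noteq> 0 \<or> b \<noteq> 0" "\<And>p. prime_elem p \<Longrightarrow> p dvd a \<Longrightarrow> p dvd b \<Longrightarrow> False"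
  shows "coprime a b"
proof (rule ccontr)
  assume "\<not> coprime a b"
  then have "\<not> is_unit (gcd a b)"
    using is_unit_gcd by blast
  moreover have "gcd a b \<noteq> 0"
    using assms(1) by auto
  ultimately obtain p where "prime p" "p dvd gcd a b"
    using prime_divisor_exists by blast
  then show False
    using assms(2)[of p] by (auto simp: prime_def)
qed

lemma prime_elem_dvd_prime_elem:
  fixes p r :: gint
  assumes "prime_elem p" "prime_elem r" "p dvd r"
  shows "r dvd p"
proof -
  obtain s where s: "r = p * s"
    using assms(3) ..
  have "r dvd p \<or> r dvd s"
    using assms(2) s by (metis dvd_refl prime_elem_dvd_mult_iff)
  moreover have "r dvd p" if "r dvd s"
  proof -
    have "p * s dvd 1 * s"
      using that s by simp
    then have "is_unit p \<or> s = 0"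
      by (metis dvd_times_right_cancel_iff)
    then show ?thesis
      using assms(1,2) s by (auto simp: prime_elem_not_unit)
  qed
  ultimately show ?thesis
    by blast
qed

text \<open>Since 2 is a unit times a square of \<open>gl\<close>, its only prime divisor is
  \<open>gl\<close> up to units; a common prime factor of 2 and z is thus a matter of
  parity.\<close>

lemma prime_elem_dvd_two:
  assumes "prime_elem (p :: gint)" "p dvd 2" "p dvd z"
  shows "gl dvd z"
proof -
  have "p dvd - gi * gl\<^sup>2"
    using assms(2) by (simp add: two_eq_gl(2))
  moreover have "\<not> p dvd gi"
    using assms(1) by (meson dvd_trans gunit_iff prime_elem_not_unit)
  ultimately have "p dvd gl"
    using assms(1) by (auto simp: prime_elem_dvd_mult_iff prime_elem_dvd_power_iff)
  then show ?thesis
    using prime_elem_dvd_prime_elem[OF assms(1) prime_elem_gl] assms(3) dvd_trans by blast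
qed

section \<open>The case of odd \<open>y\<close>\<close>

text \<open>With \<open>s = c\<^sup>2\<close> these are the polynomials in \<open>(1 + c)\<^sup>n = 1 + s Y\<^sub>n + c Z\<^sub>n\<close>.\<close>

fun powY powZ :: "gint \<Rightarrow> nat \<Rightarrow> gint" where
  "powY s 0 = 0"
| "powY s (Suc n) = powY s n + powZ s n"
| "powZ s 0 = 0"
| "powZ s (Suc n) = powZ s n + 1 + s * powY s n"

lemma one_plus_power: "(1 + c) ^ n = 1 + c\<^sup>2 * powY (c\<^sup>2) n + c * powZ (c\<^sup>2) n"
proof (induction n)
  case (Suc n)
  have "(1 + c) ^ Suc n = (1 + c) * (1 + c) ^ n"
    by simp
  then show ?case
    unfolding Suc by (simp add: algebra_simps power2_eq_square)
qed simp

text \<open>These are the coefficients in the product of the expansions of (1 + c)^m and (1 + c)^n,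
  with c^2 = s.\<close>

lemma powYZ_add:
  "powY s (m + n) = powY s m + powY s n + s * powY s m * powY s n + powZ s m * powZ s n"
  "powZ s (m + n) = powZ s m + powZ s n + s * (powY s m * powZ s n + powZ s m * powY s n)"
proof (induction n)
  case (Suc n)
  have *: "powY s (m + Suc n) = powY s (m + n) + powZ s (m + n)"
    "powZ s (m + Suc n) = powZ s (m + n) + 1 + s * powY s (m + n)"
    by simp_all
  case 1
  show ?case
    unfolding * Suc by (simp add: algebra_simps)
  case 2
  show ?case
    unfolding * Suc by (simp add: algebra_simps)
qed simp_all

text \<open>Modulo 2 both \<open>s\<close> and \<open>powZ\<close> at even indices vanish, so
  \<open>powY s (2 * t)\<close> is additive in \<open>t\<close> and starts from 1 at index 2. The
  sum in the last clause is \<open>powY\<close> at the odd index 2t + 1.\<close>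

lemma powYZ_even:
  assumes s: "s = 2 * gi * w\<^sup>2"
  shows "\<exists>y z d. powY s (2 * t) = of_nat t + 2 * y \<and> powZ s (2 * t) = 2 * z \<and>
    powY s (2 * t) + powZ s (2 * t) = of_nat t + 2 * d"
proof (induction t)
  case (Suc t)
  then obtain y z d where IH: "powY s (2 * t) = of_nat t + 2 * y" "powZ s (2 * t) = 2 * z" by blast
  have b: "powY s 2 = 1" "powZ s 2 = 2"
    by (simp_all add: numeral_2_eq_2)
  have e: "2 * Suc t = 2 * t + 2"
    by simp
  have Y: "powY s (2 * Suc t) = of_nat (Suc t) + 2 * (y + gi * w\<^sup>2 * (of_nat t + 2 * y) + 2 * z)"
    unfolding e powYZ_add IH b unfolding s by (simp add: algebra_simps)
  have Z: "powZ s (2 * Suc t) = 2 * (z + 1 + gi * w\<^sup>2 * (2 * (of_nat t + 2 * y) + 2 * z))"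
    unfolding e powYZ_add IH b unfolding s by (simp add: algebra_simps)
  show ?case
    unfolding Y Z by (intro exI conjI, rule refl, rule refl)
      (simp only: distrib_left[symmetric] add.assoc)
qed (auto intro!: exI[of _ 0])

text \<open>The invariant that shows that \<open>Y\<^sub>n + Z\<^sub>n\<close> does not vanish when \<open>n = 2Mt\<close> with \<open>M\<close> a power
  of 2 and \<open>t\<close> odd.\<close>

definition pow2_inv :: "gint \<Rightarrow> gint \<Rightarrow> gint \<Rightarrow> nat \<Rightarrow> nat \<Rightarrow> bool" where
  "pow2_inv s w M t n \<longleftrightarrow> (\<exists>y z d. powY s n = M * y \<and> powZ s n = 2 * M * z \<and>
    powY s n + powZ s n = M * (of_nat t * (1 + gi * w\<^sup>2) + 2 * d))"

text \<open>All cross terms of the addition formula are divisible by 2M, as \<open>s\<close> is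
  even; so the cofactor of \<open>M\<close> in the sum is additive modulo 2.\<close>

lemma pow2_inv_add:
  assumes s: "s = 2 * gi * w\<^sup>2" and "pow2_inv s w M t m" "pow2_inv s w M u n"
  shows "pow2_inv s w M (t + u) (m + n)"
proof -
  obtain y z d y' z' d' where
    1: "powY s m = M * y" "powZ s m = 2 * M * z"
      "powY s m + powZ s m = M * (of_nat t * (1 + gi * w\<^sup>2) + 2 * d)" and
    2: "powY s n = M * y'" "powZ s n = 2 * M * z'"
      "powY s n + powZ s n = M * (of_nat u * (1 + gi * w\<^sup>2) + 2 * d')"
    using assms(2,3) unfolding pow2_inv_def by blast
  have "powY s (m + n) = M * (y + y' + s * M * y * y' + 4 * M * z * z')"
    unfolding powYZ_add 1 2 by (simp add: algebra_simps)
  moreover have "powZ s (m + n) = 2 * M * (z + z' + s * M * (y * z' + z * y'))"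
    unfolding powYZ_add 1 2 by (simp add: algebra_simps)
  moreover have "powY s (m + n) + powZ s (m + n) = M * (of_nat (t + u) * (1 + gi * w\<^sup>2) +
    2 * (d + d' + gi * w\<^sup>2 * M * y * y' + 2 * M * z * z' + 2 * gi * w\<^sup>2 * M * (y * z' + z * y')))"
  proof -
    have "powY s (m + n) + powZ s (m + n) = (powY s m + powZ s m) + (powY s n + powZ s n)
      + (s * powY s m * powY s n + powZ s m * powZ s n
         + s * (powY s m * powZ s n + powZ s m * powY s n))"
      unfolding powYZ_add by (simp add: algebra_simps)
    also have "\<dots> = M * (of_nat t * (1 + gi * w\<^sup>2) + 2 * d) + M * (of_nat u * (1 + gi * w\<^sup>2) + 2 * d')
      + (2 * gi * w\<^sup>2 * (M * y) * (M * y') + (2 * M * z) * (2 * M * z')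
         + 2 * gi * w\<^sup>2 * (M * y * (2 * M * z') + (2 * M * z) * (M * y')))"
      unfolding 1(3) 2(3) unfolding 1 2 unfolding s by simp
    also have "\<dots> = M * (of_nat (t + u) * (1 + gi * w\<^sup>2) +
    2 * (d + d' + gi * w\<^sup>2 * M * y * y' + 2 * M * z * z' + 2 * gi * w\<^sup>2 * M * (y * z' + z * y')))"
      by (simp add: algebra_simps)
    finally show ?thesis .
  qed
  ultimately show ?thesis
    unfolding pow2_inv_def by blast
qed

text \<open>Doubling the index doubles \<open>M\<close>. For an extra factor 2 to remain in the
  cross terms, the square of the old \<open>M\<close> must be divisible by 2M, whence the form
  2N.\<close>

lemma pow2_inv_double:
  assumes s: "s = 2 * gi * w\<^sup>2" and "pow2_inv s w (2 * N) t n"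
  shows "pow2_inv s w (4 * N) t (2 * n)"
proof -
  obtain y z d where
    1: "powY s n = 2 * N * y" "powZ s n = 2 * (2 * N) * z"
      "powY s n + powZ s n = 2 * N * (of_nat t * (1 + gi * w\<^sup>2) + 2 * d)"
    using assms(2) unfolding pow2_inv_def by blast
  have nn: "2 * n = n + n" by simp
  have "powY s (2 * n) = 4 * N * (y + gi * w\<^sup>2 * (2 * N) * y * y + 2 * (2 * N) * z * z)"
    unfolding nn powYZ_add 1 unfolding s by (simp add: algebra_simps)
  moreover have "powZ s (2 * n) = 2 * (4 * N) * (z + 2 * gi * w\<^sup>2 * (2 * N) * y * z)"
    unfolding nn powYZ_add 1 unfolding s by (simp add: algebra_simps)
  moreover have "powY s (2 * n) + powZ s (2 * n) = 4 * N * (of_nat t * (1 + gi * w\<^sup>2) +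
    2 * (d + gi * w\<^sup>2 * N * y * y + 2 * N * z * z + 4 * gi * w\<^sup>2 * N * y * z))"
  proof -
    have "powY s (2 * n) + powZ s (2 * n) = 2 * (powY s n + powZ s n)
      + (s * powY s n * powY s n + powZ s n * powZ s n
         + s * (powY s n * powZ s n + powZ s n * powY s n))"
      unfolding nn powYZ_add by (simp add: algebra_simps)
    also have "\<dots> = 2 * (2 * N * (of_nat t * (1 + gi * w\<^sup>2) + 2 * d))
      + (2 * gi * w\<^sup>2 * (2 * N * y) * (2 * N * y) + (2 * (2 * N) * z) * (2 * (2 * N) * z)
         + 2 * gi * w\<^sup>2 * (2 * N * y * (2 * (2 * N) * z) + (2 * (2 * N) * z) * (2 * N * y)))"
      unfolding 1(3) unfolding 1 unfolding s by simp
    also have "\<dots> = 4 * N * (of_nat t * (1 + gi * w\<^sup>2) +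
    2 * (d + gi * w\<^sup>2 * N * y * y + 2 * N * z * z + 4 * gi * w\<^sup>2 * N * y * z))"
      by (simp add: algebra_simps)
    finally show ?thesis .
  qed
  ultimately show ?thesis
    unfolding pow2_inv_def by blast
qed

lemma pow2_inv_power:
  assumes s: "s = 2 * gi * w\<^sup>2"
  shows "pow2_inv s w (2 ^ Suc j) 1 (2 * 2 ^ Suc j)"
proof (induction j)
  case 0
  \<comment> \<open>The start is index 4, not 2, because doubling needs an even \<open>M\<close>.
    The sum here is 10 + 5s, which is 2 times \<open>5 * (1 + gi * w\<^sup>2)\<close>.\<close>
  have "powY s 4 = 6 + s" "powZ s 4 = 4 + 4 * s"
    by (simp_all add: eval_nat_numeral algebra_simps)
  then show ?case
    unfolding pow2_inv_def s
    by (intro exI[of _ "3 + gi * w\<^sup>2"] exI[of _ "1 + s"] exI[of _ "2 * (1 + gi * w\<^sup>2)"])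
      (simp add: s algebra_simps)
next
  case (Suc j)
  then show ?case
    using pow2_inv_double[OF s, of "2 ^ j" 1 "2 * 2 ^ Suc j"] by simp
qed

lemma pow2_inv_multiple:
  assumes s: "s = 2 * gi * w\<^sup>2"
  shows "pow2_inv s w (2 ^ Suc j) (Suc t) (2 * 2 ^ Suc j * Suc t)"
proof (induction t)
  case 0
  then show ?case
    using pow2_inv_power[OF s] by simp
next
  case (Suc t)
  then show ?case
    using pow2_inv_add[OF s Suc pow2_inv_power[OF s]] by (simp add: algebra_simps)
qed

text \<open>The alternatives are (q - 1)/2 odd and (q - 1)/2 even; in the second, the power of 2
  pulled out is the exact one in (q - 1)/2.\<close>

lemma powY_odd_form:
  assumes s: "s = 2 * gi * w\<^sup>2" and "odd q" "q > 1"
  shows "(\<exists>t d. odd t \<and> powY s q = of_nat t + 2 * d) \<or>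
    (\<exists>j t d. odd t \<and> powY s q = 2 ^ Suc j * (of_nat t * (1 + gi * w\<^sup>2) + 2 * d))"
proof -
  obtain k where k: "q = Suc (2 * k)" "k > 0"
    using assms(2,3) by (elim oddE) auto
  obtain t where t: "k = 2 ^ multiplicity 2 k * t" "\<not> 2 dvd t"
    using multiplicity_decompose'[of k 2] k(2) by auto
  have q: "powY s q = powY s (2 * k) + powZ s (2 * k)"
    by (simp add: k(1))
  show ?thesis
  proof (cases "multiplicity 2 k")
    case 0
    then show ?thesis
      using powYZ_even[OF s, of k] t q by auto
  next
    case (Suc j)
    moreover obtain t' where "t = Suc t'"
      using t by (cases t) auto
    ultimately have "2 * k = 2 * 2 ^ Suc j * Suc t'"
      using t(1) by simp
    then have "pow2_inv s w (2 ^ Suc j) t (2 * k)"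
      using pow2_inv_multiple[OF s, of j t'] \<open>t = Suc t'\<close> by simp
    then show ?thesis
      using t(2) unfolding q pow2_inv_def by blast
  qed
qed

text \<open>A unit congruent to 1 modulo 2 is 1 or -1. The value 1 would make \<open>powY\<close>
  vanish, but its cofactor has odd real part, squares having even imaginary part. The value -1 would
  give \<open>gi * w\<^sup>2 * powY s q = -1\<close>, whereas the real part on the left is
  even.\<close>

lemma one_plus_powY_not_unit:
  assumes s: "s = 2 * gi * w\<^sup>2" and "odd q" "q > 1" "w \<noteq> 0"
  shows "\<not> is_unit (1 + s * powY s q)"
proof
  assume unit: "is_unit (1 + s * powY s q)"
  define P where "P = s * powY s q"
  have "2 dvd P"
    unfolding P_def s by (simp add: mult.assoc)
  then have "even (gRe P)" "even (gIm P)"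
    unfolding numeral_dvd_gint_iff by simp_all
  have "is_unit (1 + P)"
    using unit by (simp add: P_def)
  then have "P = 0 \<or> P = -2"
    by (cases rule: gunit_cases)
      (use \<open>even (gRe P)\<close> \<open>even (gIm P)\<close> in \<open>auto simp: gint_eq_iff\<close>)
  then have "s * powY s q = 0 \<or> s * powY s q = -2"
    by (simp add: P_def)
  moreover have R: "even (gIm (w\<^sup>2))"
    by (simp add: power2_eq_square)
  from powY_odd_form[OF assms(1-3)] have "powY s q \<noteq> 0"
  proof (elim disjE exE conjE)
    fix t d assume "odd t" "powY s q = of_nat t + 2 * d"
    then have "odd (gRe (powY s q))"
      by simp
    then show ?thesis
      by auto
  next
    fix j t d assume t: "odd t" "powY s q = 2 ^ Suc j * (of_nat t * (1 + gi * w\<^sup>2) + 2 * d)"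
    have "odd (gRe (of_nat t * (1 + gi * w\<^sup>2) + 2 * d))"
      using t(1) R by simp
    then have "of_nat t * (1 + gi * w\<^sup>2) + 2 * d \<noteq> 0"
      by (metis even_zero gRe_gIm_simps(1))
    then show ?thesis
      using t(2) by simp
  qed
  ultimately have "s * powY s q = -2"
    using s assms(4) by (auto simp: gint_eq_iff[of gi])
  then have "2 * (gi * w\<^sup>2 * powY s q) = 2 * (-1)"
    by (simp add: s mult.assoc)
  then have *: "gi * w\<^sup>2 * powY s q = -1"
    by (metis mult_left_cancel zero_neq_numeral)
  from powY_odd_form[OF assms(1-3)] show False
  proof (elim disjE exE conjE)
    fix t d assume t: "odd t" "powY s q = of_nat t + 2 * d"
    have "even (gRe (gi * w\<^sup>2 * powY s q))"
      using R unfolding t(2) by (simp add: mult.assoc)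
    then show False
      by (simp add: *)
  next
    fix j t d assume t: "odd t" "powY s q = 2 ^ Suc j * (of_nat t * (1 + gi * w\<^sup>2) + 2 * d)"
    then have "2 dvd gi * w\<^sup>2 * powY s q"
      by simp
    then show False
      unfolding * by (simp add: numeral_dvd_gint_iff)
  qed
qed

proposition catalan_odd_base:
  assumes eq: "x\<^sup>2 = y ^ q + 1" and "odd q" "q > 1" and odd: "\<not> gl dvd y"
  shows "x = 0"
proof (rule ccontr)
  assume "x \<noteq> 0"
  have "y \<noteq> 0"
    using odd by auto
  have prod: "(x + 1) * (x - 1) = y ^ q"
    using eq by (simp add: algebra_simps power2_eq_square)
  have "\<not> gl dvd (x + 1) * (x - 1)"
    unfolding prod using odd by simp
  then have x_odd: "\<not> gl dvd x + 1" "\<not> gl dvd x - 1"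
    by auto
  have cop: "coprime (x + 1) (x - 1)"
  proof (rule gint_coprimeI)
    show "x + 1 \<noteq> 0 \<or> x - 1 \<noteq> 0"
      using x_odd by auto
    fix p :: gint
    assume p: "prime_elem p" "p dvd x + 1" "p dvd x - 1"
    have "p dvd (x + 1) - (x - 1)"
      by (rule dvd_diff[OF p(2,3)])
    then have "p dvd 2"
      by simp
    then show False
      using prime_elem_dvd_two p x_odd by blast
  qed
  obtain b where b: "x + 1 = b ^ q"
    using coprime_mult_eq_odd_power[OF cop prod \<open>odd q\<close>] .
  obtain a where a: "x - 1 = a ^ q"
    using coprime_mult_eq_odd_power[of "x - 1" "x + 1" y q] cop prod \<open>odd q\<close>
    by (auto simp: coprime_commute mult.commute)
  have ab_odd: "\<not> gl dvd a" "\<not> gl dvd b"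
    using x_odd a b \<open>odd q\<close> odd_pos by auto
  have two: "(b - a) * gsum b a q = 2"
    unfolding diff_mult_gsum a[symmetric] b[symmetric] by simp
  have "is_unit (gsum b a q)"
  proof -
    have "\<not> gl dvd gsum b a q"
      using gsum_odd ab_odd \<open>odd q\<close> by blast
    then have "coprime (gsum b a q) 2"
      by (intro gint_coprimeI) (auto dest: prime_elem_dvd_two)
    moreover have "gsum b a q dvd 2"
      by (metis two dvd_triv_right)
    ultimately show ?thesis
      using coprime_absorb_left by blast
  qed
  then obtain u where u: "gsum b a q * u = 1"
    by (metis dvd_def)
  have "b - a = 2 * u"
    using two u by (metis mult.assoc mult.commute mult_1)
  define v where "v = gsum b a q"
  have uv: "u * v = 1"
    using u by (simp add: v_def mult.commute)
  \<comment> \<open>\<open>v\<close> is the inverse of \<open>u\<close>, so c is the midpoint of a/u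
    and b/u: after scaling, the two roots are c - 1 and c + 1, and c is even because b is
    odd.\<close>
  define c where "c = v * (a + u)"
  have "a = u * (c - 1)"
    unfolding c_def using uv by (simp add: algebra_simps flip: mult.assoc)
  have "b = u * (c + 1)"
    using \<open>b - a = 2 * u\<close> \<open>a = u * (c - 1)\<close> by (simp add: algebra_simps)
  have "\<not> gl dvd u"
    using uv by (metis dvd_mult2 gl_dvd_simps(1))
  then have "gl dvd c"
    using ab_odd(2) unfolding \<open>b = u * (c + 1)\<close> by (simp add: gl_dvd_add_iff)
  then obtain w where w: "c = gl * w" ..
  have s: "c\<^sup>2 = 2 * gi * w\<^sup>2"
    by (simp add: w power_mult_distrib gl_sq)
  have "2 = b ^ q - a ^ q"
    by (simp flip: a b)
  also have "\<dots> = u ^ q * ((1 + c) ^ q + (1 + (- c)) ^ q)"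
  proof -
    have "a ^ q = - (u ^ q * (1 + (- c)) ^ q)"
      unfolding \<open>a = u * (c - 1)\<close> power_mult_distrib
      using power_minus_odd[OF \<open>odd q\<close>, of "1 - c"] by simp
    moreover have "b ^ q = u ^ q * (1 + c) ^ q"
      unfolding \<open>b = u * (c + 1)\<close> power_mult_distrib by (simp add: add.commute)
    ultimately show ?thesis
      by (simp add: algebra_simps)
  qed
  also have "\<dots> = 2 * (u ^ q * (1 + c\<^sup>2 * powY (c\<^sup>2) q))"
    unfolding one_plus_power by (simp add: algebra_simps)
  finally have "2 * 1 = 2 * (u ^ q * (1 + c\<^sup>2 * powY (c\<^sup>2) q))"
    by simp
  then have *: "u ^ q * (1 + c\<^sup>2 * powY (c\<^sup>2) q) = 1"
    by (metis mult_left_cancel zero_neq_numeral)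
  then have "is_unit (1 + c\<^sup>2 * powY (c\<^sup>2) q)"
    by (metis dvd_triv_right)
  then have "w = 0"
    using one_plus_powY_not_unit[OF s \<open>odd q\<close> \<open>q > 1\<close>] by blast
  then have "c = 0"
    by (simp add: w)
  \<comment> \<open>With c = 0 one has b = u, and the identity above reduces to u^q = 1; then x + 1
    = b^q = 1.\<close>
  then have "b ^ q = 1"
    using * \<open>b = u * (c + 1)\<close> by simp
  then show False
    using b \<open>x \<noteq> 0\<close> by simp
qed

section \<open>Descent lemmas for even \<open>y\<close>\<close>

lemma odd_square_coords:
  assumes "\<not> gl dvd z"
  shows "odd (gRe (z\<^sup>2))" "4 dvd gIm (z\<^sup>2)"
proof -
  obtain e k where k: "e = 1 \<or> e = -1" "z\<^sup>2 = e * (1 + 4 * gl * k)"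
    using odd_square_gint[OF assms] by blast
  then have "z\<^sup>2 = e + 4 * (e * gl * k)"
    by (simp add: algebra_simps)
  with k(1) show "odd (gRe (z\<^sup>2))" "4 dvd gIm (z\<^sup>2)"
    by auto
qed

lemma odd_fourth_coords:
  assumes "\<not> gl dvd z"
  shows "gRe (z ^ 4) mod 8 = 1" "gIm (z ^ 4) mod 8 = 0"
proof -
  obtain k where k: "z ^ 4 = 1 + 8 * (gl * k)"
    using odd_fourth_gint[OF assms] by (metis mult.assoc)
  show "gRe (z ^ 4) mod 8 = 1" "gIm (z ^ 4) mod 8 = 0"
    unfolding k by (simp; presburger)+
qed

lemma even_gIm_square: "even (gIm (z\<^sup>2))"
  by (simp add: power2_eq_square)

lemma gnorm_mod_4: "gnorm z mod 4 \<noteq> 3"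
proof -
  have "n\<^sup>2 mod 4 = 0 \<or> n\<^sup>2 mod 4 = 1" for n :: int
  proof (cases "even n")
    case True
    then show ?thesis by (auto simp: power_mult_distrib elim!: evenE)
  next
    case False
    then obtain k where "n = 2 * k + 1" by (elim oddE)
    then have "n\<^sup>2 = 4 * (k\<^sup>2 + k) + 1" by (simp add: power2_eq_square algebra_simps)
    then show ?thesis by presburger
  qed
  from this[of "gRe z"] this[of "gIm z"] show ?thesis
    unfolding gnorm_def by presburger
qed

text \<open>The product of the two units is the fourth power of a unit, hence 1. So the units are
  inverse to each other, and only four pairs have to be considered in the descents.\<close>

lemma coprime_mult_eq_fourth_power:
  fixes F G z :: gint
  assumes "coprime G F" "G * F = z ^ 4" "z \<noteq> 0"
  obtains u v r s where "u * v = 1" "z = r * s" "G = u * r ^ 4" "F = v * s ^ 4"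
proof -
  obtain u r where r: "is_unit u" "G = u * r ^ 4"
    using coprime_mult_eq_power[OF assms(1,2)] by auto
  obtain v s where s: "is_unit v" "F = v * s ^ 4"
    using coprime_mult_eq_power[of F G z 4] assms(1,2) by (auto simp: coprime_commute mult.commute)
  have eq: "z ^ 4 = (u * v) * (r * s) ^ 4"
    using assms(2) r s by (simp add: power_mult_distrib algebra_simps)
  then have "(r * s) ^ 4 dvd z ^ 4"
    by simp
  then have "r * s dvd z"
    by simp
  then obtain e where e: "z = r * s * e" ..
  have rs: "r * s \<noteq> 0"
    using e assms(3) by auto
  then have e4: "e ^ 4 = u * v"
    using eq unfolding e power_mult_distrib[of "r * s"] by simp
  have "is_unit (u * v)"
    using r(1) s(1) by (rule unit_prod)
  then have "is_unit e"
    by (metis e4 is_unit_power_iff zero_neq_numeral)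
  then have "e ^ 4 = 1"
    by (cases e rule: gunit_cases) (simp_all add: eval_nat_numeral gint_eq_iff)
  then show ?thesis
    using that[of u v "r * e" s] e e4 r(2) s(2) by (simp add: power_mult_distrib mult_ac)
qed

text \<open>Here x = 2X + 1 and 4X(X + 1) = y^q. Exactly one of X and X + 1 is odd, and it is
  coprime to 4 times the other; the sign of x is chosen so that the odd one is (x' + 1)/2.\<close>

lemma catalan_even_base_decomp:
  assumes eq: "x\<^sup>2 = y ^ q + 1" and "odd q" "q \<ge> 3" and even: "gl dvd y"
  obtains a B x' where "x' = x \<or> x' = - x" "x' = 2 * a ^ q - 1" "B ^ q = 4 * (a ^ q - 1)"
    "y = a * B" "\<not> gl dvd a"
proof -
  have core: "\<exists>a B. A = a ^ q \<and> B ^ q = 4 * (a ^ q - 1) \<and> y = a * B \<and> \<not> gl dvd a"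
    if A: "4 * A * (A - 1) = y ^ q" "\<not> gl dvd A" for A
  proof -
    have "coprime A (4 * (A - 1))"
    proof (rule gint_coprimeI)
      show "A \<noteq> 0 \<or> 4 * (A - 1) \<noteq> 0"
        by auto
      fix p :: gint
      assume p: "prime_elem p" "p dvd A" "p dvd 4 * (A - 1)"
      have "\<not> p dvd 2"
        using prime_elem_dvd_two[OF p(1)] p(2) A(2) by blast
      moreover have "(4 :: gint) = 2 * 2"
        by simp
      ultimately have "\<not> p dvd 4"
        using p(1) by (metis prime_elem_dvd_mult_iff)
      then have "p dvd A - 1"
        using p(3) prime_elem_dvd_mult_iff[OF p(1)] by blast
      then have "p dvd A - (A - 1)"
        using p(2) by (rule dvd_diff[rotated])
      then show False
        using p(1) by (simp add: prime_elem_not_unit)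
    qed
    moreover have "A * (4 * (A - 1)) = y ^ q"
      using A(1) by (simp add: algebra_simps)
    ultimately obtain a B where ab: "A = a ^ q" "4 * (A - 1) = B ^ q"
      using coprime_mult_eq_odd_power[of A "4 * (A - 1)" y q]
        coprime_mult_eq_odd_power[of "4 * (A - 1)" A y q] \<open>odd q\<close>
      by (metis coprime_commute mult.commute)
    have "y ^ q = (a * B) ^ q"
      using \<open>A * (4 * (A - 1)) = y ^ q\<close> ab by (simp add: power_mult_distrib)
    then have "y = a * B"
      using odd_power_inject_gint \<open>odd q\<close> by blast
    moreover have "\<not> gl dvd a"
      using A(2) ab(1) odd_pos[OF \<open>odd q\<close>] by auto
    ultimately show ?thesis
      using ab by metis
  qed
  have prod: "(x - 1) * (x + 1) = y ^ q"
    using eq by (simp add: algebra_simps power2_eq_square)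
  have "gl dvd y ^ q"
    using even \<open>q \<ge> 3\<close> by simp
  then have "gl dvd x - 1"
    using prod by (metis gl_dvd_mult_iff gl_dvd_add_iff gl_dvd_diff_iff)
  then obtain P where P: "x - 1 = gl * P" ..
  have "x + 1 = gl * P + 2"
    by (simp flip: P)
  then have P': "x + 1 = gl * (P + (1 - gi))"
    by (simp add: algebra_simps two_eq_gl(1))
  \<comment> \<open>The bound on q enters here: three factors \<open>gl\<close> in the product of x
    - 1 and x + 1 lift the divisibility of x - 1 from \<open>gl\<close> to 2.\<close>
  have "gl ^ 3 dvd y ^ q"
    using even \<open>q \<ge> 3\<close> by (meson dvd_power_same dvd_trans le_imp_power_dvd)
  then have "gl\<^sup>2 * gl dvd gl\<^sup>2 * (P * (P + (1 - gi)))"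
    using prod unfolding P P' by (simp add: power2_eq_square power3_eq_cube mult_ac)
  then have "gl dvd P * (P + (1 - gi))"
    by (subst (asm) dvd_times_left_cancel_iff) (auto simp: gl_sq gint_eq_iff)
  then have "gl dvd P"
    by (auto simp: gl_dvd_iff)
  then obtain P2 where "P = gl * P2" ..
  then have X: "x - 1 = 2 * (gi * P2)"
    using P gl_sq by (metis mult.assoc power2_eq_square)
  define X where "X = gi * P2"
  have x: "x = 2 * X + 1"
    using X by (simp add: X_def algebra_simps)
  have yq: "4 * (X + 1) * X = y ^ q"
    using prod by (simp add: x algebra_simps)
  show ?thesis
  proof (cases "gl dvd X")
    case True
    then have "\<exists>a B. X + 1 = a ^ q \<and> B ^ q = 4 * (a ^ q - 1) \<and> y = a * B \<and> \<not> gl dvd a"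
      using yq by (intro core) (simp_all add: gl_dvd_add_iff)
    then obtain a B where "X + 1 = a ^ q" "B ^ q = 4 * (a ^ q - 1)" "y = a * B" "\<not> gl dvd a"
      by blast
    then show ?thesis
      using that[of x a B] x by (simp add: algebra_simps flip: \<open>X + 1 = a ^ q\<close>)
  next
    case False
    have "\<exists>a B. - X = a ^ q \<and> B ^ q = 4 * (a ^ q - 1) \<and> y = a * B \<and> \<not> gl dvd a"
      using False by (intro core) (simp_all add: algebra_simps flip: yq)
    then obtain a B where "- X = a ^ q" "B ^ q = 4 * (a ^ q - 1)" "y = a * B" "\<not> gl dvd a"
      by blast
    then show ?thesis
      using that[of "-x" a B] x by (simp add: algebra_simps flip: \<open>- X = a ^ q\<close>)
  qed
qed

subsection \<open>A Pell equation\<close>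

text \<open>Modelled on the powers X + Y sqrt(y) of the fundamental solution z + sqrt(y): for even y
  the parity of Y is that of the exponent, and even exponents have z dividing Y, odd ones z dividing
  X.\<close>

definition pell_parity :: "gint \<Rightarrow> gint \<Rightarrow> gint \<Rightarrow> bool" where
  "pell_parity z X Y \<longleftrightarrow> z dvd Y \<and> gl dvd Y \<or> z dvd X \<and> \<not> gl dvd Y"

text \<open>\<open>X'\<close> and \<open>Y'\<close> are the coordinates of (X + Y sqrt(y))(z -
  sqrt(y)). Multiplying back by z + sqrt(y) interchanges the two alternatives, because
  \<open>X'\<close> is odd.\<close>

lemma pell_parity_step:
  assumes y: "y = z\<^sup>2 - 1" "gl dvd y" and eq: "X\<^sup>2 = y * Y\<^sup>2 + 1"
    and X': "X' = z * X - y * Y" and Y': "Y' = z * Y - X"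
    and IH: "X'\<^sup>2 = y * Y'\<^sup>2 + 1 \<Longrightarrow> pell_parity z X' Y'"
  shows "pell_parity z X Y"
proof -
  have z_odd: "\<not> gl dvd z"
    using y by (auto simp: gl_dvd_diff_iff)
  have "X'\<^sup>2 - y * Y'\<^sup>2 = (z\<^sup>2 - y) * (X\<^sup>2 - y * Y\<^sup>2)"
    unfolding X' Y' by (simp add: power2_eq_square algebra_simps)
  then have eq': "X'\<^sup>2 = y * Y'\<^sup>2 + 1"
    using eq by (simp add: y(1) algebra_simps)
  have X: "X = z * X' + y * Y'" and Y: "Y = X' + z * Y'"
    unfolding X' Y' y(1) by (simp_all add: power2_eq_square algebra_simps)
  have X'_odd: "\<not> gl dvd X'"
  proof
    assume "gl dvd X'"
    then have "gl dvd y * Y'\<^sup>2 + 1"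
      unfolding eq'[symmetric] by simp
    then show False
      using y(2) by (simp add: gl_dvd_add_iff)
  qed
  from IH[OF eq'] show ?thesis
    unfolding pell_parity_def
  proof (elim disjE conjE)
    assume "z dvd Y'" "gl dvd Y'"
    then have "z dvd X" "\<not> gl dvd Y"
      using X'_odd unfolding X Y by (auto simp: gl_dvd_add_iff)
    then show "z dvd Y \<and> gl dvd Y \<or> z dvd X \<and> \<not> gl dvd Y"
      by blast
  next
    assume "z dvd X'" "\<not> gl dvd Y'"
    then have "z dvd Y" "gl dvd Y"
      using X'_odd z_odd unfolding Y by (auto simp: gl_dvd_add_iff)
    then show "z dvd Y \<and> gl dvd Y \<or> z dvd X \<and> \<not> gl dvd Y"
      by blast
  qed
qed

text \<open>One of the two neighbours of a solution has smaller \<open>Y\<close>, since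
  \<open>(zY - X)(zY + X) = Y\<^sup>2 - 1\<close> while the factors have sum \<open>2zY\<close>.\<close>

lemma pell_descent:
  assumes y: "y = z\<^sup>2 - 1" "gl dvd y" and z: "gnorm z \<ge> 3"
    and eq: "X\<^sup>2 = y * Y\<^sup>2 + 1"
  shows "pell_parity z X Y"
  using eq
proof (induction "nat (gnorm Y)" arbitrary: X Y rule: less_induct)
  case less
  show ?case
  proof (cases "Y = 0")
    case True
    then show ?thesis
      by (simp add: pell_parity_def)
  next
    case False
    define M where "M = gnorm Y"
    have M: "M \<ge> 1"
      using False gnorm_ge_1 by (simp add: M_def)
    define a where "a = gnorm (z * Y - X)"
    define b where "b = gnorm (z * Y + X)"
    have "(z * Y - X) * (z * Y + X) = Y\<^sup>2 - 1"
      using less.prems by (simp add: y(1) power2_eq_square algebra_simps)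
    then have "a * b = gnorm (Y\<^sup>2 - 1)"
      unfolding a_def b_def by (simp flip: gnorm_mult)
    also have "\<dots> \<le> (M + 1)\<^sup>2"
    proof -
      have "(M + 1)\<^sup>2 - gnorm (Y\<^sup>2 - 1) = 4 * (gRe Y)\<^sup>2"
        by (simp add: M_def gnorm_def power2_eq_square algebra_simps)
      moreover have "(gRe Y)\<^sup>2 \<ge> 0"
        by simp
      ultimately show ?thesis
        by linarith
    qed
    finally have ab: "a * b \<le> (M + 1)\<^sup>2" .
    have "a + b = 2 * (gnorm z * M) + 2 * gnorm X"
      unfolding a_def b_def M_def parallelogram_gnorm by (simp add: gnorm_mult)
    moreover have "gnorm z * M \<ge> 3 * M"
      using z M by (intro mult_right_mono) auto
    ultimately have sum: "a + b \<ge> 6 * M"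
      using gnorm_nonneg[of X] by linarith
    \<comment> \<open>If both norms were at least M, their product would be at least M(a + b - M),
      so at least 5M^2, which exceeds (M + 1)^2.\<close>
    have "a < M \<or> b < M"
    proof (rule ccontr)
      assume "\<not> (a < M \<or> b < M)"
      then have "(a - M) * (b - M) \<ge> 0"
        by (intro mult_nonneg_nonneg) auto
      then have "a * b \<ge> M * (a + b) - M * M"
        by (simp add: algebra_simps)
      moreover have "M * (a + b) \<ge> M * (6 * M)"
        using sum M by (intro mult_left_mono) auto
      ultimately have "5 * (M * M) \<le> (M + 1)\<^sup>2"
        using ab by simp
      moreover have "(M + 1)\<^sup>2 = M * M + 2 * M + 1"
        by (simp add: power2_eq_square algebra_simps)
      moreover have "M * M \<ge> M"
        using M by simp
      ultimately show False
        using M by linarith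
    qed
    then show ?thesis
    proof
      assume "a < M"
      then show ?thesis
        using less.hyps[of "z * Y - X" "z * X - y * Y"] M
        by (intro pell_parity_step[OF y less.prems refl refl]) (simp add: a_def M_def False)
    next
      assume "b < M"
      have eq2: "(- X)\<^sup>2 = y * Y\<^sup>2 + 1"
        using less.prems by simp
      have "pell_parity z (- X) Y"
        using less.hyps[of "z * Y - (- X)" "z * (- X) - y * Y"] M \<open>b < M\<close>
        by (intro pell_parity_step[OF y eq2 refl refl]) (simp add: b_def M_def False)
      then show ?thesis
        by (simp add: pell_parity_def)
    qed
  qed
qed

text \<open>With q = 2k + 1 the pair (x, y^k) solves the Pell equation with even second coordinate,
  so z divides a power of z^2 - 1 and is a unit. This leaves y = -2 and x^2 = 1 - 2^q, where a
  purely imaginary x would have norm 3 modulo 4.\<close>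

lemma catalan_pell:
  assumes eq: "x\<^sup>2 = y ^ q + 1" and "odd q" "q \<ge> 3" and y: "y = z\<^sup>2 - 1" "gl dvd y"
  shows "y = 0"
proof (rule ccontr)
  assume "y \<noteq> 0"
  obtain k where q: "q = 2 * k + 1"
    using \<open>odd q\<close> by (auto elim: oddE)
  have z_odd: "\<not> gl dvd z"
    using y by (auto simp: gl_dvd_diff_iff)
  have nunit: "\<not> is_unit z"
  proof
    assume "is_unit z"
    then have "z\<^sup>2 = 1 \<or> z\<^sup>2 = -1"
      by (cases z rule: gunit_cases) (auto simp: gi_sq)
    then have "y = -2"
      using \<open>y \<noteq> 0\<close> y by auto
    then have x: "x\<^sup>2 = of_int (1 - 2 ^ q)"
      using eq \<open>odd q\<close> by simp
    have "gRe (x\<^sup>2) = 1 - 2 ^ q" "gIm (x\<^sup>2) = 0"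
      unfolding x by (simp_all del: of_int_diff of_int_power)
    then have re: "(gRe x)\<^sup>2 - (gIm x)\<^sup>2 = 1 - 2 ^ q" and "gRe x = 0 \<or> gIm x = 0"
      by (auto simp: power2_eq_square)
    moreover have "(2 :: int) ^ q = 4 * 2 ^ (q - 2)"
      using \<open>q \<ge> 3\<close> by (subst le_add_diff_inverse[of 2 q, symmetric]) (simp_all add: power_add)
    ultimately consider "gnorm x = 4 * 2 ^ (q - 2) - 1" | "(gRe x)\<^sup>2 = 1 - 4 * 2 ^ (q - 2)"
      by (auto simp: gnorm_def)
    then show False
    proof cases
      case 1
      then show False
        using gnorm_mod_4[of x] by presburger
    next
      case 2
      moreover have "(2 :: int) ^ (q - 2) \<ge> 1"
        by simp
      ultimately show False
        using zero_le_power2[of "gRe x"] by linarith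
    qed
  qed
  have "gnorm z \<noteq> 1" "odd (gnorm z)" "z \<noteq> 0"
    using nunit z_odd by (auto simp: gunit_iff_gnorm gl_dvd_gnorm)
  then have "gnorm z \<ge> 3"
    using gnorm_ge_1[of z] by presburger
  moreover have "x\<^sup>2 = y * (y ^ k)\<^sup>2 + 1"
    using eq by (simp add: q power_mult mult.commute flip: power_mult)
  ultimately have "pell_parity z x (y ^ k)"
    using pell_descent y by blast
  moreover have "gl dvd y ^ k"
    using y(2) q \<open>q \<ge> 3\<close> by simp
  ultimately have "z dvd y ^ k"
    by (simp add: pell_parity_def)
  moreover have "coprime z (y ^ k)"
  proof -
    have "coprime z (z * z - 1)"
    proof (rule coprimeI)
      fix c
      assume "c dvd z" "c dvd z * z - 1"
      then have "c dvd z * z - (z * z - 1)"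
        by (meson dvd_diff dvd_mult2)
      then show "is_unit c"
        by simp
    qed
    then show ?thesis
      by (simp add: y(1) power2_eq_square)
  qed
  ultimately show False
    using nunit coprime_absorb_left by blast
qed

subsection \<open>A size argument\<close>

text \<open>The assumption on primes above q makes a^2 - B coprime to its cofactor \<open>T\<close>,
  since a common prime divides q or B. A square a^2 - B then factors B into two even elements,
  forcing the norm of B up to 4 times that of a, too much for B^q = 4(a^q - 1).\<close>

lemma catalan_no_common_q:
  assumes eq: "B ^ q = 4 * (a ^ q - 1)" and "odd q" "q \<ge> 5" and B: "2 dvd B" "B \<noteq> 0"
    and a: "\<not> gl dvd a"
    and q: "\<And>p. prime_elem p \<Longrightarrow> p dvd of_nat q \<Longrightarrow> \<not> p dvd a ^ q - 2"
  shows False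
proof -
  define T where "T = gsum (a\<^sup>2) B q"
  have "(a\<^sup>2 - B) * T = (a ^ q)\<^sup>2 - 4 * (a ^ q - 1)"
    unfolding T_def diff_mult_gsum eq by (simp add: power_mult mult.commute flip: power_mult)
  then have prod: "(a\<^sup>2 - B) * T = (a ^ q - 2)\<^sup>2"
    by (simp add: power2_eq_square algebra_simps)
  have B': "gl dvd B" "even (gIm B)" "even (gRe B)"
    using B(1) unfolding numeral_dvd_gint_iff by (auto simp: gl_dvd_iff)
  have odd_d: "\<not> gl dvd a\<^sup>2 - B"
    using B' a by (simp add: gl_dvd_diff_iff)
  obtain n where n: "q = Suc n"
    using \<open>q \<ge> 5\<close> by (cases q) auto
  have "coprime (a\<^sup>2 - B) T"
  proof (rule gint_coprimeI)
    show "a\<^sup>2 - B \<noteq> 0 \<or> T \<noteq> 0"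
      using odd_d by auto
    fix p :: gint
    assume p: "prime_elem p" "p dvd a\<^sup>2 - B" "p dvd T"
    obtain W where "T = of_nat q * B ^ n + (a\<^sup>2 - B) * W"
      using gsum_cong_linear[of "a\<^sup>2" B n] unfolding T_def n by blast
    then have "p dvd of_nat q * B ^ n"
      using p(2,3) by (metis dvd_add_left_iff dvd_mult2)
    then consider "p dvd of_nat q" | "p dvd B"
      using p(1) by (auto simp: prime_elem_dvd_mult_iff dest: prime_elem_dvd_power)
    then show False
    proof cases
      case 1
      have "p dvd (a ^ q - 2)\<^sup>2"
        using p(2) unfolding prod[symmetric] by simp
      then show False
        using q[OF p(1) 1] prime_elem_dvd_power[OF p(1)] by blast
    next
      case 2
      then have "p dvd a\<^sup>2"
        using p(2) by (metis diff_add_cancel dvd_add)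
      then have pa: "p dvd a"
        using prime_elem_dvd_power[OF p(1)] by blast
      have "p dvd B ^ q" "p dvd a ^ q"
        using 2 pa n by simp_all
      then have "p dvd 4 * a ^ q - B ^ q"
        by (intro dvd_diff) auto
      then have "p dvd 2 * 2"
        unfolding eq by (simp add: algebra_simps)
      then have "p dvd 2"
        using p(1) by (metis prime_elem_dvd_mult_iff)
      then show False
        using prime_elem_dvd_two[OF p(1) _ pa] a by blast
    qed
  qed
  then obtain u w where u: "is_unit u" "a\<^sup>2 - B = u * w\<^sup>2"
    using coprime_mult_eq_power[OF _ prod] by auto
  have w_odd: "\<not> gl dvd w"
    using odd_d u(2) by auto
  have "even (gIm (u * w\<^sup>2))"
    unfolding u(2)[symmetric] using B' even_gIm_square[of a] by simp
  with odd_square_coords(1)[OF w_odd] have "u \<noteq> gi" "u \<noteq> - gi"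
    by auto
  then have "u = 1 \<or> u = -1"
    using u(1) by (simp add: gunit_iff)
  then obtain w' where w': "a\<^sup>2 - B = w'\<^sup>2"
    using u(2) by (metis gi_sq mult_1 power_mult_distrib)
  have w'_odd: "\<not> gl dvd w'"
    using odd_d w' by simp
  \<comment> \<open>Both norms are even and positive, hence at least 2, so their product is at least
    2(n1 + n2) - 4; the parallelogram law evaluates the sum.\<close>
  define n1 n2 where "n1 = gnorm (a - w')" and "n2 = gnorm (a + w')"
  have "(a - w') * (a + w') = B"
    using w' by (simp add: power2_eq_square algebra_simps)
  then have n12: "n1 * n2 = gnorm B" "a - w' \<noteq> 0" "a + w' \<noteq> 0"
    using B(2) unfolding n1_def n2_def by (auto simp flip: gnorm_mult)
  have "even n1" "even n2"
    using a w'_odd unfolding n1_def n2_def gl_dvd_gnorm[symmetric]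
    by (simp_all add: gl_dvd_diff_iff gl_dvd_add_iff)
  moreover have "n1 \<ge> 1" "n2 \<ge> 1"
    using n12 gnorm_ge_1 by (simp_all add: n1_def n2_def)
  ultimately have "n1 \<ge> 2" "n2 \<ge> 2"
    by presburger+
  then have "(n1 - 2) * (n2 - 2) \<ge> 0"
    by simp
  then have "gnorm B \<ge> 2 * (n1 + n2) - 4"
    unfolding n12(1)[symmetric] by (simp add: algebra_simps)
  moreover have "n1 + n2 = 2 * gnorm a + 2 * gnorm w'"
    unfolding n1_def n2_def by (rule parallelogram_gnorm)
  moreover have "gnorm w' \<ge> 1"
    using w'_odd by (intro gnorm_ge_1) auto
  ultimately have big: "gnorm B \<ge> 4 * gnorm a"
    by simp
  define A where "A = gnorm a ^ q"
  have "A \<ge> 1"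
    unfolding A_def using a by (intro one_le_power gnorm_ge_1) auto
  \<comment> \<open>Comparing norms of q-th powers: 16 comes from the norm of 4, and the norm of a^q
    - 1 is at most 4A. The resulting bound, 4^q at most 64, still allows q = 3.\<close>
  have "4 ^ q * A = (4 * gnorm a) ^ q"
    by (simp add: A_def power_mult_distrib)
  also have "\<dots> \<le> gnorm B ^ q"
    using big by (intro power_mono) auto
  also have "\<dots> = 16 * gnorm (a ^ q - 1)"
    unfolding gnorm_power[symmetric] eq gnorm_mult by simp
  also have "\<dots> \<le> 64 * A"
    using parallelogram_gnorm[of "a ^ q" 1] gnorm_nonneg[of "a ^ q + 1"] \<open>A \<ge> 1\<close>
    unfolding A_def gnorm_power gnorm_simps by linarith
  finally have "4 ^ q * A \<le> 64 * A" .
  then have "(4 :: int) ^ q \<le> 64"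
    using \<open>A \<ge> 1\<close> by simp
  moreover have "(4 :: int) ^ 5 \<le> 4 ^ q"
    using \<open>q \<ge> 5\<close> by (intro power_increasing) auto
  ultimately show False
    by simp
qed

subsection \<open>The exponent 3\<close>

lemma prime_elem_3: "prime_elem (3 :: gint)"
proof -
  have "irreducible (3 :: gint)"
  proof (rule irreducibleI)
    fix a b :: gint
    assume ab: "3 = a * b"
    have "gnorm a * gnorm b = 9"
      unfolding gnorm_mult[symmetric] ab[symmetric] by simp
    moreover from this have "gnorm a > 0" "gnorm b > 0"
      using ab by auto
    moreover from calculation have "gnorm a \<le> 9"
      using mult_left_mono[of 1 "gnorm b" "gnorm a"] by linarith
    ultimately have "gnorm a \<in> {1, 3, 9}"
    proof -
      assume *: "gnorm a * gnorm b = 9" "gnorm a > 0" "gnorm a \<le> 9"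
      then have "gnorm a \<in> {1..9}"
        by (simp del: gnorm_pos_iff)
      also have "{1..9} = {1, 2, 3, 4, 5, 6, 7, 8, 9 :: int}"
        by auto
      finally have "gnorm a \<in> {1, 2, 3, 4, 5, 6, 7, 8, 9}" .
      with *(1) show ?thesis
        by (elim insertE emptyE; simp) presburger+
    qed
    moreover have "gnorm a \<noteq> 3"
      using gnorm_mod_4[of a] by auto
    ultimately show "is_unit a \<or> is_unit b"
      using \<open>gnorm a * gnorm b = 9\<close> by (auto simp: gunit_iff_gnorm)
  qed (auto simp: gunit_iff_gnorm)
  then show ?thesis
    by (simp add: prime_elem_iff_irreducible)
qed

lemma gunit_pair_cases:
  assumes "u * v = (1 :: gint)"
  obtains "u = 1" "v = 1" | "u = -1" "v = -1" | "u = gi" "v = -gi" | "u = -gi" "v = gi"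
proof -
  have "is_unit u"
    using assms by (metis dvd_triv_left)
  then show ?thesis
    using assms that by (cases u rule: gunit_cases) (auto simp: gint_eq_iff)
qed

lemma coprime_mult_eq_3_fourth_power:
  fixes F G z :: gint
  assumes "coprime F G" "F * G = 3 * z ^ 4" "z \<noteq> 0"
  obtains u v r s where "u * v = 1" "z = r * s" "\<not> 3 dvd s" "coprime r s"
    "F = 3 * u * r ^ 4 \<and> G = v * s ^ 4 \<or> G = 3 * u * r ^ 4 \<and> F = v * s ^ 4"
proof -
  have main: "\<exists>u v r s. u * v = 1 \<and> z = r * s \<and> \<not> 3 dvd s \<and> coprime r s \<and>
      F = 3 * u * r ^ 4 \<and> G = v * s ^ 4"
    if cop: "coprime F G" and eq: "F * G = 3 * z ^ 4" and "3 dvd F" for F G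
  proof -
    obtain H where H: "F = 3 * H"
      using \<open>3 dvd F\<close> ..
    have "coprime H G"
      using cop unfolding H by simp
    moreover have "H * G = z ^ 4"
      using eq unfolding H by simp
    ultimately obtain u v r s where uv: "u * v = 1" "z = r * s" "H = u * r ^ 4" "G = v * s ^ 4"
      using coprime_mult_eq_fourth_power[of H G z] \<open>z \<noteq> 0\<close> by metis
    have "\<not> 3 dvd s"
    proof
      assume "3 dvd s"
      then have "3 dvd G"
        unfolding uv(4) by (intro dvd_mult) (simp add: prime_elem_dvd_power_iff[OF prime_elem_3])
      then have "is_unit (3 :: gint)"
        using cop \<open>3 dvd F\<close> by (meson coprime_common_divisor)
      then show False
        by (simp add: gunit_iff_gnorm)
    qed
    moreover have "coprime r s"
      using \<open>coprime H G\<close> unfolding uv(3,4) by simp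
    ultimately show ?thesis
      using uv H by (intro exI[of _ u] exI[of _ v] exI[of _ r] exI[of _ s]) (simp add: mult.assoc)
  qed
  have "3 dvd F * G"
    using assms(2) by simp
  then consider "3 dvd F" | "3 dvd G"
    using prime_elem_3 by (auto simp: prime_elem_dvd_mult_iff)
  then show ?thesis
  proof cases
    case 1
    then show ?thesis
      using main[OF assms(1,2)] that by blast
  next
    case 2
    then show ?thesis
      using main[of G F] assms(1,2) that by (metis coprime_commute mult.commute)
  qed
qed

lemma gunit_square: "is_unit (u :: gint) \<Longrightarrow> u\<^sup>2 = 1 \<or> u\<^sup>2 = -1"
  by (cases u rule: gunit_cases) (auto simp: gi_sq)

lemma gunit_pow4: "is_unit (u :: gint) \<Longrightarrow> u ^ 4 = 1"
  by (cases u rule: gunit_cases) (auto simp: eval_nat_numeral gint_eq_iff)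

text \<open>With m^2 = \<delta> of square 1, completing the square gives (2s)^2 - (2n^2 -
  3\<delta>)^2 = 3, and 3 is prime: only finitely many factorizations remain, sorted out by
  congruences.\<close>

lemma quartic_3_unit_case:
  assumes eq: "s\<^sup>2 = 3 * m ^ 4 - 3 * m\<^sup>2 * n\<^sup>2 + n ^ 4" and "is_unit m" and "\<not> gl dvd n"
  shows "is_unit n \<and> is_unit s"
proof -
  obtain \<delta> where \<delta>: "m\<^sup>2 = \<delta>" "\<delta> = 1 \<or> \<delta> = -1"
    using gunit_square[OF \<open>is_unit m\<close>] by blast
  have m4: "m ^ 4 = 1"
    by (rule gunit_pow4[OF \<open>is_unit m\<close>])
  have \<delta>2: "\<delta> * \<delta> = 1"
    using \<delta>(2) by auto
  have n4: "n ^ 4 = n\<^sup>2 * n\<^sup>2"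
    by (simp add: power2_eq_square eval_nat_numeral)
  have s: "s\<^sup>2 = 3 - 3 * \<delta> * n\<^sup>2 + n\<^sup>2 * n\<^sup>2"
    using eq unfolding m4 \<delta>(1) n4 by simp
  define P where "P = 2 * s - (2 * n\<^sup>2 - 3 * \<delta>)"
  define Q where "Q = 2 * s + (2 * n\<^sup>2 - 3 * \<delta>)"
  have "P * Q = 4 * s\<^sup>2 - 4 * (n\<^sup>2 * n\<^sup>2) + 12 * \<delta> * n\<^sup>2 - 9 * (\<delta> * \<delta>)"
    unfolding P_def Q_def by (simp add: power2_eq_square algebra_simps)
  then have PQ: "P * Q = 3"
    unfolding s \<delta>2 by (simp add: algebra_simps)
  have diff: "Q - P = 4 * n\<^sup>2 - 6 * \<delta>"
    unfolding P_def Q_def by simp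
  have "is_unit P \<or> is_unit Q"
    using irreducibleD[OF prime_elem_imp_irreducible[OF prime_elem_3]] PQ by metis
  then obtain u v where uv: "u * v = 1" "4 * n\<^sup>2 - 6 * \<delta> = 3 * v - u \<or> 4 * n\<^sup>2 - 6 * \<delta> = u - 3 * v"
  proof
    assume "is_unit P"
    then obtain v where v: "P * v = 1"
      by (metis dvdE)
    then have "Q = 3 * v"
      using PQ by (metis mult.assoc mult.commute mult_1)
    then show ?thesis
      using that[of P v] v diff by auto
  next
    assume "is_unit Q"
    then obtain v where v: "Q * v = 1"
      by (metis dvdE)
    then have "P = 3 * v"
      using PQ by (metis mult.assoc mult.commute mult_1)
    then show ?thesis
      using that[of Q v] v diff by auto
  qed
  have odd_n: "odd (gRe (n\<^sup>2))" "4 dvd gIm (n\<^sup>2)"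
    using odd_square_coords assms(3) by auto
  have "n\<^sup>2 = 1 \<or> n\<^sup>2 = -1"
    using uv(1)
  proof (cases rule: gunit_pair_cases)
    case 1
    then show ?thesis
      using uv(2) \<delta>(2) odd_n by (auto simp: gint_eq_iff; presburger)
  next
    case 2
    then show ?thesis
      using uv(2) \<delta>(2) odd_n by (auto simp: gint_eq_iff; presburger)
  next
    case 3
    have False
      using uv(2) \<delta>(2) odd_n unfolding 3 by (auto simp: gint_eq_iff; presburger)
    then show ?thesis ..
  next
    case 4
    have False
      using uv(2) \<delta>(2) odd_n unfolding 4 by (auto simp: gint_eq_iff; presburger)
    then show ?thesis ..
  qed
  then have n2: "n\<^sup>2 = 1 \<or> n\<^sup>2 = -1" .
  then have "is_unit (n\<^sup>2)"
    by (auto simp: gunit_iff)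
  then have "is_unit n"
    by (simp add: is_unit_power_iff)
  moreover from this have "s\<^sup>2 = 1 \<or> s\<^sup>2 = 7"
    using s n2 \<delta>(2) gunit_pow4[OF \<open>is_unit n\<close>] by auto
  then have "is_unit s"
  proof
    assume "s\<^sup>2 = 1"
    then show ?thesis
      by (metis dvd_triv_left power2_eq_square)
  next
    assume "s\<^sup>2 = 7"
    then have "(gnorm s)\<^sup>2 = 7\<^sup>2"
      unfolding gnorm_power[symmetric] by simp
    then have "gnorm s = 7"
      using gnorm_nonneg[of s] by (simp only: power2_eq_iff_nonneg zero_le_numeral)
    then show ?thesis
      using gnorm_mod_4[of s] by simp
  qed
  ultimately show ?thesis
    by simp
qed

text \<open>The equation becomes 3m^2(m^2 - n^2) = s^2 - 1, where the right side is 0 or -2 and 3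
  does not divide 2.\<close>

lemma quartic_3_both_units:
  fixes m n s :: gint
  assumes eq: "s\<^sup>2 = 3 * m ^ 4 - 3 * m\<^sup>2 * n\<^sup>2 + n ^ 4" and "is_unit s" "is_unit n" "m \<noteq> 0"
  shows "is_unit m"
proof -
  have n: "n\<^sup>2 = 1 \<or> n\<^sup>2 = -1" and s: "s\<^sup>2 = 1 \<or> s\<^sup>2 = -1" and n4: "n ^ 4 = 1"
    using assms(2,3) gunit_square gunit_pow4 by blast+
  have "3 * (m\<^sup>2 * (m\<^sup>2 - n\<^sup>2)) = s\<^sup>2 - 1"
    unfolding eq n4 by (simp add: power2_eq_square eval_nat_numeral algebra_simps)
  with s have "m\<^sup>2 * (m\<^sup>2 - n\<^sup>2) = 0 \<or> 3 * (m\<^sup>2 * (m\<^sup>2 - n\<^sup>2)) = -2"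
    by auto
  moreover have "3 * w \<noteq> -2" for w :: gint
    by (auto simp: gint_eq_iff) presburger
  ultimately have "m\<^sup>2 = n\<^sup>2"
    using \<open>m \<noteq> 0\<close> by auto
  then have "is_unit (m\<^sup>2)"
    using n by (auto simp: gunit_iff)
  then show ?thesis
    by (simp add: is_unit_power_iff)
qed

lemma coprime_gi [simp]: "coprime gi s" "coprime s gi"
  by (simp_all add: is_unit_left_imp_coprime is_unit_right_imp_coprime gunit_iff)

lemma gi_pow4: "gi ^ 4 = 1"
  by (simp add: eval_nat_numeral gint_eq_iff)

text \<open>Completing the square makes 3z^4 a product of coprime odd factors whose difference is
  4e^2 - 6z^2. This leads to the quartic of the 2-isogenous curve. The unit pairs with
  \<open>gi\<close> fail in the real parts modulo 4.\<close>

lemma quartic_3_step1: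
  assumes eq: "w\<^sup>2 = 3 * z ^ 4 - 3 * z\<^sup>2 * e\<^sup>2 + e ^ 4" and odd: "\<not> gl dvd z" and cop: "coprime z e"
  obtains r s e' where "gnorm z = gnorm r * gnorm s" "coprime r s" "\<not> 3 dvd s" "\<not> gl dvd r"
    "\<not> gl dvd s" "4 * e'\<^sup>2 = s ^ 4 + 6 * (r * s)\<^sup>2 - 3 * r ^ 4"
proof -
  define F G where "F = 2 * w - (2 * e\<^sup>2 - 3 * z\<^sup>2)" and "G = 2 * w + (2 * e\<^sup>2 - 3 * z\<^sup>2)"
  have "F * G = 4 * w\<^sup>2 - (2 * e\<^sup>2 - 3 * z\<^sup>2)\<^sup>2"
    unfolding F_def G_def by (simp add: power2_eq_square algebra_simps)
  then have FG: "F * G = 3 * z ^ 4"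
    unfolding eq by (simp add: power2_eq_square eval_nat_numeral algebra_simps)
  have F_odd: "\<not> gl dvd F"
    unfolding F_def using odd by (simp add: gl_dvd_diff_iff)
  have not3: "\<not> 3 dvd e"
  proof
    assume "3 dvd e"
    then obtain e1 where e1: "e = 3 * e1" ..
    have w2: "w\<^sup>2 = 3 * (z ^ 4 - 9 * z\<^sup>2 * e1\<^sup>2 + 27 * e1 ^ 4)"
      unfolding eq e1 by (simp add: power_mult_distrib algebra_simps)
    have "3 dvd w\<^sup>2"
      unfolding w2 by (rule dvd_triv_left)
    then have "3 dvd w"
      by (rule prime_elem_dvd_power[OF prime_elem_3])
    then obtain w1 where w1: "w = 3 * w1" ..
    have "3 * z ^ 4 = 3 * (3 * (w1\<^sup>2 + 3 * z\<^sup>2 * e1\<^sup>2 - 9 * e1 ^ 4))"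
      using w2 unfolding w1 by (simp add: power_mult_distrib algebra_simps)
    then have "z ^ 4 = 3 * (w1\<^sup>2 + 3 * z\<^sup>2 * e1\<^sup>2 - 9 * e1 ^ 4)"
      by (metis mult_left_cancel zero_neq_numeral)
    then have "3 dvd z ^ 4"
      by (metis dvd_triv_left)
    then have "3 dvd z"
      by (rule prime_elem_dvd_power[OF prime_elem_3])
    then have "is_unit (3 :: gint)"
      using \<open>3 dvd e\<close> cop by (meson coprime_common_divisor)
    then show False
      by (simp add: gunit_iff_gnorm)
  qed
  have "coprime F G"
  proof (rule gint_coprimeI)
    show "F \<noteq> 0 \<or> G \<noteq> 0"
      using F_odd by auto
    fix p :: gint
    assume p: "prime_elem p" "p dvd F" "p dvd G"
    have p2: "\<not> p dvd 2"
      using prime_elem_dvd_two[OF p(1) _ p(2)] F_odd by blast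
    have "p dvd G - F"
      using p by (rule_tac dvd_diff)
    then have "p dvd 2 * (2 * e\<^sup>2 - 3 * z\<^sup>2)"
      by (simp add: F_def G_def algebra_simps)
    then have d: "p dvd 2 * e\<^sup>2 - 3 * z\<^sup>2"
      using p(1) p2 prime_elem_dvd_mult_iff by blast
    have e: "p dvd e" if "p dvd 3 * z\<^sup>2"
    proof -
      have "p dvd (2 * e\<^sup>2 - 3 * z\<^sup>2) + 3 * z\<^sup>2"
        using d that by (rule dvd_add)
      then have "p dvd 2 * e\<^sup>2"
        by simp
      then show ?thesis
        using p2 p(1) prime_elem_dvd_mult_iff prime_elem_dvd_power by blast
    qed
    have "p dvd 3 * z ^ 4"
      using p(2) unfolding FG[symmetric] by simp
    then consider "p dvd 3" | "p dvd z"
      using p(1) prime_elem_dvd_mult_iff prime_elem_dvd_power by blast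
    then show False
    proof cases
      case 1
      then have "3 dvd p" "p dvd e"
        using prime_elem_dvd_prime_elem[OF p(1) prime_elem_3] e by simp_all
      then show False
        using not3 dvd_trans by blast
    next
      case 2
      then have "p dvd e"
        using e by (simp add: power2_eq_square)
      then show False
        using 2 cop p(1) by (meson coprime_common_divisor prime_elem_not_unit)
    qed
  qed
  moreover have "z \<noteq> 0"
    using odd by auto
  ultimately obtain u v r s where uv: "u * v = 1" and z: "z = r * s" and s: "\<not> 3 dvd s" "coprime r s"
    and FG': "F = 3 * u * r ^ 4 \<and> G = v * s ^ 4 \<or> G = 3 * u * r ^ 4 \<and> F = v * s ^ 4"
    using coprime_mult_eq_3_fourth_power[OF _ FG] by metis
  have rs: "\<not> gl dvd r" "\<not> gl dvd s"
    using odd z by auto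
  have GF: "G - F = 4 * e\<^sup>2 - 6 * (r * s)\<^sup>2"
    unfolding F_def G_def by (simp add: z)
  have D: "4 * e\<^sup>2 - 6 * (r * s)\<^sup>2 = v * s ^ 4 - 3 * u * r ^ 4 \<or>
      4 * e\<^sup>2 - 6 * (r * s)\<^sup>2 = - (v * s ^ 4 - 3 * u * r ^ 4)"
    using FG' GF by auto
  have c: "odd (gRe ((r * s)\<^sup>2))" "gRe (r ^ 4) mod 8 = 1" "gIm (r ^ 4) mod 8 = 0"
    "gRe (s ^ 4) mod 8 = 1" "gIm (s ^ 4) mod 8 = 0"
    using odd_square_coords(1)[of "r * s"] odd_fourth_coords rs by simp_all
  have real: "u = 1 \<and> v = 1 \<or> u = -1 \<and> v = -1"
    using uv
  proof (cases rule: gunit_pair_cases)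
    case 3
    have False
    proof -
      have "4 * gRe (e\<^sup>2) - 6 * gRe ((r * s)\<^sup>2) = gIm (s ^ 4) + 3 * gIm (r ^ 4) \<or>
          4 * gRe (e\<^sup>2) - 6 * gRe ((r * s)\<^sup>2) = - gIm (s ^ 4) - 3 * gIm (r ^ 4)"
        using D unfolding 3 gint_eq_iff by auto
      then show False
        using c(1,3,5) by presburger
    qed
    then show ?thesis ..
  next
    case 4
    have False
    proof -
      have "4 * gRe (e\<^sup>2) - 6 * gRe ((r * s)\<^sup>2) = gIm (s ^ 4) + 3 * gIm (r ^ 4) \<or>
          4 * gRe (e\<^sup>2) - 6 * gRe ((r * s)\<^sup>2) = - gIm (s ^ 4) - 3 * gIm (r ^ 4)"
        using D unfolding 4 gint_eq_iff by auto
      then show False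
        using c(1,3,5) by presburger
    qed
    then show ?thesis ..
  qed auto
  with D consider "4 * e\<^sup>2 = s ^ 4 + 6 * (r * s)\<^sup>2 - 3 * r ^ 4"
    | "4 * e\<^sup>2 = - (s ^ 4) + 6 * (r * s)\<^sup>2 + 3 * r ^ 4"
    by (auto simp: algebra_simps)
  then show ?thesis
  proof cases
    case 1
    then show ?thesis
      using that[of r s e] s rs by (simp add: z gnorm_mult)
  next
    case 2
    \<comment> \<open>Multiplying r by i changes the sign of its square but not its fourth power;
      this absorbs the unit -1 here and in the later descents.\<close>
    have "4 * (gi * e)\<^sup>2 = s ^ 4 + 6 * (gi * r * s)\<^sup>2 - 3 * (gi * r) ^ 4"
      using 2 by (simp add: power_mult_distrib gi_sq gi_pow4 algebra_simps)
    then show ?thesis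
      using that[of "gi * r" s "gi * e"] s rs by (simp add: z gnorm_mult)
  qed
qed

text \<open>The way back along the dual isogeny: with 2H = s^2 + 3r^2, the difference H^2 - e^2 is
  3r^4, and the sum of the factors H - e and H + e returns the original form.\<close>

lemma quartic_3_step2:
  assumes eq: "4 * e\<^sup>2 = s ^ 4 + 6 * (r * s)\<^sup>2 - 3 * r ^ 4" and cop: "coprime r s" "\<not> 3 dvd s"
    and odd: "\<not> gl dvd r" "\<not> gl dvd s"
  obtains m n s' where "gnorm r = gnorm m * gnorm n" "gnorm s' = gnorm s" "coprime m n"
    "\<not> gl dvd m" "\<not> gl dvd n" "s'\<^sup>2 = 3 * m ^ 4 - 3 * m\<^sup>2 * n\<^sup>2 + n ^ 4"
proof -
  have "2 dvd s\<^sup>2 + 3 * r\<^sup>2"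
    using odd_square_coords[OF odd(1)] odd_square_coords[OF odd(2)]
    unfolding numeral_dvd_gint_iff by (simp; presburger)
  then obtain H where H: "s\<^sup>2 + 3 * r\<^sup>2 = 2 * H" ..
  have "4 * ((H - e) * (H + e)) = (2 * H)\<^sup>2 - 4 * e\<^sup>2"
    by (simp add: power2_eq_square algebra_simps)
  also have "\<dots> = 4 * (3 * r ^ 4)"
    unfolding H[symmetric] eq by (simp add: power2_eq_square eval_nat_numeral algebra_simps)
  finally have prod: "(H - e) * (H + e) = 3 * r ^ 4"
    by simp
  have "\<not> gl dvd (H - e) * (H + e)"
    unfolding prod using odd by simp
  then have H_odd: "\<not> gl dvd H - e"
    by auto
  have "coprime (H - e) (H + e)"
  proof (rule gint_coprimeI)
    show "H - e \<noteq> 0 \<or> H + e \<noteq> 0"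
      using H_odd by auto
    fix p :: gint
    assume p: "prime_elem p" "p dvd H - e" "p dvd H + e"
    have "p dvd (H - e) + (H + e)"
      using p(2,3) by (rule dvd_add)
    then have d: "p dvd s\<^sup>2 + 3 * r\<^sup>2"
      unfolding H by simp
    have s: "p dvd s" if "p dvd 3 * r\<^sup>2"
    proof -
      have "p dvd (s\<^sup>2 + 3 * r\<^sup>2) - 3 * r\<^sup>2"
        using d that by (rule dvd_diff)
      then show ?thesis
        using prime_elem_dvd_power[OF p(1), of s 2] by simp
    qed
    have "p dvd 3 * r ^ 4"
      using p(2) unfolding prod[symmetric] by simp
    then consider "p dvd 3" | "p dvd r"
      using p(1) prime_elem_dvd_mult_iff prime_elem_dvd_power by blast
    then show False
    proof cases
      case 1
      then have "3 dvd p" "p dvd s"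
        using prime_elem_dvd_prime_elem[OF p(1) prime_elem_3] s by simp_all
      then show False
        using cop(2) dvd_trans by blast
    next
      case 2
      then have "p dvd s"
        using s by (simp add: power2_eq_square)
      then show False
        using 2 cop(1) p(1) by (meson coprime_common_divisor prime_elem_not_unit)
    qed
  qed
  moreover have "r \<noteq> 0"
    using odd by auto
  ultimately obtain u v m n where uv: "u * v = 1" and r: "r = m * n" and mn: "coprime m n"
    and E: "H - e = 3 * u * m ^ 4 \<and> H + e = v * n ^ 4 \<or> H + e = 3 * u * m ^ 4 \<and> H - e = v * n ^ 4"
    using coprime_mult_eq_3_fourth_power[OF _ prod] by metis
  have mn_odd: "\<not> gl dvd m" "\<not> gl dvd n"
    using odd r by auto
  have "(H - e) + (H + e) = s\<^sup>2 + 3 * (m * n)\<^sup>2"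
    unfolding r[symmetric] H by simp
  then have D: "s\<^sup>2 + 3 * (m * n)\<^sup>2 = 3 * u * m ^ 4 + v * n ^ 4"
    using E by (metis add.commute)
  have c: "4 dvd gIm ((m * n)\<^sup>2)" "4 dvd gIm (s\<^sup>2)" "gRe (m ^ 4) mod 8 = 1" "gIm (m ^ 4) mod 8 = 0"
    "gRe (n ^ 4) mod 8 = 1" "gIm (n ^ 4) mod 8 = 0"
    using odd_square_coords(2)[of "m * n"] odd_square_coords(2) odd_fourth_coords mn_odd odd
    by simp_all
  have real: "u = 1 \<and> v = 1 \<or> u = -1 \<and> v = -1"
    using uv
  proof (cases rule: gunit_pair_cases)
    case 3
    have False
      using D c unfolding 3 gint_eq_iff by (simp; presburger)
    then show ?thesis ..
  next
    case 4
    have False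
      using D c unfolding 4 gint_eq_iff by (simp; presburger)
    then show ?thesis ..
  qed auto
  then show ?thesis
  proof (elim disjE conjE)
    assume "u = 1" "v = 1"
    then have "s\<^sup>2 = 3 * m ^ 4 - 3 * m\<^sup>2 * n\<^sup>2 + n ^ 4"
      using D by (simp add: power_mult_distrib algebra_simps)
    then show ?thesis
      using that[of m n s] mn mn_odd by (simp add: r gnorm_mult)
  next
    assume "u = -1" "v = -1"
    then have s2: "s\<^sup>2 = - (3 * m ^ 4) - n ^ 4 - 3 * (m * n)\<^sup>2"
      using D by (simp add: eq_diff_eq)
    have "(gi * s)\<^sup>2 = 3 * m ^ 4 - 3 * m\<^sup>2 * (gi * n)\<^sup>2 + (gi * n) ^ 4"
      by (simp add: s2 power_mult_distrib gi_sq gi_pow4 algebra_simps)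
    then show ?thesis
      using that[of m "gi * n" "gi * s"] mn mn_odd by (simp add: r gnorm_mult)
  qed
qed

text \<open>The two steps factor the norm of z as the product of those of m, n and s, with m in the
  place of z. Either m has smaller norm, or n and s are units; in both cases all three turn out to
  be units.\<close>

lemma quartic_3:
  assumes "w\<^sup>2 = 3 * z ^ 4 - 3 * z\<^sup>2 * e\<^sup>2 + e ^ 4" "\<not> gl dvd z" "coprime z e"
  shows "is_unit z"
  using assms
proof (induction "nat (gnorm z)" arbitrary: z e w rule: less_induct)
  case less
  obtain r s e' where rs: "gnorm z = gnorm r * gnorm s" "coprime r s" "\<not> 3 dvd s" "\<not> gl dvd r"
    "\<not> gl dvd s" "4 * e'\<^sup>2 = s ^ 4 + 6 * (r * s)\<^sup>2 - 3 * r ^ 4"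
    using quartic_3_step1[OF less.prems] .
  obtain m n s' where mn: "gnorm r = gnorm m * gnorm n" "gnorm s' = gnorm s" "coprime m n"
    "\<not> gl dvd m" "\<not> gl dvd n" "s'\<^sup>2 = 3 * m ^ 4 - 3 * m\<^sup>2 * n\<^sup>2 + n ^ 4"
    using quartic_3_step2[OF rs(6,2-5)] .
  have z: "gnorm z = gnorm m * (gnorm n * gnorm s)"
    using rs(1) mn(1) by simp
  have pos: "gnorm m \<ge> 1" "gnorm n \<ge> 1" "gnorm s \<ge> 1"
    using mn(4,5) rs(5) by (auto intro!: gnorm_ge_1)
  have "is_unit m \<and> is_unit n \<and> is_unit s'"
  proof (cases "gnorm m < gnorm z")
    case True
    moreover have "z \<noteq> 0"
      using less.prems(2) by auto
    ultimately have "is_unit m"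
      using less.hyps[OF _ mn(6,4,3)] by simp
    then show ?thesis
      using quartic_3_unit_case[OF mn(6) _ mn(5)] by blast
  next
    \<comment> \<open>The norm of m has not dropped, so the other two factors have norm 1 and the
      equation itself determines m up to a unit.\<close>
    case False
    have "1 \<le> gnorm n * gnorm s"
      using pos by (metis mult_mono' mult_1 zero_le_one)
    moreover have "gnorm n * gnorm s \<le> 1"
      using False pos mult_le_cancel_left_pos[of "gnorm m" "gnorm n * gnorm s" 1]
      unfolding z by linarith
    ultimately have "gnorm n * gnorm s = 1"
      by simp
    then have "gnorm n = 1" "gnorm s = 1"
      using pos pos_zmult_eq_1_iff[of "gnorm n" "gnorm s"] by (simp_all del: gnorm_pos_iff)
    then have "is_unit n" "is_unit s'"
      using mn(2) by (simp_all add: gunit_iff_gnorm)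
    moreover have "m \<noteq> 0"
      using mn(4) by auto
    ultimately show ?thesis
      using quartic_3_both_units[OF mn(6)] by blast
  qed
  then show ?case
    using z mn(2) by (simp add: gunit_iff_gnorm)
qed

subsection \<open>Two quartic curves for the exponent 5\<close>

lemma coprime_addI:
  fixes a b c :: gint
  assumes "coprime a b" "b dvd c"
  shows "coprime (a + c) b"
proof (rule coprimeI)
  fix d
  assume "d dvd a + c" "d dvd b"
  then have "d dvd (a + c) - c"
    using assms(2) by (meson dvd_diff dvd_trans)
  then have "d dvd a"
    by simp
  then show "is_unit d"
    using \<open>d dvd b\<close> assms(1) by (meson coprime_common_divisor)
qed

lemma coprime_125_factors:
  fixes S T X :: gint
  assumes "S * T = 125 * X ^ 4" "coprime (S + T) (5 * X)"
  shows "coprime S T"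
proof (rule coprimeI)
  fix d
  assume d: "d dvd S" "d dvd T"
  have "d dvd S + T"
    using d by (rule dvd_add)
  then have "coprime d (5 * X)"
    using assms(2) by (meson coprime_divisors dvd_refl)
  then have "coprime d (5 ^ 3 * X ^ 4)"
    unfolding coprime_mult_right_iff by (metis coprime_power_right_iff)
  moreover have "d dvd 5 ^ 3 * X ^ 4"
    using assms(1) d(1) dvd_mult2[of d S T] by simp
  ultimately show "is_unit d"
    using coprime_absorb_left by blast
qed

lemma red5_pi5: "red5 pi5 = 0" "red5 (gcnj pi5) = 4"
  by (simp_all add: red5_def pi5_def gcnj_def)

lemma pi5_not_assoc: "\<not> pi5 dvd gcnj pi5" "\<not> gcnj pi5 dvd pi5"
proof -
  show "\<not> pi5 dvd gcnj pi5"
    by (simp add: pi5_dvd_iff red5_pi5)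
  then show "\<not> gcnj pi5 dvd pi5"
    using prime_elem_dvd_prime_elem prime_elem_pi5 by blast
qed

lemma coprime_pi5: "coprime pi5 (gcnj pi5)"
  using prime_elem_pi5 pi5_not_assoc
  by (meson prime_elem_imp_coprime)

lemma pi5_cubes: "125 = pi5 ^ 3 * gcnj pi5 ^ 3"
  by (simp add: eval_nat_numeral pi5_def gcnj_def gint_eq_iff)

lemma pi5_cube: "pi5 ^ 3 = Gint 2 (- 11)" "gcnj pi5 ^ 3 = Gint 2 11"
  by (simp_all add: eval_nat_numeral pi5_def gcnj_def gint_eq_iff)

lemma prime_elem_cube_dvd_coprime:
  fixes S T p :: gint
  assumes "prime_elem p" "p ^ 3 dvd S * T" "coprime S T"
  shows "p ^ 3 dvd S \<or> p ^ 3 dvd T"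
proof -
  have "\<not> p dvd S \<or> \<not> p dvd T"
    using assms(1,3) by (meson coprime_common_divisor prime_elem_not_unit)
  then show ?thesis
  proof
    assume "\<not> p dvd S"
    then have "coprime (p ^ 3) S"
      using assms(1) by (simp add: prime_elem_imp_coprime)
    then show ?thesis
      using assms(2) by (simp add: coprime_dvd_mult_right_iff)
  next
    assume "\<not> p dvd T"
    then have "coprime (p ^ 3) T"
      using assms(1) by (simp add: prime_elem_imp_coprime)
    then show ?thesis
      using assms(2) by (simp add: coprime_dvd_mult_left_iff)
  qed
qed

text \<open>Each cube of a prime above 5 goes entirely into one of the coprime factors: both into
  the same one, or one into each. Recording only the sum makes the result symmetric in S and T, so
  swapping them costs nothing.\<close>

lemma coprime_mult_eq_125_fourth_power:
  fixes S T X :: gint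
  assumes "coprime S T" "S * T = 125 * X ^ 4" "X \<noteq> 0"
  obtains u v r s where "u * v = 1" "X = r * s" "coprime r s"
    "S + T = u * r ^ 4 + 125 * v * s ^ 4 \<and> coprime r 5 \<or>
     S + T = u * pi5 ^ 3 * r ^ 4 + v * gcnj pi5 ^ 3 * s ^ 4 \<and> \<not> pi5 dvd s"
proof -
  let ?P = "\<lambda>S T u v r s. u * v = 1 \<and> X = r * s \<and> coprime r s \<and>
    (S + T = u * r ^ 4 + 125 * v * s ^ 4 \<and> coprime r 5 \<or>
     S + T = u * pi5 ^ 3 * r ^ 4 + v * gcnj pi5 ^ 3 * s ^ 4 \<and> \<not> pi5 dvd s)"
  have A: "\<exists>u v r s. ?P S T u v r s"
    if ST: "coprime S T" "S * T = 125 * X ^ 4" "125 dvd T" for S T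
  proof -
    obtain H where H: "T = 125 * H"
      using ST(3) ..
    have "coprime S H"
      using ST(1) unfolding H by simp
    moreover have "S * H = X ^ 4"
      using ST(2) unfolding H by simp
    ultimately obtain u v r s where uv: "u * v = 1" "X = r * s" "S = u * r ^ 4" "H = v * s ^ 4"
      using coprime_mult_eq_fourth_power[of S H X] \<open>X \<noteq> 0\<close> by metis
    have "coprime S 125"
      using ST(1) unfolding H by simp
    then have "coprime (r ^ 4) (5 ^ 3)"
      unfolding uv(3) by simp
    then have "coprime r 5"
      by (metis coprime_power_left_iff coprime_power_right_iff zero_neq_numeral)
    moreover have "coprime r s"
      using \<open>coprime S H\<close> unfolding uv(3,4) by simp
    moreover have "S + T = u * r ^ 4 + 125 * v * s ^ 4"
      by (simp add: H uv(3,4))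
    ultimately show ?thesis
      using uv(1,2) by blast
  qed
  have B: "\<exists>u v r s. ?P S T u v r s"
    if ST: "coprime S T" "S * T = 125 * X ^ 4" "pi5 ^ 3 dvd S" "gcnj pi5 ^ 3 dvd T" for S T
  proof -
    obtain G where G: "S = pi5 ^ 3 * G"
      using ST(3) ..
    obtain H where H: "T = gcnj pi5 ^ 3 * H"
      using ST(4) ..
    have "coprime G H" "coprime (pi5 ^ 3) (H)"
      using ST(1) unfolding G H by simp_all
    moreover have "(pi5 ^ 3 * gcnj pi5 ^ 3) * (G * H) = (pi5 ^ 3 * gcnj pi5 ^ 3) * X ^ 4"
      using ST(2) unfolding G H pi5_cubes by (simp add: mult_ac)
    then have "G * H = X ^ 4"
      unfolding pi5_cubes[symmetric] by simp
    ultimately obtain u v r s where uv: "u * v = 1" "X = r * s" "G = u * r ^ 4" "H = v * s ^ 4"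
      using coprime_mult_eq_fourth_power[of G H X] \<open>X \<noteq> 0\<close> by metis
    have "\<not> pi5 dvd s"
    proof
      assume "pi5 dvd s"
      then have "pi5 dvd H"
        unfolding uv(4) by (intro dvd_mult) (simp add: prime_elem_dvd_power_iff prime_elem_pi5)
      then have "is_unit pi5"
        using \<open>coprime (pi5 ^ 3) H\<close> by (meson coprime_common_divisor dvd_power zero_less_numeral)
      then show False
        using prime_elem_pi5 prime_elem_not_unit by blast
    qed
    moreover have "coprime r s"
      using \<open>coprime G H\<close> unfolding uv(3,4) by simp
    moreover have "S + T = u * pi5 ^ 3 * r ^ 4 + v * gcnj pi5 ^ 3 * s ^ 4"
      by (simp add: G H uv(3,4))
    ultimately show ?thesis
      using uv(1,2) by blast
  qed
  have C: "125 dvd Z" if "pi5 ^ 3 dvd Z" "gcnj pi5 ^ 3 dvd Z" for Z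
    unfolding pi5_cubes using that coprime_pi5 by (intro divides_mult) simp_all
  have "pi5 ^ 3 dvd S * T" "gcnj pi5 ^ 3 dvd S * T"
    unfolding assms(2) pi5_cubes by simp_all
  then have "pi5 ^ 3 dvd S \<or> pi5 ^ 3 dvd T" "gcnj pi5 ^ 3 dvd S \<or> gcnj pi5 ^ 3 dvd T"
    using prime_elem_cube_dvd_coprime prime_elem_pi5 assms(1) by blast+
  moreover have swap: "coprime T S" "T * S = 125 * X ^ 4"
    using assms(1,2) by (simp_all add: coprime_commute mult.commute)
  ultimately have "(\<exists>u v r s. ?P S T u v r s) \<or> (\<exists>u v r s. ?P T S u v r s)"
    using A[OF assms(1,2)] A[OF swap] B[OF assms(1,2)] B[OF swap] C by blast
  then have "\<exists>u v r s. ?P S T u v r s"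
    by (simp add: add.commute[of T S])
  then show ?thesis
    using that by blast
qed

text \<open>Modulo \<open>2 - i\<close> the unit \<open>i\<close> is a non-residue; this forces the units in the descent to be
  \<open>\<plusminus>1\<close>.\<close>

lemma red5_square: "red5 (p\<^sup>2) mod 5 \<in> {0, 1, 4}"
proof -
  have "red5 (p\<^sup>2) mod 5 = (red5 p)\<^sup>2 mod 5"
    using red5_power[of p 2] by (simp add: cong_def)
  also have "\<dots> = (red5 p mod 5)\<^sup>2 mod 5"
    by (simp add: power_mod)
  finally have *: "red5 (p\<^sup>2) mod 5 = (red5 p mod 5)\<^sup>2 mod 5" .
  have "red5 p mod 5 \<in> {0, 1, 2, 3, 4}"
    by (simp; presburger)
  then show ?thesis
    unfolding * by auto
qed

lemma red5_fourth: "\<not> pi5 dvd s \<Longrightarrow> red5 (s ^ 4) mod 5 = 1"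
proof -
  assume "\<not> pi5 dvd s"
  then have "\<not> 5 dvd red5 s"
    by (simp add: pi5_dvd_iff)
  then have "red5 s mod 5 \<in> {1, 2, 3, 4}"
    by (simp; presburger)
  moreover have "red5 (s ^ 4) mod 5 = (red5 s mod 5) ^ 4 mod 5"
    using red5_power[of s 4] by (simp add: cong_def power_mod)
  ultimately show ?thesis
    by auto
qed

lemma red5_mult_mod: "red5 (z * w) mod 5 = (red5 z mod 5) * (red5 w mod 5) mod 5"
  using red5_mult[of z w] by (simp add: cong_def mod_mult_eq)

lemma unit_real_type1:
  assumes "u * v = 1" "p\<^sup>2 + 5 * A = u * r ^ 4 + 5 * B" "\<not> pi5 dvd r"
  shows "u = 1 \<and> v = 1 \<or> u = -1 \<and> v = -1"
proof -
  have *: "red5 (p\<^sup>2) mod 5 = (red5 u mod 5) mod 5"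
  proof -
    have "p\<^sup>2 = u * r ^ 4 + 5 * (B - A)"
      using assms(2) by (simp add: algebra_simps eq_diff_eq)
    then have "red5 (p\<^sup>2) = red5 (u * r ^ 4) + red5 (5 * (B - A))"
      by simp
    moreover have "red5 (5 * (B - A)) mod 5 = 0"
      by (subst red5_mult_mod) simp
    moreover have "red5 (u * r ^ 4) mod 5 = (red5 u mod 5) mod 5"
      by (subst red5_mult_mod) (simp add: red5_fourth assms(3))
    ultimately show ?thesis
      by (metis add.right_neutral mod_add_eq mod_mod_trivial)
  qed
  from assms(1) show ?thesis
  proof (cases rule: gunit_pair_cases)
    case 3
    then show ?thesis
      using * red5_square[of p] by simp
  next
    case 4
    then show ?thesis
      using * red5_square[of p] by simp
  qed auto
qed

text \<open>Modulo \<open>pi5\<close> the first term drops out and the cube of the conjugate prime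
  becomes 4, so 4 times the residue of v is a square modulo 5; \<open>gi\<close> and its negative go
  to the non-residues 2 and 3.\<close>

lemma unit_real_type2:
  assumes "u * v = 1" "p\<^sup>2 + 5 * A = u * pi5 ^ 3 * r ^ 4 + v * gcnj pi5 ^ 3 * s ^ 4" "\<not> pi5 dvd s"
  shows "u = 1 \<and> v = 1 \<or> u = -1 \<and> v = -1"
proof -
  have *: "red5 (p\<^sup>2) mod 5 = 4 * (red5 v mod 5) mod 5"
  proof -
    have "p\<^sup>2 = u * pi5 ^ 3 * r ^ 4 + v * gcnj pi5 ^ 3 * s ^ 4 - 5 * A"
      using assms(2) by (simp add: eq_diff_eq)
    then have "red5 (p\<^sup>2) = red5 (u * pi5 ^ 3 * r ^ 4) + red5 (v * gcnj pi5 ^ 3 * s ^ 4) - red5 (5 * A)"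
      by simp
    moreover have "red5 (5 * A) mod 5 = 0"
      by (subst red5_mult_mod) simp
    moreover have "red5 (u * pi5 ^ 3 * r ^ 4) mod 5 = 0"
      by (subst red5_mult_mod, subst red5_mult_mod) (simp add: pi5_cube red5_def)
    moreover have "red5 (v * gcnj pi5 ^ 3 * s ^ 4) mod 5 = 4 * (red5 v mod 5) mod 5"
    proof -
      have "red5 (v * gcnj pi5 ^ 3) mod 5 = 4 * (red5 v mod 5) mod 5"
        by (subst red5_mult_mod) (simp add: pi5_cube red5_def mult.commute)
      then show ?thesis
        by (subst red5_mult_mod) (simp add: red5_fourth assms(3))
    qed
    ultimately show ?thesis
      by (metis add_0 diff_zero mod_add_eq mod_diff_eq mod_mod_trivial)
  qed
  from assms(1) show ?thesis
  proof (cases rule: gunit_pair_cases)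
    case 3
    then show ?thesis
      using * red5_square[of p] by simp
  next
    case 4
    then show ?thesis
      using * red5_square[of p] by simp
  qed auto
qed

subsection \<open>Descent on the two quartics\<close>

lemma quartic5_twist:
  assumes "u = 1 \<and> v = 1 \<or> u = -1 \<and> v = -1" "p\<^sup>2 + 25 * (r * s)\<^sup>2 = u * r ^ 4 + 125 * v * s ^ 4"
  obtains p' s' where "p'\<^sup>2 = r ^ 4 - 25 * (r * s')\<^sup>2 + 125 * s' ^ 4" "s' = s \<or> s' = gi * s"
proof -
  have p: "p\<^sup>2 = u * r ^ 4 + 125 * v * s ^ 4 - 25 * (r * s)\<^sup>2"
    using assms(2) by (simp add: eq_diff_eq)
  from assms(1) show ?thesis
  proof (elim disjE conjE)
    assume "u = 1" "v = 1"
    then show ?thesis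
      using that[of p s] p by (simp add: algebra_simps)
  next
    assume "u = -1" "v = -1"
    then have "(gi * p)\<^sup>2 = r ^ 4 - 25 * (r * (gi * s))\<^sup>2 + 125 * (gi * s) ^ 4"
      by (simp add: p power_mult_distrib gi_sq gi_pow4 algebra_simps)
    then show ?thesis
      using that by blast
  qed
qed

lemma quartic5_twist':
  assumes "u = 1 \<and> v = 1 \<or> u = -1 \<and> v = -1" "r\<^sup>2 - 50 * (m * n)\<^sup>2 = u * m ^ 4 + 125 * v * n ^ 4"
  obtains c n' where "(c * r)\<^sup>2 = m ^ 4 + 50 * (m * n')\<^sup>2 + 125 * n' ^ 4" "n' = n \<or> n' = gi * n"
    "c = 1 \<or> c = gi"
proof -
  have r: "r\<^sup>2 = u * m ^ 4 + 125 * v * n ^ 4 + 50 * (m * n)\<^sup>2"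
    using assms(2) by (simp add: diff_eq_eq)
  from assms(1) show ?thesis
  proof (elim disjE conjE)
    assume "u = 1" "v = 1"
    then show ?thesis
      using that[of 1 n] r by (simp add: algebra_simps)
  next
    assume "u = -1" "v = -1"
    then have "(gi * r)\<^sup>2 = m ^ 4 + 50 * (m * (gi * n))\<^sup>2 + 125 * (gi * n) ^ 4"
      by (simp add: r power_mult_distrib gi_sq gi_pow4 algebra_simps)
    then show ?thesis
      using that by blast
  qed
qed

text \<open>Both factors are even and differ by 2l. Written with one \<open>gl\<close> taken out of
  each, the cofactors differ by a multiple of \<open>gl\<close> and their product is still divisible
  by \<open>gl\<close>, so a second \<open>gl\<close> comes out of both.\<close>

lemma half_factors:
  assumes eq: "(X - l) * (X + l) = 4 * W" and odd: "\<not> gl dvd X" "\<not> gl dvd l"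
  obtains S where "X - l = 2 * S" "S * (S + l) = W" "S + (S + l) = X"
proof -
  have "gl dvd X - l"
    using odd by (simp add: gl_dvd_diff_iff)
  then obtain A where A: "X - l = gl * A" ..
  have "X + l = (X - l) + 2 * l"
    by simp
  also have "\<dots> = gl * A + gl * (1 - gi) * l"
    by (simp only: A two_eq_gl(1))
  finally have A': "X + l = gl * (A + (1 - gi) * l)"
    by (simp add: algebra_simps)
  have "gl\<^sup>2 * (A * (A + (1 - gi) * l)) = (X - l) * (X + l)"
    unfolding A A' by (simp add: power2_eq_square algebra_simps)
  also have "\<dots> = gl\<^sup>2 * (gl * (gl * - W))"
    unfolding eq using gl_pow4 by (simp add: eval_nat_numeral gint_eq_iff)
  finally have "gl\<^sup>2 * (A * (A + (1 - gi) * l)) = gl\<^sup>2 * (gl * (gl * - W))" .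
  moreover have "gl\<^sup>2 \<noteq> 0"
    by (simp add: gl_sq gint_eq_iff)
  ultimately have "A * (A + (1 - gi) * l) = gl * (gl * - W)"
    by (metis mult_left_cancel)
  then have "gl dvd A * (A + (1 - gi) * l)"
    by (metis dvd_triv_left)
  moreover have "gl dvd 1 - gi"
    by (simp add: gl_dvd_iff)
  ultimately have "gl dvd A"
    by (auto simp: gl_dvd_add_iff)
  then obtain A2 where "A = gl * A2" ..
  then have S: "X - l = 2 * (gi * A2)"
    using A gl_sq by (metis mult.assoc power2_eq_square)
  have X: "X = 2 * (gi * A2) + l"
    using S by (simp add: diff_eq_eq)
  have "4 * (gi * A2 * (gi * A2 + l)) = (X - l) * (X + l)"
    unfolding X by (simp add: algebra_simps)
  then have "gi * A2 * (gi * A2 + l) = W"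
    unfolding eq by simp
  then show ?thesis
    using that[of "gi * A2"] S X by (simp add: algebra_simps)
qed

text \<open>The cubes are 2 - 11i and 2 + 11i; with exactly one of r, s odd, exactly one odd
  multiple of 11 reaches the imaginary part. Sums of integer multiples of squares have even
  imaginary part, so this excludes the split type.\<close>

lemma type2_parity:
  assumes "u = 1 \<and> v = 1 \<or> u = -1 \<and> v = -1"
    "gl dvd r \<longleftrightarrow> \<not> gl dvd s" "X = u * pi5 ^ 3 * r ^ 4 + v * gcnj pi5 ^ 3 * s ^ 4"
  shows "odd (gIm X)"
proof -
  have e: "even (gRe (t ^ 4))" if "gl dvd t" for t
  proof -
    have "gl ^ 4 dvd t ^ 4"
      using that by (rule dvd_power_same)
    then have "4 dvd t ^ 4"
      by (simp add: gl_pow4)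
    then show ?thesis
      unfolding numeral_dvd_gint_iff by presburger
  qed
  have o: "odd (gRe (t ^ 4))" if "\<not> gl dvd t" for t
    using odd_fourth_coords(1)[OF that] by presburger
  have "odd (gRe (r ^ 4)) \<longleftrightarrow> even (gRe (s ^ 4))"
    using assms(2) e o by blast
  then show ?thesis
    using assms(1) unfolding assms(3) pi5_cube by auto
qed

text \<open>Odd fourth powers are 1 modulo 8 and the two cubes add up to 4.\<close>

lemma type2_odd_coords:
  assumes "u = 1 \<and> v = 1 \<or> u = -1 \<and> v = -1"
    "\<not> gl dvd r" "\<not> gl dvd s" "X = u * pi5 ^ 3 * r ^ 4 + v * gcnj pi5 ^ 3 * s ^ 4"
  shows "gRe X mod 8 = 4" "gIm X mod 8 = 0"
proof -
  obtain k k' where k: "r ^ 4 = 1 + 8 * gl * k" "s ^ 4 = 1 + 8 * gl * k'"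
    using odd_fourth_gint assms(2,3) by metis
  have "pi5 ^ 3 + gcnj pi5 ^ 3 = 4"
    by (simp add: pi5_cube gint_eq_iff)
  then have "X = 4 * u + 8 * (u * (pi5 ^ 3 * gl * k + gcnj pi5 ^ 3 * gl * k'))"
    using assms(1) unfolding assms(4) k by (auto simp: algebra_simps)
  then obtain W where "X = 4 * u + 8 * W"
    by blast
  with assms(1) show "gRe X mod 8 = 4" "gIm X mod 8 = 0"
    by (auto; presburger)+
qed

text \<open>The half factors would have odd product, hence even sum; but the sum is p^2 + 25d^2,
  which is odd.\<close>

lemma quartic5_even_odd:
  assumes "l\<^sup>2 = p ^ 4 + 50 * (p * d)\<^sup>2 + 125 * d ^ 4" "gl dvd p" "\<not> gl dvd d"
  shows False
proof -
  define X where "X = p\<^sup>2 + 25 * d\<^sup>2"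
  have "(X - l) * (X + l) = X\<^sup>2 - l\<^sup>2"
    by (simp add: power2_eq_square algebra_simps)
  also have "\<dots> = 4 * (125 * d ^ 4)"
    unfolding assms(1) X_def by (simp add: power2_eq_square eval_nat_numeral algebra_simps)
  finally have eq: "(X - l) * (X + l) = 4 * (125 * d ^ 4)" .
  have X: "\<not> gl dvd X"
    unfolding X_def using assms(2,3) by (simp add: gl_dvd_add_iff)
  have "\<not> gl dvd l\<^sup>2"
    unfolding assms(1) using assms(2,3) by (simp add: gl_dvd_add_iff)
  then obtain S where S: "S * (S + l) = 125 * d ^ 4" "S + (S + l) = X"
    using half_factors[OF eq X] by auto
  have "\<not> gl dvd S * (S + l)"
    unfolding S(1) using assms(3) by simp
  then have "gl dvd S + (S + l)"
    by (auto simp: gl_dvd_add_iff)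
  then show False
    using X S(2) by simp
qed

text \<open>From (p^2 + 25d^2)^2 - l^2 = 500d^4, the half factors have product 125d^4 and sum p^2 +
  25d^2. The unsplit type yields the quartic of the 2-isogenous curve; the split type dies by
  parity, as exactly one of r, s is even.\<close>

lemma quartic5_stepA:
  assumes eq: "l\<^sup>2 = p ^ 4 + 50 * (p * d)\<^sup>2 + 125 * d ^ 4" and odd: "\<not> gl dvd p" "gl dvd d"
    and cop: "coprime p (5 * d)" and "d \<noteq> 0"
  obtains p' r s where "p'\<^sup>2 = r ^ 4 - 25 * (r * s)\<^sup>2 + 125 * s ^ 4" "gnorm d = gnorm r * gnorm s"
    "coprime r (5 * s)" "gl dvd r \<longleftrightarrow> \<not> gl dvd s"
proof -
  define X where "X = p\<^sup>2 + 25 * d\<^sup>2"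
  have "(X - l) * (X + l) = X\<^sup>2 - l\<^sup>2"
    by (simp add: power2_eq_square algebra_simps)
  also have "\<dots> = 4 * (125 * d ^ 4)"
    unfolding eq X_def by (simp add: power2_eq_square eval_nat_numeral algebra_simps)
  finally have eq': "(X - l) * (X + l) = 4 * (125 * d ^ 4)" .
  have X: "\<not> gl dvd X"
    unfolding X_def using odd by (simp add: gl_dvd_add_iff)
  have "\<not> gl dvd l\<^sup>2"
    unfolding eq using odd by (simp add: gl_dvd_add_iff)
  then obtain S where S: "S * (S + l) = 125 * d ^ 4" "S + (S + l) = X"
    using half_factors[OF eq' X] by auto
  have "coprime (p\<^sup>2 + 25 * d\<^sup>2) (5 * d)"
  proof (rule coprime_addI)
    show "coprime (p\<^sup>2) (5 * d)"
      using cop by (simp only: coprime_power_left_iff) simp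
    have "25 * d\<^sup>2 = 5 * d * (5 * d)"
      by (simp add: power2_eq_square)
    then show "5 * d dvd 25 * d\<^sup>2"
      by (metis dvd_triv_left)
  qed
  then have "coprime (S + (S + l)) (5 * d)"
    unfolding S(2) X_def .
  from coprime_125_factors[OF S(1) this]
  obtain u v r s where uv: "u * v = 1" "d = r * s" "coprime r s"
    "X = u * r ^ 4 + 125 * v * s ^ 4 \<and> coprime r 5 \<or>
     X = u * pi5 ^ 3 * r ^ 4 + v * gcnj pi5 ^ 3 * s ^ 4 \<and> \<not> pi5 dvd s"
    using coprime_mult_eq_125_fourth_power[OF _ S(1) \<open>d \<noteq> 0\<close>] unfolding S(2) by metis
  have par: "gl dvd r \<longleftrightarrow> \<not> gl dvd s"
  proof -
    have "gl dvd r \<or> gl dvd s"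
      using odd(2) unfolding uv(2) by simp
    moreover have "\<not> (gl dvd r \<and> gl dvd s)"
      using uv(3) prime_elem_gl by (meson coprime_common_divisor prime_elem_not_unit)
    ultimately show ?thesis
      by blast
  qed
  have Xp: "X = p\<^sup>2 + 5 * (5 * d\<^sup>2)"
    by (simp add: X_def)
  from uv(4) show ?thesis
  proof (elim disjE conjE)
    assume 1: "X = u * r ^ 4 + 125 * v * s ^ 4" "coprime r 5"
    have "\<not> pi5 dvd r"
      using 1(2) five_eq prime_elem_pi5(1)
      by (metis coprime_common_divisor dvd_triv_left prime_elem_not_unit)
    moreover have "p\<^sup>2 + 5 * (5 * d\<^sup>2) = u * r ^ 4 + 5 * (25 * v * s ^ 4)"
      using 1(1) unfolding Xp by simp
    ultimately have "u = 1 \<and> v = 1 \<or> u = -1 \<and> v = -1"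
      using unit_real_type1[OF uv(1)] by blast
    moreover have "p\<^sup>2 + 25 * (r * s)\<^sup>2 = u * r ^ 4 + 125 * v * s ^ 4"
      using 1(1) unfolding X_def uv(2) .
    ultimately obtain p' s' where "p'\<^sup>2 = r ^ 4 - 25 * (r * s')\<^sup>2 + 125 * s' ^ 4" "s' = s \<or> s' = gi * s"
      using quartic5_twist by blast
    then show ?thesis
      using that[of p' r s'] par uv(2,3) 1(2) by (auto simp: gnorm_mult)
  next
    assume 2: "X = u * pi5 ^ 3 * r ^ 4 + v * gcnj pi5 ^ 3 * s ^ 4" "\<not> pi5 dvd s"
    have "u = 1 \<and> v = 1 \<or> u = -1 \<and> v = -1"
      using unit_real_type2[OF uv(1) _ 2(2)] 2(1) unfolding Xp by blast
    then have "odd (gIm X)"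
      using type2_parity[OF _ par 2(1)] by blast
    moreover have "even (gIm X)"
      unfolding X_def using even_gIm_square[of p] even_gIm_square[of d] by simp
    ultimately show ?thesis
      by blast
  qed
qed

text \<open>The step back. An even s is in fact divisible by 2, and s = 2t gives (r^2 - 50t^2)^2 -
  p^2 = 500t^4. The norm of s is 4 times a product containing that of the new n, so the descent is
  strict.\<close>

lemma quartic5_stepB:
  assumes eq: "p\<^sup>2 = r ^ 4 - 25 * (r * s)\<^sup>2 + 125 * s ^ 4" and odd: "\<not> gl dvd r" "gl dvd s"
    and cop: "coprime r (5 * s)" and "s \<noteq> 0"
  obtains l m n where "l\<^sup>2 = m ^ 4 + 50 * (m * n)\<^sup>2 + 125 * n ^ 4" "\<not> gl dvd m" "gl dvd n"
    "coprime m (5 * n)" "n \<noteq> 0" "gnorm n < gnorm s"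
proof -
  obtain \<sigma> where \<sigma>: "s = gl * \<sigma>"
    using odd(2) ..
  have s2: "s\<^sup>2 = 2 * gi * \<sigma>\<^sup>2" and s4: "s ^ 4 = - 4 * \<sigma> ^ 4"
    by (simp_all add: \<sigma> power_mult_distrib gl_sq gl_pow4)
  have "\<not> gl dvd p\<^sup>2"
    unfolding eq using odd by (simp add: gl_dvd_add_iff gl_dvd_diff_iff)
  then have p_odd: "\<not> gl dvd p"
    by simp
  \<comment> \<open>Were \<sigma> odd, the middle term would contribute 50 times an odd number to
    the imaginary part, while those of p^2 and r^4 are divisible by 4.\<close>
  have "gl dvd \<sigma>"
  proof (rule ccontr)
    assume "\<not> gl dvd \<sigma>"
    then have "odd (gRe ((r * \<sigma>)\<^sup>2))"
      using odd(1) by (intro odd_square_coords) simp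
    moreover have "p\<^sup>2 = r ^ 4 - 50 * (gi * (r * \<sigma>)\<^sup>2) - 500 * \<sigma> ^ 4"
      unfolding eq power_mult_distrib s2 s4 by (simp add: algebra_simps)
    then have "gIm (p\<^sup>2) = gIm (r ^ 4) - 50 * gRe ((r * \<sigma>)\<^sup>2) - 500 * gIm (\<sigma> ^ 4)"
      by simp
    moreover obtain x where "gIm (p\<^sup>2) = 4 * x"
      using odd_square_coords(2)[OF p_odd] by (elim dvdE)
    moreover obtain x' where "gIm (r ^ 4) = 8 * x'"
      using odd_fourth_coords(2)[OF odd(1)] by (auto simp: mod_eq_0_iff_dvd)
    ultimately have "25 * gRe ((r * \<sigma>)\<^sup>2) = 2 * (2 * x' - x - 125 * gIm (\<sigma> ^ 4))"
      by simp
    then have "even (25 * gRe ((r * \<sigma>)\<^sup>2))"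
      by (metis dvd_triv_left)
    then show False
      using \<open>odd (gRe ((r * \<sigma>)\<^sup>2))\<close> by simp
  qed
  then obtain \<tau> where "\<sigma> = gl * \<tau>" ..
  then have "s = 2 * (gi * \<tau>)"
    using \<sigma> gl_sq by (metis mult.assoc power2_eq_square)
  then obtain t where t: "s = 2 * t"
    by blast
  define X where "X = r\<^sup>2 - 50 * t\<^sup>2"
  have "(X - p) * (X + p) = X\<^sup>2 - p\<^sup>2"
    by (simp add: power2_eq_square algebra_simps)
  also have "\<dots> = 4 * (125 * t ^ 4)"
    unfolding eq X_def t by (simp add: power2_eq_square eval_nat_numeral algebra_simps)
  finally have eq': "(X - p) * (X + p) = 4 * (125 * t ^ 4)" .
  have X: "\<not> gl dvd X"
    unfolding X_def using odd by (simp add: gl_dvd_diff_iff)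
  obtain S where S: "S * (S + p) = 125 * t ^ 4" "S + (S + p) = X"
    using half_factors[OF eq' X p_odd] .
  have t_even: "gl dvd t"
  proof (rule ccontr)
    assume "\<not> gl dvd t"
    then have "\<not> gl dvd S * (S + p)"
      unfolding S(1) by simp
    then have "gl dvd S + (S + p)"
      by (auto simp: gl_dvd_add_iff)
    then show False
      using X S(2) by simp
  qed
  have "coprime (r\<^sup>2 + - (50 * t\<^sup>2)) (5 * t)"
  proof (rule coprime_addI)
    have "coprime r (5 * t)"
      using cop unfolding t coprime_mult_right_iff by blast
    then show "coprime (r\<^sup>2) (5 * t)"
      by (simp only: coprime_power_left_iff) simp
    have "- (50 * t\<^sup>2) = 5 * t * (- 10 * t)"
      by (simp add: power2_eq_square)
    then show "5 * t dvd - (50 * t\<^sup>2)"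
      by (metis dvd_triv_left)
  qed
  then have "coprime (S + (S + p)) (5 * t)"
    unfolding S(2) X_def by simp
  moreover have "t \<noteq> 0"
    using t \<open>s \<noteq> 0\<close> by auto
  ultimately obtain u v m n where uv: "u * v = 1" "t = m * n" "coprime m n"
    "X = u * m ^ 4 + 125 * v * n ^ 4 \<and> coprime m 5 \<or>
     X = u * pi5 ^ 3 * m ^ 4 + v * gcnj pi5 ^ 3 * n ^ 4 \<and> \<not> pi5 dvd n"
    using coprime_mult_eq_125_fourth_power[OF coprime_125_factors[OF S(1)] S(1)]
    unfolding S(2) by metis
  have par: "gl dvd m \<longleftrightarrow> \<not> gl dvd n"
  proof -
    have "gl dvd m \<or> gl dvd n"
      using t_even unfolding uv(2) by simp
    moreover have "\<not> (gl dvd m \<and> gl dvd n)"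
      using uv(3) prime_elem_gl by (meson coprime_common_divisor prime_elem_not_unit)
    ultimately show ?thesis
      by blast
  qed
  have Xr: "X = r\<^sup>2 + 5 * (- 10 * t\<^sup>2)"
    by (simp add: X_def)
  from uv(4) show ?thesis
  proof (elim disjE conjE)
    assume 1: "X = u * m ^ 4 + 125 * v * n ^ 4" "coprime m 5"
    have "\<not> pi5 dvd m"
      using 1(2) five_eq prime_elem_pi5(1)
      by (metis coprime_common_divisor dvd_triv_left prime_elem_not_unit)
    moreover have "r\<^sup>2 + 5 * (- 10 * t\<^sup>2) = u * m ^ 4 + 5 * (25 * v * n ^ 4)"
      using 1(1) unfolding Xr by simp
    ultimately have "u = 1 \<and> v = 1 \<or> u = -1 \<and> v = -1"
      using unit_real_type1[OF uv(1)] by blast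
    moreover have "r\<^sup>2 - 50 * (m * n)\<^sup>2 = u * m ^ 4 + 125 * v * n ^ 4"
      using 1(1) unfolding X_def uv(2) .
    ultimately obtain c n' where n': "(c * r)\<^sup>2 = m ^ 4 + 50 * (m * n')\<^sup>2 + 125 * n' ^ 4"
      "n' = n \<or> n' = gi * n"
      using quartic5_twist' by blast
    have "\<not> gl dvd m"
      using quartic5_even_odd[OF n'(1)] par n'(2) by auto
    moreover have "gl dvd n'" "coprime m (5 * n')" "n' \<noteq> 0"
      using par \<open>\<not> gl dvd m\<close> n'(2) uv(2,3) 1(2) \<open>t \<noteq> 0\<close> by (auto simp: gint_eq_iff[of gi])
    moreover have "gnorm n' < gnorm s"
    proof -
      have "gnorm s = 4 * (gnorm m * gnorm n')"
        using n'(2) by (auto simp: t uv(2) gnorm_mult)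
      moreover have "gnorm m \<ge> 1" "gnorm n' \<ge> 1"
        using \<open>\<not> gl dvd m\<close> \<open>n' \<noteq> 0\<close> by (auto intro!: gnorm_ge_1)
      moreover from this have "1 * gnorm n' \<le> gnorm m * gnorm n'"
        by (intro mult_right_mono) auto
      ultimately show ?thesis
        by linarith
    qed
    ultimately show ?thesis
      using that[OF n'(1)] by blast
  next
    assume 2: "X = u * pi5 ^ 3 * m ^ 4 + v * gcnj pi5 ^ 3 * n ^ 4" "\<not> pi5 dvd n"
    have "u = 1 \<and> v = 1 \<or> u = -1 \<and> v = -1"
      using unit_real_type2[OF uv(1) _ 2(2)] 2(1) unfolding Xr by blast
    then have "odd (gIm X)"
      using type2_parity[OF _ par 2(1)] by blast
    moreover have "even (gIm X)"
      unfolding X_def using even_gIm_square[of r] even_gIm_square[of t] by simp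
    ultimately show ?thesis
      by blast
  qed
qed

text \<open>For odd s nothing can be halved, so 2r^2 - 25s^2 and 2p are used: the product of their
  sum and difference is 125s^4. The split type fails because its real part would be 4 modulo 8,
  while 50s^2 makes it 2 modulo 4.\<close>

lemma quartic5_stepB':
  assumes eq: "p\<^sup>2 = r ^ 4 - 25 * (r * s)\<^sup>2 + 125 * s ^ 4" and odd: "\<not> gl dvd s"
    and cop: "coprime r (5 * s)"
  obtains c m n where "(2 * (c * r))\<^sup>2 = m ^ 4 + 50 * (m * n)\<^sup>2 + 125 * n ^ 4" "\<not> gl dvd m"
    "\<not> gl dvd n" "coprime m (5 * n)" "c = 1 \<or> c = gi"
proof -
  define X where "X = 2 * r\<^sup>2 - 25 * s\<^sup>2"
  have "(X - 2 * p) * (X + 2 * p) = X\<^sup>2 - 4 * p\<^sup>2"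
    by (simp add: power2_eq_square algebra_simps)
  also have "\<dots> = 125 * s ^ 4"
    unfolding eq X_def by (simp add: power2_eq_square eval_nat_numeral algebra_simps)
  finally have prod: "(X - 2 * p) * (X + 2 * p) = 125 * s ^ 4" .
  have sum: "(X - 2 * p) + (X + 2 * p) = (2 * r)\<^sup>2 + - (50 * s\<^sup>2)"
    unfolding X_def by (simp add: power2_eq_square algebra_simps)
  have "coprime ((2 * r)\<^sup>2 + - (50 * s\<^sup>2)) (5 * s)"
  proof (rule coprime_addI)
    have "coprime 2 (5 * s)"
    proof (rule gint_coprimeI)
      fix q :: gint
      assume "prime_elem q" "q dvd 2" "q dvd 5 * s"
      then show False
        using prime_elem_dvd_two[of q "5 * s"] odd by simp
    qed simp
    then have "coprime (2 * r) (5 * s)"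
      using cop unfolding coprime_mult_left_iff by blast
    then show "coprime ((2 * r)\<^sup>2) (5 * s)"
      by (simp only: coprime_power_left_iff) simp
    have "- (50 * s\<^sup>2) = 5 * s * (- 10 * s)"
      by (simp add: power2_eq_square)
    then show "5 * s dvd - (50 * s\<^sup>2)"
      by (metis dvd_triv_left)
  qed
  then have cop2: "coprime ((X - 2 * p) + (X + 2 * p)) (5 * s)"
    unfolding sum .
  have "s \<noteq> 0"
    using odd by auto
  obtain u v m n where uv: "u * v = 1" "s = m * n" "coprime m n"
    "(2 * r)\<^sup>2 + - (50 * s\<^sup>2) = u * m ^ 4 + 125 * v * n ^ 4 \<and> coprime m 5 \<or>
     (2 * r)\<^sup>2 + - (50 * s\<^sup>2) = u * pi5 ^ 3 * m ^ 4 + v * gcnj pi5 ^ 3 * n ^ 4 \<and> \<not> pi5 dvd n"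
    using coprime_mult_eq_125_fourth_power[OF coprime_125_factors[OF prod cop2] prod \<open>s \<noteq> 0\<close>]
    unfolding sum by metis
  have mn: "\<not> gl dvd m" "\<not> gl dvd n"
    using odd uv(2) by auto
  from uv(4) show ?thesis
  proof (elim disjE conjE)
    assume 1: "(2 * r)\<^sup>2 + - (50 * s\<^sup>2) = u * m ^ 4 + 125 * v * n ^ 4" "coprime m 5"
    have "\<not> pi5 dvd m"
      using 1(2) five_eq prime_elem_pi5(1)
      by (metis coprime_common_divisor dvd_triv_left prime_elem_not_unit)
    moreover have "(2 * r)\<^sup>2 + 5 * (- 10 * s\<^sup>2) = u * m ^ 4 + 5 * (25 * v * n ^ 4)"
      using 1(1) by simp
    ultimately have "u = 1 \<and> v = 1 \<or> u = -1 \<and> v = -1"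
      using unit_real_type1[OF uv(1)] by blast
    moreover have "(2 * r)\<^sup>2 - 50 * (m * n)\<^sup>2 = u * m ^ 4 + 125 * v * n ^ 4"
      using 1(1) unfolding uv(2) by simp
    ultimately obtain c n' where n': "(c * (2 * r))\<^sup>2 = m ^ 4 + 50 * (m * n')\<^sup>2 + 125 * n' ^ 4"
      "n' = n \<or> n' = gi * n" "c = 1 \<or> c = gi"
      using quartic5_twist' by blast
    have "c * (2 * r) = 2 * (c * r)"
      by simp
    then have "(2 * (c * r))\<^sup>2 = m ^ 4 + 50 * (m * n')\<^sup>2 + 125 * n' ^ 4"
      using n'(1) by metis
    moreover have "\<not> gl dvd n'" "coprime m (5 * n')"
      using mn n'(2) uv(3) 1(2) by auto
    ultimately show ?thesis
      using that mn(1) n'(3) by blast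
  next
    assume 2: "(2 * r)\<^sup>2 + - (50 * s\<^sup>2) = u * pi5 ^ 3 * m ^ 4 + v * gcnj pi5 ^ 3 * n ^ 4"
      "\<not> pi5 dvd n"
    have "(2 * r)\<^sup>2 + 5 * (- 10 * s\<^sup>2) = u * pi5 ^ 3 * m ^ 4 + v * gcnj pi5 ^ 3 * n ^ 4"
      using 2(1) by simp
    then have "u = 1 \<and> v = 1 \<or> u = -1 \<and> v = -1"
      using unit_real_type2[OF uv(1) _ 2(2)] by blast
    then have "gRe ((2 * r)\<^sup>2 + - (50 * s\<^sup>2)) mod 8 = 4"
      using type2_odd_coords(1)[OF _ mn 2(1)] by blast
    moreover have "gRe ((2 * r)\<^sup>2 + - (50 * s\<^sup>2)) = 4 * gRe (r\<^sup>2) - 50 * gRe (s\<^sup>2)"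
      by (simp add: power_mult_distrib)
    ultimately show ?thesis
      using odd_square_coords(1)[OF odd] by presburger
  qed
qed

text \<open>The coordinates of \<open>gl * k\<close> add up to twice the real part of k. So the
  error term of an odd square, known modulo 4 in each coordinate, drops out modulo 8 from their
  sum.\<close>

lemma odd_square_coords_sum: "\<not> gl dvd z \<Longrightarrow> (gRe (z\<^sup>2) + gIm (z\<^sup>2)) mod 8 \<in> {1, 7}"
proof -
  assume "\<not> gl dvd z"
  then obtain e k where k: "e = 1 \<or> e = -1" "z\<^sup>2 = e * (1 + 4 * gl * k)"
    using odd_square_gint by blast
  then have "z\<^sup>2 = e + 4 * (e * gl * k)"
    by (simp add: algebra_simps)
  then have "gRe (z\<^sup>2) + gIm (z\<^sup>2) = gRe e + gIm e + 8 * gRe (e * k)"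
    using k(1) by auto
  with k(1) show ?thesis
    by (elim disjE; simp; presburger)
qed

lemma quartic5_odd_odd_aux:
  assumes eq: "(2 * r)\<^sup>2 = m ^ 4 + 50 * (m * n)\<^sup>2 + 125 * n ^ 4" and odd: "\<not> gl dvd m" "\<not> gl dvd n"
    and cop: "coprime m (5 * n)"
  obtains p r' s where "gl dvd r" "p\<^sup>2 = r' ^ 4 - 25 * (r' * s)\<^sup>2 + 125 * s ^ 4" "\<not> gl dvd r'"
    "\<not> gl dvd s" "coprime r' (5 * s)"
proof -
  define X where "X = m\<^sup>2 + 25 * n\<^sup>2"
  have "2 dvd X"
    using odd_square_coords[OF odd(1)] odd_square_coords[OF odd(2)]
    unfolding numeral_dvd_gint_iff X_def by (simp; presburger)
  then obtain H where H: "X = 2 * H" ..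
  have "4 * ((H - r) * (H + r)) = X\<^sup>2 - (2 * r)\<^sup>2"
    unfolding H by (simp add: power2_eq_square algebra_simps)
  also have "\<dots> = 4 * (125 * n ^ 4)"
    unfolding eq X_def by (simp add: power2_eq_square eval_nat_numeral algebra_simps)
  finally have prod: "(H - r) * (H + r) = 125 * n ^ 4"
    by simp
  have sum: "(H - r) + (H + r) = X"
    by (simp add: H)
  have "coprime (m\<^sup>2 + 25 * n\<^sup>2) (5 * n)"
  proof (rule coprime_addI)
    show "coprime (m\<^sup>2) (5 * n)"
      using cop by (simp only: coprime_power_left_iff) simp
    have "25 * n\<^sup>2 = 5 * n * (5 * n)"
      by (simp add: power2_eq_square)
    then show "5 * n dvd 25 * n\<^sup>2"
      by (metis dvd_triv_left)
  qed
  then have cop2: "coprime ((H - r) + (H + r)) (5 * n)"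
    unfolding sum X_def .
  have "n \<noteq> 0"
    using odd by auto
  obtain u v \<rho> \<sigma> where uv: "u * v = 1" "n = \<rho> * \<sigma>" "coprime \<rho> \<sigma>"
    "X = u * \<rho> ^ 4 + 125 * v * \<sigma> ^ 4 \<and> coprime \<rho> 5 \<or>
     X = u * pi5 ^ 3 * \<rho> ^ 4 + v * gcnj pi5 ^ 3 * \<sigma> ^ 4 \<and> \<not> pi5 dvd \<sigma>"
    using coprime_mult_eq_125_fourth_power[OF coprime_125_factors[OF prod cop2] prod \<open>n \<noteq> 0\<close>]
    unfolding sum by metis
  have rs: "\<not> gl dvd \<rho>" "\<not> gl dvd \<sigma>"
    using odd uv(2) by auto
  have Xm: "X = m\<^sup>2 + 5 * (5 * n\<^sup>2)"
    by (simp add: X_def)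
  from uv(4) show ?thesis
  proof (elim disjE conjE)
    assume 1: "X = u * \<rho> ^ 4 + 125 * v * \<sigma> ^ 4" "coprime \<rho> 5"
    have "\<not> pi5 dvd \<rho>"
      using 1(2) five_eq prime_elem_pi5(1)
      by (metis coprime_common_divisor dvd_triv_left prime_elem_not_unit)
    moreover have "m\<^sup>2 + 5 * (5 * n\<^sup>2) = u * \<rho> ^ 4 + 5 * (25 * v * \<sigma> ^ 4)"
      using 1(1) unfolding Xm by simp
    ultimately have real: "u = 1 \<and> v = 1 \<or> u = -1 \<and> v = -1"
      using unit_real_type1[OF uv(1)] by blast
    have "m\<^sup>2 + 25 * (\<rho> * \<sigma>)\<^sup>2 = u * \<rho> ^ 4 + 125 * v * \<sigma> ^ 4"
      using 1(1) unfolding X_def uv(2) .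
    then obtain p s' where s': "p\<^sup>2 = \<rho> ^ 4 - 25 * (\<rho> * s')\<^sup>2 + 125 * s' ^ 4"
      "s' = \<sigma> \<or> s' = gi * \<sigma>"
      using quartic5_twist real by blast
    have "gl dvd r"
    proof (rule ccontr)
      assume "\<not> gl dvd r"
      moreover have "\<not> gl dvd (H - r) * (H + r)"
        unfolding prod using odd by simp
      ultimately have "gl dvd H"
        by (simp add: gl_dvd_diff_iff gl_dvd_add_iff)
      then obtain H' where "H = gl * H'" ..
      then have "gRe X + gIm X = 4 * gRe H'"
        by (simp add: H)
      \<comment> \<open>If r were odd, X would be \<open>2 * gl\<close> times an integer, with
        coordinate sum divisible by 4; but odd fourth powers have coordinate sum 1 modulo 8, and 1 +
        125 is 2 modulo 4.\<close>
      moreover define a b where "a = gRe (\<rho> ^ 4) + gIm (\<rho> ^ 4)" and "b = gRe (\<sigma> ^ 4) + gIm (\<sigma> ^ 4)"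
      have "gRe X + gIm X = a + 125 * b \<or> gRe X + gIm X = - (a + 125 * b)"
        using real unfolding 1(1) a_def b_def by auto
      ultimately have "4 * (gRe H' - 31 * b) = a + b \<or> 4 * (gRe H' + 31 * b) = - (a + b)"
        by auto
      then have "4 dvd a + b"
        by (metis dvd_minus_iff dvd_triv_left)
      moreover have "a mod 8 = 1" "b mod 8 = 1"
        using odd_fourth_coords[OF rs(1)] odd_fourth_coords[OF rs(2)]
        unfolding a_def b_def by presburger+
      ultimately show False
        by presburger
    qed
    then show ?thesis
      using that[OF _ s'(1)] s'(2) rs uv(3) 1(2) by auto
  next
    assume 2: "X = u * pi5 ^ 3 * \<rho> ^ 4 + v * gcnj pi5 ^ 3 * \<sigma> ^ 4" "\<not> pi5 dvd \<sigma>"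
    have "u = 1 \<and> v = 1 \<or> u = -1 \<and> v = -1"
      using unit_real_type2[OF uv(1) _ 2(2)] 2(1) unfolding Xm by blast
    then have "gRe X mod 8 = 4" "gIm X mod 8 = 0"
      using type2_odd_coords[OF _ rs 2(1)] by blast+
    then have "(gRe X + gIm X) mod 8 = 4"
      by presburger
    moreover define a b where "a = gRe (m\<^sup>2) + gIm (m\<^sup>2)" and "b = gRe (n\<^sup>2) + gIm (n\<^sup>2)"
    then have "gRe X + gIm X = (a + b) + 8 * (3 * b)"
      by (simp add: X_def)
    ultimately have "((a + b) + 8 * (3 * b)) mod 8 = 4"
      by metis
    then have "(a mod 8 + b mod 8) mod 8 = 4"
      unfolding mod_mult_self2 mod_add_eq .
    moreover have "a mod 8 \<in> {1, 7}" "b mod 8 \<in> {1, 7}"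
      unfolding a_def b_def using odd_square_coords_sum odd by blast+
    ultimately have False
      by auto
    then show ?thesis ..
  qed
qed

text \<open>No infinite descent is needed. One round trip yields a solution of the same shape whose
  r is, up to a unit, the odd \<open>r'\<close> of the intermediate quartic; yet every solution of
  this shape has even r.\<close>

lemma quartic5_odd_odd:
  assumes eq: "(2 * r)\<^sup>2 = m ^ 4 + 50 * (m * n)\<^sup>2 + 125 * n ^ 4" and odd: "\<not> gl dvd m" "\<not> gl dvd n"
    and cop: "coprime m (5 * n)"
  shows False
proof -
  obtain p r' s where 1: "p\<^sup>2 = r' ^ 4 - 25 * (r' * s)\<^sup>2 + 125 * s ^ 4" "\<not> gl dvd r'"
    "\<not> gl dvd s" "coprime r' (5 * s)"
    using quartic5_odd_odd_aux[OF assms] by metis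
  obtain c m' n' where 2: "(2 * (c * r'))\<^sup>2 = m' ^ 4 + 50 * (m' * n')\<^sup>2 + 125 * n' ^ 4" "\<not> gl dvd m'"
    "\<not> gl dvd n'" "coprime m' (5 * n')" "c = 1 \<or> c = gi"
    using quartic5_stepB'[OF 1(1,3,4)] by metis
  have "gl dvd c * r'"
    using quartic5_odd_odd_aux[OF 2(1-4)] by metis
  then show False
    using 1(2) 2(5) by auto
qed

text \<open>If the intermediate s is even, the step back produces a solution with smaller d; if it
  is odd, it produces one with both variables odd, which is impossible.\<close>

lemma quartic5_no_solution:
  assumes "l\<^sup>2 = p ^ 4 + 50 * (p * d)\<^sup>2 + 125 * d ^ 4" "\<not> gl dvd p" "gl dvd d"
    "coprime p (5 * d)" "d \<noteq> 0"
  shows False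
  using assms
proof (induction "nat (gnorm d)" arbitrary: l p d rule: less_induct)
  case less
  obtain p' r s where 1: "p'\<^sup>2 = r ^ 4 - 25 * (r * s)\<^sup>2 + 125 * s ^ 4" "gnorm d = gnorm r * gnorm s"
    "coprime r (5 * s)" "gl dvd r \<longleftrightarrow> \<not> gl dvd s"
    using quartic5_stepA[OF less.prems] by metis
  have rs: "gnorm r \<ge> 1" "gnorm s \<ge> 1"
    using 1(2) \<open>d \<noteq> 0\<close> by (auto intro!: gnorm_ge_1)
  show False
  proof (cases "gl dvd s")
    case True
    then have "\<not> gl dvd r" "s \<noteq> 0"
      using 1(4) rs by auto
    then obtain l' m n where 2: "l'\<^sup>2 = m ^ 4 + 50 * (m * n)\<^sup>2 + 125 * n ^ 4" "\<not> gl dvd m" "gl dvd n"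
      "coprime m (5 * n)" "n \<noteq> 0" "gnorm n < gnorm s"
      using quartic5_stepB[OF 1(1) _ True 1(3)] by metis
    have "1 * gnorm s \<le> gnorm r * gnorm s"
      using rs by (intro mult_right_mono) auto
    then have "nat (gnorm n) < nat (gnorm d)"
      using 2(6) 1(2) rs by linarith
    then show False
      using less.hyps[OF _ 2(1-5)] by blast
  next
    case False
    obtain c m n where 2: "(2 * (c * r))\<^sup>2 = m ^ 4 + 50 * (m * n)\<^sup>2 + 125 * n ^ 4" "\<not> gl dvd m"
      "\<not> gl dvd n" "coprime m (5 * n)"
      using quartic5_stepB'[OF 1(1) False 1(3)] by metis
    then show False
      using quartic5_odd_odd by blast
  qed
qed

subsection \<open>The exponent 5\<close>

lemma squarefree_5: "squarefree (5 :: gint)"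
  unfolding five_eq using coprime_pi5 prime_elem_pi5
  by (intro squarefree_mult_coprime squarefree_prime_elem)

lemma squarefree_dvd_power_imp_dvd:
  fixes g h :: "'a :: factorial_semiring_gcd"
  assumes "squarefree g" "g dvd h ^ n"
  shows "g dvd h"
proof -
  define d where "d = gcd g h"
  have "g \<noteq> 0"
    using assms(1) by auto
  obtain g1 where g1: "g = d * g1"
    unfolding d_def by (metis dvdE gcd_dvd1)
  have "is_unit g1"
  proof (rule ccontr)
    assume "\<not> is_unit g1"
    moreover have "g1 \<noteq> 0"
      using g1 \<open>g \<noteq> 0\<close> by auto
    ultimately obtain p where p: "prime p" "p dvd g1"
      using prime_divisor_exists by blast
    then have "p dvd g"
      unfolding g1 by simp
    moreover from this have "p dvd h"
      using assms(2) p(1) by (meson dvd_trans prime_dvd_power)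
    ultimately have "p dvd d"
      by (simp add: d_def)
    then have "p\<^sup>2 dvd g"
      unfolding g1 power2_eq_square using p(2) by (rule mult_dvd_mono)
    then have "is_unit p"
      using assms(1) by (rule squarefreeD[rotated])
    then show False
      using p(1) not_prime_unit by blast
  qed
  then have "g dvd d"
    unfolding g1 by (simp only: mult_unit_dvd_iff dvd_refl)
  then show ?thesis
    by (simp add: d_def)
qed

lemma pi5_dvd_frobenius: "pi5 dvd z ^ 5 - z"
proof -
  have "red5 (z ^ 5) mod 5 = (red5 z mod 5) ^ 5 mod 5"
    using red5_power[of z 5] by (simp add: cong_def power_mod)
  moreover have "red5 z mod 5 \<in> {0, 1, 2, 3, 4}"
    by (simp; presburger)
  ultimately have "red5 (z ^ 5) mod 5 = red5 z mod 5"
    by auto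
  then show ?thesis
    by (simp add: pi5_dvd_iff mod_eq_dvd_iff)
qed

lemma gcnj_dvd_gcnj: "a dvd b \<Longrightarrow> gcnj a dvd gcnj b"
  by (auto simp: gcnj_mult)

lemma gcnj_simps2: "gcnj (a - b) = gcnj a - gcnj b" "gcnj (gcnj a) = a" "gcnj (a ^ n) = gcnj a ^ n"
proof -
  show "gcnj (a ^ n) = gcnj a ^ n"
    by (induction n) (simp_all add: gcnj_mult, simp add: gint_eq_iff)
qed (simp_all add: gint_eq_iff)

lemma prime_dvd_5_frobenius:
  fixes p :: gint
  assumes "prime_elem p" "p dvd 5"
  shows "p dvd z ^ 5 - z"
proof -
  have "p dvd pi5 \<or> p dvd gcnj pi5"
    using assms by (simp add: five_eq prime_elem_dvd_mult_iff)
  moreover have "gcnj pi5 dvd z ^ 5 - z"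
    using gcnj_dvd_gcnj[OF pi5_dvd_frobenius[of "gcnj z"]] by (simp add: gcnj_simps2)
  ultimately show ?thesis
    using pi5_dvd_frobenius dvd_trans by blast
qed

text \<open>The first two congruences and the norm also admit 1 and -3 + 4i, -3 - 4i, but their
  coordinate sums are 1 modulo 8.\<close>

lemma divisor_5_cases:
  assumes "w dvd 5" "gRe w mod 4 = 1" "gIm w mod 4 = 0" "(gRe w + gIm w) mod 8 = 5"
  shows "w = 5"
proof -
  have N: "gnorm w dvd 25"
    using gnorm_dvd[OF assms(1)] by simp
  then have "gnorm w \<le> 25"
    by (intro zdvd_imp_le) auto
  then have "(gRe w)\<^sup>2 \<le> 25" "(gIm w)\<^sup>2 \<le> 25"
    using zero_le_power2[of "gRe w"] zero_le_power2[of "gIm w"] unfolding gnorm_def by linarith+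
  then have "(gRe w)\<^sup>2 \<le> 5\<^sup>2" "(gIm w)\<^sup>2 \<le> 5\<^sup>2"
    by simp_all
  then have "\<bar>gRe w\<bar> \<le> 5" "\<bar>gIm w\<bar> \<le> 5"
    by (simp_all only: power2_le_iff_abs_le)
  then have "gRe w = -3 \<or> gRe w = 1 \<or> gRe w = 5" "gIm w = -4 \<or> gIm w = 0 \<or> gIm w = 4"
    using assms(2,3) by presburger+
  with assms(4) N show ?thesis
    by (auto simp: gint_eq_iff gnorm_def)
qed

text \<open>\<open>Q\<close> is (e^5 - f^5)/(e - f) expanded in powers of D. Its common factor with
  D divides 5, and the cofactor is a unit times a square. As Q is 5 modulo 8, the common factor and
  the unit can be identified.\<close>

lemma quintic_quotient:
  fixes e f :: gint
  defines "D \<equiv> e - f" and "Q \<equiv> 5 * f ^ 4 + 10 * f ^ 3 * (e - f) + 10 * f\<^sup>2 * (e - f)\<^sup>2 + 5 * f * (e - f) ^ 3 + (e - f) ^ 4"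
  assumes eq: "g * (D * Q) = 5 * K\<^sup>2" and g: "g dvd 5" and cop: "coprime e f"
    and f_odd: "\<not> gl dvd f" and D8: "8 dvd D" and "D \<noteq> 0"
  shows "5 dvd D \<and> (\<exists>L. Q = 5 * L\<^sup>2)"
proof -
  have DQ: "D * Q = e ^ 5 - f ^ 5"
    unfolding D_def Q_def by (simp add: power2_eq_square eval_nat_numeral algebra_simps)
  obtain D1 where D1: "D = 8 * D1"
    using D8 ..
  obtain k where k: "f ^ 4 = 1 + 8 * gl * k"
    using odd_fourth_gint[OF f_odd] .
  have "Q = 5 + 8 * (5 * gl * k + D1 * (10 * f ^ 3 + 10 * f\<^sup>2 * D + 5 * f * D\<^sup>2 + D ^ 3))"
    (is "_ = _ + 8 * ?R")
  proof -
    have "Q = 5 * f ^ 4 + D * (10 * f ^ 3 + 10 * f\<^sup>2 * D + 5 * f * D\<^sup>2 + D ^ 3)"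
      unfolding Q_def D_def by (simp add: power2_eq_square eval_nat_numeral algebra_simps)
    then show ?thesis
      unfolding k by (simp add: D1 algebra_simps)
  qed
  then obtain R where R: "Q = 5 + 8 * R" by blast
  then have "Q \<noteq> 0"
    by (auto simp: gint_eq_iff) presburger
  have cop_f: "coprime D f"
    using coprime_addI[OF cop, of "- f"] unfolding D_def by simp
  define \<delta> where "\<delta> = gcd Q D"
  have \<delta>: "\<delta> dvd Q" "\<delta> dvd D"
    by (simp_all add: \<delta>_def)
  have \<delta>5: "\<delta> dvd 5"
  proof -
    have "5 * f ^ 4 = Q - D * (10 * f ^ 3 + 10 * f\<^sup>2 * D + 5 * f * D\<^sup>2 + D ^ 3)"
      unfolding Q_def D_def by (simp add: power2_eq_square eval_nat_numeral algebra_simps)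
    also have "\<delta> dvd \<dots>"
      using \<delta> by (intro dvd_diff dvd_mult2)
    finally have "\<delta> dvd 5 * f ^ 4" .
    moreover have "coprime \<delta> (f ^ 4)"
      using \<delta>(2) cop_f by (metis coprime_divisors coprime_power_right_iff dvd_refl)
    ultimately show ?thesis
      by (simp add: coprime_dvd_mult_left_iff)
  qed
  obtain Q1 where Q1: "Q = \<delta> * Q1"
    using \<delta>(1) ..
  \<comment> \<open>A bad prime above 5 divides D by Fermat (z^5 = z in its residue field), so its
    square divides both Q and Q - 5f^4, contradicting that 5 is squarefree.\<close>
  have "coprime (5 * g * D * \<delta>) Q1"
  proof (rule gint_coprimeI)
    show "5 * g * D * \<delta> \<noteq> 0 \<or> Q1 \<noteq> 0"
      using \<open>Q \<noteq> 0\<close> Q1 by auto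
    fix p :: gint
    assume p: "prime_elem p" "p dvd 5 * g * D * \<delta>" "p dvd Q1"
    have pQ: "p dvd Q"
      unfolding Q1 using p(3) by simp
    have "p dvd 5 \<or> p dvd D"
      using p(1,2) g \<delta>5 dvd_trans by (auto simp: prime_elem_dvd_mult_iff)
    then have pD: "p dvd D"
    proof
      assume p5: "p dvd 5"
      have "p dvd (e ^ 5 - f ^ 5) - ((e ^ 5 - e) - (f ^ 5 - f))"
        using dvd_diff[OF dvd_mult[OF pQ, of D]
          dvd_diff[OF prime_dvd_5_frobenius[OF p(1) p5] prime_dvd_5_frobenius[OF p(1) p5]]]
        unfolding DQ .
      then show ?thesis
        by (simp add: D_def)
    qed
    then have p\<delta>: "p dvd \<delta>"
      using pQ by (simp add: \<delta>_def)
    have p5: "p dvd 5"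
      using p\<delta> \<delta>5 dvd_trans by blast
    obtain c where c: "5 = p * c"
      using p5 ..
    have "p\<^sup>2 dvd Q"
      unfolding Q1 power2_eq_square using p\<delta> p(3) by (rule mult_dvd_mono)
    moreover have "p\<^sup>2 dvd D * (10 * f ^ 3 + D * (10 * f\<^sup>2 + 5 * f * D + D\<^sup>2))"
    proof -
      have "p dvd 2 * 5 * f ^ 3"
        using p5 by (intro dvd_mult2 dvd_mult)
      then have "p dvd 10 * f ^ 3 + D * (10 * f\<^sup>2 + 5 * f * D + D\<^sup>2)"
        using pD by simp
      then show ?thesis
        unfolding power2_eq_square using pD by (rule mult_dvd_mono[rotated])
    qed
    ultimately have "p\<^sup>2 dvd Q - D * (10 * f ^ 3 + D * (10 * f\<^sup>2 + 5 * f * D + D\<^sup>2))"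
      by (rule dvd_diff)
    also have "\<dots> = 5 * f ^ 4"
      unfolding Q_def D_def by (simp add: power2_eq_square eval_nat_numeral algebra_simps)
    finally have "p\<^sup>2 dvd 5 * f ^ 4" .
    moreover have "coprime (p\<^sup>2) (f ^ 4)"
      using pD cop_f by (metis coprime_divisors coprime_power_left_iff coprime_power_right_iff dvd_refl)
    ultimately have "p\<^sup>2 dvd 5"
      by (simp add: coprime_dvd_mult_left_iff)
    then show False
      using squarefreeD[OF squarefree_5] p(1) prime_elem_not_unit by blast
  qed
  moreover have "(5 * g * D * \<delta>) * Q1 = (5 * K)\<^sup>2"
  proof -
    have "(5 * g * D * \<delta>) * Q1 = 5 * (g * (D * Q))"
      unfolding Q1 by (simp add: algebra_simps)
    then show ?thesis
      unfolding eq by (simp add: power2_eq_square algebra_simps)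
  qed
  ultimately obtain u l where u: "is_unit u" "Q1 = u * l\<^sup>2"
    using coprime_mult_eq_power[of Q1 "5 * g * D * \<delta>" "5 * K" 2]
    by (auto simp: coprime_commute mult.commute)
  have "\<not> gl dvd Q"
    unfolding R by (simp add: gl_dvd_add_iff)
  then have "\<not> gl dvd l"
    unfolding Q1 u(2) by auto
  then obtain \<epsilon> \<kappa> where \<kappa>: "\<epsilon> = 1 \<or> \<epsilon> = -1" "l\<^sup>2 = \<epsilon> * (1 + 4 * gl * \<kappa>)"
    using odd_square_gint by blast
  \<comment> \<open>All unknown units and the common factor are gathered in w, so that Q = w(1 + 4
    gl \<kappa>); hence w agrees with Q, and so with 5, modulo \<open>4 * gl\<close>.\<close>
  define w where "w = \<delta> * u * \<epsilon>"
  have "w = Q - 4 * gl * (\<kappa> * w)"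
    unfolding Q1 u(2) \<kappa>(2) w_def by (simp add: algebra_simps)
  then have w5: "w = 5 + 8 * R - 4 * gl * (\<kappa> * w)"
    unfolding R .
  define T where "T = \<kappa> * w"
  have wc: "gRe w = 5 + 8 * gRe R - 4 * (gRe T - gIm T)" "gIm w = 8 * gIm R - 4 * (gRe T + gIm T)"
    using w5 unfolding T_def[symmetric] gint_eq_iff by simp_all
  have \<epsilon>: "is_unit \<epsilon>"
    using \<kappa>(1) by auto
  have "w dvd 5"
    unfolding w_def using \<delta>5 u(1) \<epsilon> by (simp add: mult_unit_dvd_iff)
  moreover have "gRe w mod 4 = 1" "gIm w mod 4 = 0" "(gRe w + gIm w) mod 8 = 5"
    unfolding wc by presburger+
  ultimately have "w = 5"
    by (rule divisor_5_cases)
  have "5 dvd \<delta>"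
    using \<open>w = 5\<close> u(1) \<epsilon> unfolding w_def by (metis dvd_mult_unit_iff dvd_refl)
  then have "5 dvd D"
    using \<delta>(2) dvd_trans by blast
  moreover have "\<epsilon> * \<epsilon> = 1"
    using \<kappa>(1) by auto
  then have "Q = w * (\<epsilon> * l\<^sup>2)"
    unfolding Q1 u(2) w_def by (simp add: algebra_simps)
  then have "Q = 5 * (\<epsilon> * l\<^sup>2)"
    using \<open>w = 5\<close> by simp
  moreover have "\<exists>L. \<epsilon> * l\<^sup>2 = L\<^sup>2"
    using \<kappa>(1) by (metis gi_sq mult_1 power_mult_distrib)
  ultimately show ?thesis
    by metis
qed

proposition catalan_5_exact:
  assumes eq: "B ^ 5 = 4 * (a ^ 5 - 1)" and B: "gl dvd B" "\<not> 2 dvd B" and a_odd: "\<not> gl dvd a"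
  shows "a\<^sup>2 = -1"
proof (rule ccontr)
  assume contr: "a\<^sup>2 \<noteq> -1"
  obtain b where b: "B = gl * b"
    using B(1) ..
  have b_odd: "\<not> gl dvd b"
  proof
    assume "gl dvd b"
    then obtain c where "b = gl * c" ..
    then have "B = 2 * (gi * c)"
      using b gl_sq by (metis mult.assoc power2_eq_square)
    then show False
      using B(2) by simp
  qed
  define \<Phi> where "\<Phi> = a ^ 4 + a ^ 3 + a\<^sup>2 + a + 1"
  have "gl ^ 5 = -4 * gl"
    using gl_pow4 by (simp add: eval_nat_numeral gint_eq_iff)
  moreover have "4 * (a ^ 5 - 1) = gl ^ 5 * b ^ 5"
    by (simp only: eq[symmetric] b power_mult_distrib)
  ultimately have "4 * (a ^ 5 - 1) = 4 * (gl * (- b) ^ 5)"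
    by simp
  then have "a ^ 5 - 1 = gl * (- b) ^ 5"
    by (metis mult_left_cancel zero_neq_numeral)
  moreover have "(a - 1) * \<Phi> = a ^ 5 - 1"
    unfolding \<Phi>_def by (simp add: power2_eq_square eval_nat_numeral algebra_simps)
  ultimately have prod: "(a - 1) * \<Phi> = gl * (- b) ^ 5"
    by simp
  have \<Phi>_odd: "\<not> gl dvd \<Phi>"
    unfolding \<Phi>_def using a_odd by (simp add: gl_dvd_add_iff)
  have "gl dvd (a - 1) * \<Phi>"
    unfolding prod by simp
  then have "gl dvd a - 1"
    using \<Phi>_odd by simp
  then obtain A where "a - 1 = gl * A" ..
  then have a: "a = 1 + gl * A"
    by (simp add: diff_eq_eq add.commute)
  have "gl * (A * \<Phi>) = gl * (- b) ^ 5"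
    using prod unfolding \<open>a - 1 = gl * A\<close> by (simp add: mult.assoc)
  then have A\<Phi>: "A * \<Phi> = (- b) ^ 5"
    by (metis gl_neq_0 mult_left_cancel)
  have "\<not> gl dvd A * \<Phi>"
    unfolding A\<Phi> using b_odd by simp
  then have A_odd: "\<not> gl dvd A"
    by simp
  have "A \<noteq> 0" "\<Phi> \<noteq> 0"
    using A_odd \<Phi>_odd by auto
  have \<Phi>A: "\<Phi> = 5 + A * (gl * (10 + 10 * gl * A + 5 * (gl * A)\<^sup>2 + (gl * A) ^ 3))"
    unfolding \<Phi>_def a by (simp add: power2_eq_square eval_nat_numeral algebra_simps)
  \<comment> \<open>Exactness is used here: A is odd, so a = 2 + i + 2it for some t, and a^2 + 1
    gains a factor \<open>gl\<close> beyond 4 from the even product t(t + 1).\<close>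
  obtain k where k: "a\<^sup>2 + 1 = 4 * gl * k"
  proof -
    have "gl dvd A - 1"
      using A_odd by (simp add: gl_dvd_diff_iff)
    then obtain t where "A - 1 = gl * t" ..
    then have A: "A = 1 + gl * t"
      by (simp add: diff_eq_eq add.commute)
    have "gl dvd t * (t + 1)"
      by (auto simp: gl_dvd_add_iff)
    then obtain t' where t': "t * (t + 1) = gl * t'" ..
    have a': "a = 2 + gi + 2 * gi * t"
      unfolding a A by (simp add: gint_eq_iff)
    have "a\<^sup>2 + 1 = 4 * (gl + 2 * gi * t - t * (t + 1))"
      unfolding a' by (simp add: power2_eq_square gint_eq_iff algebra_simps)
    also have "\<dots> = 4 * gl * (1 + (1 - gi) * gi * t - t')"
      unfolding t' by (simp add: two_eq_gl(1) algebra_simps)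
    finally show ?thesis
      using that by blast
  qed
  have "k \<noteq> 0"
    using k contr by (auto simp: add_eq_0_iff2)
  define g where "g = gcd A \<Phi>"
  have g: "g dvd A" "g dvd \<Phi>" "g \<noteq> 0"
    using \<open>A \<noteq> 0\<close> by (simp_all add: g_def)
  have g5: "g dvd 5"
  proof -
    have "5 = \<Phi> - A * (gl * (10 + 10 * gl * A + 5 * (gl * A)\<^sup>2 + (gl * A) ^ 3))"
      using \<Phi>A by (simp add: eq_diff_eq)
    also have "g dvd \<dots>"
      using g by (intro dvd_diff dvd_mult2)
    finally show ?thesis .
  qed
  obtain \<Phi>1 where \<Phi>1: "\<Phi> = g * \<Phi>1"
    using g(2) ..
  have cop_\<Phi>1: "coprime \<Phi>1 (A * g)"
  proof (rule gint_coprimeI)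
    show "\<Phi>1 \<noteq> 0 \<or> A * g \<noteq> 0"
      using \<open>\<Phi> \<noteq> 0\<close> \<Phi>1 by auto
    fix p :: gint
    assume p: "prime_elem p" "p dvd \<Phi>1" "p dvd A * g"
    have "p dvd A"
      using p(1,3) g(1) dvd_trans by (auto simp: prime_elem_dvd_mult_iff)
    moreover have "p dvd \<Phi>"
      unfolding \<Phi>1 using p(2) by simp
    ultimately have pg: "p dvd g"
      by (simp add: g_def)
    have p5: "p dvd 5"
      using pg g5 dvd_trans by blast
    have "p\<^sup>2 dvd \<Phi>"
      unfolding \<Phi>1 power2_eq_square using pg p(2) by (rule mult_dvd_mono)
    moreover have "p\<^sup>2 dvd A * (gl * (10 + 10 * gl * A + 5 * (gl * A)\<^sup>2 + (gl * A) ^ 3))"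
    proof -
      have "p dvd 2 * 5"
        using p5 by (rule dvd_mult)
      then have "p dvd 10"
        by simp
      then have "p dvd gl * (10 + 10 * gl * A + 5 * (gl * A)\<^sup>2 + (gl * A) ^ 3)"
        using \<open>p dvd A\<close> by (intro dvd_mult dvd_add) (auto simp: power_mult_distrib
            power2_eq_square power3_eq_cube)
      then show ?thesis
        unfolding power2_eq_square using \<open>p dvd A\<close> by (rule mult_dvd_mono[rotated])
    qed
    ultimately have "p\<^sup>2 dvd \<Phi> - A * (gl * (10 + 10 * gl * A + 5 * (gl * A)\<^sup>2 + (gl * A) ^ 3))"
      by (rule dvd_diff)
    then have "p\<^sup>2 dvd 5"
      unfolding \<Phi>A by simp
    then show False
      using squarefreeD[OF squarefree_5] p(1) prime_elem_not_unit by blast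
  qed
  have prod2: "\<Phi>1 * (A * g) = (- b) ^ 5"
    using A\<Phi> unfolding \<Phi>1 by (simp add: mult_ac)
  obtain e where e: "\<Phi>1 = e ^ 5"
    using coprime_mult_eq_odd_power[OF cop_\<Phi>1 prod2] by auto
  obtain h where h: "A * g = h ^ 5"
    using coprime_mult_eq_odd_power[of "A * g" \<Phi>1 "- b" 5] cop_\<Phi>1 prod2
    by (auto simp: coprime_commute mult.commute)
  have "g dvd h ^ 5"
    unfolding h[symmetric] by simp
  then have "g dvd h"
    by (rule squarefree_dvd_power_imp_dvd[OF squarefree_mono[OF g5 squarefree_5]])
  then obtain c where c: "h = g * c" ..
  have Ac: "A = g ^ 4 * c ^ 5"
  proof -
    have "g * A = g * (g ^ 4 * c ^ 5)"
      using h unfolding c by (simp add: power_mult_distrib eval_nat_numeral mult_ac)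
    then show ?thesis
      using g(3) by simp
  qed
  \<comment> \<open>Chosen so that g f^5 = A^4; together with \<Phi> = g e^5 the difference \<Phi> -
    A^4 becomes g times a difference of fifth powers.\<close>
  define f where "f = g ^ 3 * c ^ 4"
  \<comment> \<open>Because \<open>gl ^ 4 = - 4\<close>, the fourth power of a - 1 is -4A^4, and the
    sum on the left is 4 times a difference.\<close>
  have "4 * \<Phi> + (gl * A) ^ 4 = 5 * (a\<^sup>2 + 1)\<^sup>2"
    unfolding \<Phi>_def a by (simp add: power2_eq_square eval_nat_numeral algebra_simps)
  then have "4 * (\<Phi> - A ^ 4) = 5 * (4 * gl * k)\<^sup>2"
    unfolding k power_mult_distrib gl_pow4 by (simp add: algebra_simps)
  also have "\<dots> = 4 * (5 * (2 * gl * k)\<^sup>2)"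
    by (simp add: power_mult_distrib)
  finally have *: "\<Phi> - A ^ 4 = 5 * (2 * gl * k)\<^sup>2"
    by (metis mult_left_cancel zero_neq_numeral)
  define D where "D = e - f"
  define Q where "Q = 5 * f ^ 4 + 10 * f ^ 3 * (e - f) + 10 * f\<^sup>2 * (e - f)\<^sup>2 + 5 * f * (e - f) ^ 3
    + (e - f) ^ 4"
  have "D * Q = e ^ 5 - f ^ 5"
    unfolding D_def Q_def by (simp add: power2_eq_square eval_nat_numeral algebra_simps)
  moreover have "g * (e ^ 5 - f ^ 5) = \<Phi> - A ^ 4"
    unfolding \<Phi>1 e Ac f_def by (simp add: algebra_simps flip: power_mult power_add power_Suc)
  ultimately have gDQ: "g * (D * Q) = 5 * (2 * gl * k)\<^sup>2"
    using * by simp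
  have cop: "coprime e f"
  proof -
    have "coprime (e ^ 5) ((g * c) ^ 5)"
      using cop_\<Phi>1 unfolding e h c .
    then show ?thesis
      by (simp add: f_def)
  qed
  have g_odd: "\<not> gl dvd g" "\<not> gl dvd c"
    using A_odd unfolding Ac by auto
  then have f_odd: "\<not> gl dvd f"
    by (simp add: f_def)
  have e_odd: "\<not> gl dvd e"
    using \<Phi>_odd unfolding \<Phi>1 e by auto
  have Q_odd: "\<not> gl dvd Q"
    unfolding Q_def using f_odd e_odd by (simp add: gl_dvd_add_iff gl_dvd_diff_iff)
  have "D \<noteq> 0"
    using gDQ \<open>k \<noteq> 0\<close> by auto
  have D8: "8 dvd D"
  proof -
    have "8 dvd 5 * (2 * gl * k)\<^sup>2"
    proof -
      have "5 * (2 * gl * k)\<^sup>2 = 8 * (5 * gi * k\<^sup>2)"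
        by (simp add: power_mult_distrib gl_sq)
      then show ?thesis
        by (metis dvd_triv_left)
    qed
    then have "8 dvd (g * Q) * D"
      unfolding gDQ[symmetric] by (simp add: mult_ac)
    moreover have "coprime 8 (g * Q)"
    proof -
      have "coprime gl (g * Q)"
        using g_odd Q_odd by (intro prime_elem_imp_coprime prime_elem_gl) simp
      then have "coprime (gl ^ 6) (g * Q)"
        by simp
      moreover have "gl ^ 6 = - gi * 8"
        by (simp add: eval_nat_numeral gint_eq_iff)
      ultimately show ?thesis
        by simp
    qed
    ultimately show ?thesis
      by (simp add: coprime_dvd_mult_right_iff)
  qed
  obtain L where L: "5 dvd D" "Q = 5 * L\<^sup>2"
    using quintic_quotient[OF gDQ[unfolded D_def Q_def] g5 cop f_odd D8[unfolded D_def]] \<open>D \<noteq> 0\<close>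
    unfolding D_def Q_def by metis
  obtain D1 where D1: "D = 8 * D1"
    using D8 ..
  have "coprime (5 :: gint) 8"
  proof (rule coprimeI)
    fix d :: gint
    assume "d dvd 5" "d dvd 8"
    then have "d dvd 2 * 8 - 3 * 5"
      by (intro dvd_diff dvd_mult)
    then show "is_unit d"
      by simp
  qed
  then have "5 dvd D1"
    using L(1) unfolding D1 by (simp add: coprime_dvd_mult_right_iff)
  then obtain D2 where "D1 = 5 * D2" ..
  then have D2: "e = f + 40 * D2"
    using D1 by (simp add: D_def diff_eq_eq add.commute)
  \<comment> \<open>Midpoint and a tenth of the difference of e and f: e = p + 5d and f = p - 5d
    remove the odd powers of d from the quotient.\<close>
  define d p where "d = 4 * D2" and "p = f + 20 * D2"
  have "5 * L\<^sup>2 = 5 * (p ^ 4 + 50 * (p * d)\<^sup>2 + 125 * d ^ 4)"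
    unfolding L(2)[symmetric] Q_def D2 d_def p_def
    by (simp add: power2_eq_square eval_nat_numeral algebra_simps)
  then have "L\<^sup>2 = p ^ 4 + 50 * (p * d)\<^sup>2 + 125 * d ^ 4"
    by (metis mult_left_cancel zero_neq_numeral)
  moreover have "\<not> gl dvd p" "gl dvd d"
    using f_odd by (simp_all add: p_def d_def gl_dvd_add_iff)
  moreover have "coprime p (5 * d)"
  proof (rule coprimeI)
    fix r
    assume r: "r dvd p" "r dvd 5 * d"
    have "e = p + 5 * d" "f = p - 5 * d"
      by (simp_all add: p_def d_def D2)
    then have "r dvd e" "r dvd f"
      using r by simp_all
    then show "is_unit r"
      using cop by (meson coprime_common_divisor)
  qed
  moreover have "d \<noteq> 0"
    using \<open>D \<noteq> 0\<close> by (auto simp: d_def D_def D2)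
  ultimately show False
    by (rule quartic5_no_solution)
qed

section \<open>Quadratic reciprocity in the Gaussian integers\<close>

subsection \<open>The Jacobi symbol\<close>

lemma Legendre_cong: "[a = b] (mod p) \<Longrightarrow> Legendre a p = Legendre b p"
  unfolding Legendre_def QuadRes_def cong_def by simp

lemma Legendre_values: "Legendre a p \<in> {-1, 0, 1}"
  by (simp add: Legendre_def)

lemma Legendre_0_iff: "Legendre a p = 0 \<longleftrightarrow> p dvd a"
  by (auto simp: Legendre_def cong_0_iff)

lemma euler_criterion_int:
  assumes "prime p" "odd (p :: int)"
  shows "[Legendre a p = a ^ nat ((p - 1) div 2)] (mod p)"
proof -
  have p: "p > 2"
    using assms prime_ge_2_int[of p] by (cases "p = 2") auto
  have "prime (nat p)"
    using assms(1) prime_int_nat_transfer by blast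
  moreover have "2 < nat p"
    using p by simp
  ultimately have "[Legendre a (int (nat p)) = a ^ ((nat p - 1) div 2)] (mod int (nat p))"
    by (rule euler_criterion)
  then show ?thesis
    using p by (simp add: nat_div_distrib nat_diff_distrib)
qed

lemma small_cong_eq:
  assumes "a \<in> {-1, 0, 1}" "b \<in> {-1, 0, 1}" "[a = b] (mod p)" "p > (2 :: int)"
  shows "a = b"
proof -
  have "p dvd a - b"
    using assms(3) by (simp add: cong_iff_dvd_diff)
  moreover have "\<bar>a - b\<bar> < p"
    using assms(1,2,4) by auto
  ultimately show ?thesis
    using dvd_imp_le_int[of "a - b" p] by auto
qed

lemma Legendre_mult:
  assumes "prime p" "odd (p :: int)"
  shows "Legendre (a * b) p = Legendre a p * Legendre b p"
proof (rule small_cong_eq)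
  show "p > 2"
    using assms prime_ge_2_int[of p] by (cases "p = 2") auto
  show "Legendre a p * Legendre b p \<in> {-1, 0, 1}"
    using Legendre_values[of a p] Legendre_values[of b p] by auto
  have "[Legendre a p * Legendre b p = a ^ nat ((p - 1) div 2) * b ^ nat ((p - 1) div 2)] (mod p)"
    using assms by (intro cong_mult euler_criterion_int)
  then show "[Legendre (a * b) p = Legendre a p * Legendre b p] (mod p)"
    using euler_criterion_int[OF assms, of "a * b"]
    by (metis cong_sym cong_trans power_mult_distrib)
qed (rule Legendre_values)

text \<open>Factorization ignores signs, so for odd n this is the Jacobi symbol modulo the absolute
  value; negative odd moduli do occur in the reciprocity law.\<close>

definition jac :: "int \<Rightarrow> int \<Rightarrow> int" where
  "jac a n = (\<Prod>p\<in>#prime_factorization n. Legendre a p)"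

lemma jac_mult_right: "n \<noteq> 0 \<Longrightarrow> m \<noteq> 0 \<Longrightarrow> jac a (n * m) = jac a n * jac a m"
  by (simp add: jac_def prime_factorization_mult)

lemma jac_prime: "prime p \<Longrightarrow> jac a p = Legendre a p"
  by (simp add: jac_def prime_factorization_prime)

lemma jac_unit: "is_unit n \<Longrightarrow> jac a n = 1"
  by (simp add: jac_def prime_factorization_unit)

lemma jac_mult_left:
  assumes "odd n"
  shows "jac (a * b) n = jac a n * jac b n"
  using assms
proof (induction n rule: prime_divisors_induct)
  case (factor p n)
  then have "n \<noteq> 0" "p \<noteq> 0" "odd p" "odd n"
    by auto
  then show ?case
    using factor by (simp add: jac_mult_right jac_prime Legendre_mult)
qed (simp_all add: jac_unit)

lemma jac_cong:
  assumes "[a = b] (mod n)" "n \<noteq> 0"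
  shows "jac a n = jac b n"
  using assms
proof (induction n rule: prime_divisors_induct)
  case (factor p n)
  then have "n \<noteq> 0" "p \<noteq> 0" "[a = b] (mod p)" "[a = b] (mod n)"
    by (auto intro: cong_dvd_modulus)
  then show ?case
    using factor Legendre_cong by (simp add: jac_mult_right jac_prime)
qed (simp_all add: jac_unit)

lemma jac_values: "jac a n \<in> {-1, 0, 1}" if "n \<noteq> 0"
  using that
proof (induction n rule: prime_divisors_induct)
  case (factor p n)
  then show ?case
    using Legendre_values[of a p] by (auto simp: jac_mult_right jac_prime)
qed (simp_all add: jac_unit)

lemma jac_eq_0_iff:
  assumes "n \<noteq> 0"
  shows "jac a n = 0 \<longleftrightarrow> \<not> coprime a n"
  using assms
proof (induction n rule: prime_divisors_induct)
  case (factor p n)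
  have "coprime a p \<longleftrightarrow> \<not> p dvd a"
    using factor(1) by (metis coprime_commute not_prime_unit prime_imp_coprime coprime_absorb_left)
  then show ?case
    using factor by (simp add: jac_mult_right jac_prime Legendre_0_iff)
qed (simp_all add: jac_unit is_unit_right_imp_coprime)

lemma jac_square:
  assumes "odd n" "coprime a n"
  shows "jac (a\<^sup>2) n = 1"
proof -
  have "n \<noteq> 0"
    using assms(1) by auto
  then have "jac a n \<in> {-1, 1}"
    using jac_values[of n a] jac_eq_0_iff[of n a] assms(2) by auto
  then show ?thesis
    using jac_mult_left[OF assms(1), of a a] by (auto simp: power2_eq_square)
qed

text \<open>Sums of two coprime squares of different parity have this form. Reciprocity with one
  such argument has no sign and -1 has symbol 1, so signs of the other argument are
  harmless.\<close>

definition primes14 :: "int \<Rightarrow> bool" where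
  "primes14 n \<longleftrightarrow> n > 0 \<and> (\<forall>p. prime p \<longrightarrow> p dvd n \<longrightarrow> p mod 4 = 1)"

lemma primes14_odd: "primes14 n \<Longrightarrow> odd n"
  by (auto simp: primes14_def dest!: spec[of _ 2])

lemma Legendre_reciprocity14:
  assumes "prime p" "p mod 4 = (1 :: int)" "prime r" "odd r"
  shows "Legendre r p = Legendre p r"
proof (cases "p = r")
  case False
  have "r > 2" "p > 2"
    using assms prime_ge_2_int[of r] prime_ge_2_int[of p] by (cases "r = 2"; cases "p = 2"; auto)+
  moreover have "prime (nat p)" "prime (nat r)"
    using assms prime_int_nat_transfer by blast+
  ultimately have "Legendre p r * Legendre r p = (-1) ^ nat ((p - 1) div 2 * ((r - 1) div 2))"
    using Quadratic_Reciprocity_int[of p r] False by simp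
  moreover have "even ((p - 1) div 2)"
    using assms(2) by presburger
  then have "even (nat ((p - 1) div 2 * ((r - 1) div 2)))"
    using \<open>p > 2\<close> \<open>r > 2\<close> by (simp add: even_nat_iff)
  ultimately have "Legendre p r * Legendre r p = 1"
    by simp
  then show ?thesis
    using Legendre_values[of p r] Legendre_values[of r p] by auto
qed simp

lemma Legendre_minus_one14:
  assumes "prime p" "p mod 4 = (1 :: int)"
  shows "Legendre (-1) p = 1"
proof (rule small_cong_eq)
  have "odd p"
    using assms(2) by presburger
  show "p > 2"
    using assms prime_ge_2_int[of p] by (cases "p = 2") auto
  then have "even (nat ((p - 1) div 2))"
    using assms(2) by (simp add: even_nat_iff) presburger
  then show "[Legendre (-1) p = 1] (mod p)"
    using euler_criterion_int[OF assms(1) \<open>odd p\<close>, of "-1"] by simp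
qed (use Legendre_values in auto)

lemma primes14_mult:
  assumes "primes14 (p * n)" "prime p"
  shows "primes14 n" "p mod 4 = 1" "odd p" "n \<noteq> 0"
proof -
  show "p mod 4 = 1"
    using assms by (simp add: primes14_def)
  then show "odd p"
    by presburger
  have "n > 0"
    using assms prime_gt_0_int[of p] by (simp add: primes14_def zero_less_mult_iff)
  then show "primes14 n" "n \<noteq> 0"
    using assms by (auto simp: primes14_def)
qed

lemma jac_reciprocity_prime:
  assumes "primes14 n" "prime r" "odd r"
  shows "jac r n = Legendre n r"
  using assms(1)
proof (induction n rule: prime_divisors_induct)
  case zero
  then show ?case by (simp add: primes14_def)
next
  case (unit n)
  then have "n = 1"
    by (auto simp: primes14_def)
  moreover have "Legendre 1 r = 1"
    using assms(2) prime_gt_1_int[of r]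
    by (auto simp: Legendre_def QuadRes_def cong_0_iff intro!: exI[of _ 1])
  ultimately show ?case
    by (simp add: jac_unit)
next
  case (factor p n)
  note 1 = primes14_mult[OF factor.prems factor.hyps]
  then have "p \<noteq> 0"
    by auto
  then show ?case
    using factor 1 Legendre_reciprocity14[of p r] assms(2,3)
    by (simp add: jac_mult_right jac_prime Legendre_mult)
qed

lemma jac_minus_one:
  assumes "primes14 n"
  shows "jac (-1) n = 1"
  using assms
proof (induction n rule: prime_divisors_induct)
  case zero
  then show ?case by (simp add: primes14_def)
next
  case (factor p n)
  note 1 = primes14_mult[OF factor.prems factor.hyps]
  then have "p \<noteq> 0"
    by auto
  then show ?case
    using factor 1 Legendre_minus_one14 by (simp add: jac_mult_right jac_prime)
qed (simp add: jac_unit)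

lemma jac_one: "odd n \<Longrightarrow> jac 1 n = 1"
  using jac_square[of n 1] by simp

lemma jac_reciprocity:
  assumes "primes14 n" "odd r"
  shows "jac r n = jac n r"
  using assms(2)
proof (induction r rule: prime_divisors_induct)
  case (unit r)
  then have "r = 1 \<or> r = -1"
    by auto
  then show ?case
    using jac_minus_one[OF assms(1)] jac_one[OF primes14_odd[OF assms(1)]] unit
    by (auto simp: jac_unit)
next
  case (factor p r)
  then have "odd p" "odd r" "p \<noteq> 0" "r \<noteq> 0"
    by auto
  then show ?case
    using factor jac_reciprocity_prime[OF assms(1)]
    by (simp add: jac_mult_left primes14_odd[OF assms(1)] jac_mult_right jac_prime)
qed simp

text \<open>By Euler's criterion the Legendre symbol of w modulo p is (-1)^((p - 1)/4), which is 1
  exactly when p is 1 modulo 8; both sides are multiplicative over classes 1 and 5.\<close>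

lemma jac_sqrt_minus_one:
  assumes "primes14 n" "[w\<^sup>2 = -1] (mod n)"
  shows "jac w n = (if n mod 8 = 1 then 1 else -1) \<and> (n mod 8 = 1 \<or> n mod 8 = 5)"
  using assms
proof (induction n rule: prime_divisors_induct)
  case zero
  then show ?case by (simp add: primes14_def)
next
  case (unit n)
  then have "n = 1"
    by (auto simp: primes14_def)
  then show ?case
    by (simp add: jac_unit)
next
  case (factor p n)
  note 1 = primes14_mult[OF factor.prems(1) factor.hyps]
  have w: "[w\<^sup>2 = -1] (mod p)" "[w\<^sup>2 = -1] (mod n)"
    using factor.prems(2) by (auto intro: cong_dvd_modulus)
  have IH: "jac w n = (if n mod 8 = 1 then 1 else -1)" "n mod 8 = 1 \<or> n mod 8 = 5"
    using factor.IH 1 w by auto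
  have p8: "p mod 8 = 1 \<or> p mod 8 = 5"
    using 1(2) by presburger
  have "p > 2"
    using 1(3) factor.hyps prime_ge_2_int[of p] by (cases "p = 2") auto
  define e where "e = nat ((p - 1) div 4)"
  have "(p - 1) div 2 = 2 * ((p - 1) div 4)"
    using 1(2) by presburger
  moreover have "(p - 1) div 4 \<ge> 0"
    using \<open>p > 2\<close> by simp
  ultimately have e: "nat ((p - 1) div 2) = 2 * e" "int e = (p - 1) div 4"
    unfolding e_def by (simp_all add: nat_mult_distrib)
  have "[Legendre w p = w ^ nat ((p - 1) div 2)] (mod p)"
    by (rule euler_criterion_int[OF factor.hyps 1(3)])
  also have "w ^ nat ((p - 1) div 2) = (w\<^sup>2) ^ e"
    by (simp add: e(1) power_mult)
  also have "[(w\<^sup>2) ^ e = (-1) ^ e] (mod p)"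
    using w(1) by (rule cong_pow)
  finally have "Legendre w p = (-1) ^ e"
    using \<open>p > 2\<close> Legendre_values[of w p]
    by (intro small_cong_eq[where p = p]) (auto simp: minus_one_power_iff)
  moreover have "even e \<longleftrightarrow> p mod 8 = 1"
    using e(2) p8 by presburger
  ultimately have L: "Legendre w p = (if p mod 8 = 1 then 1 else -1)"
    by (simp add: minus_one_power_iff)
  have m8: "(p * n) mod 8 = ((p mod 8) * (n mod 8)) mod 8"
    by (simp add: mod_mult_eq)
  have "p \<noteq> 0"
    using factor.hyps by auto
  then have J: "jac w (p * n) = Legendre w p * jac w n"
    using 1(4) factor.hyps by (simp add: jac_mult_right jac_prime)
  show ?case
    using p8 IH(2) unfolding J L IH(1) m8 by (elim disjE) simp_all
qed

lemma primes14_sum_squares: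
  assumes "coprime c d" "odd c" "even (d :: int)"
  shows "primes14 (c\<^sup>2 + d\<^sup>2)"
  unfolding primes14_def
proof (intro conjI allI impI)
  show "c\<^sup>2 + d\<^sup>2 > 0"
    using assms(2) by (intro add_pos_nonneg) (auto simp: zero_less_power2)
  fix p :: int
  assume p: "prime p" "p dvd c\<^sup>2 + d\<^sup>2"
  have odd: "odd p"
    using p(2) assms(2,3) by (metis dvd_trans even_add even_power zero_neq_numeral pos2)
  have "\<not> p dvd d"
  proof
    assume d: "p dvd d"
    then have "p dvd (c\<^sup>2 + d\<^sup>2) - d\<^sup>2"
      using p by (intro dvd_diff) (auto simp: power2_eq_square)
    then have "p dvd c"
      using p(1) by (simp add: prime_dvd_power)
    then show False
      using d assms(1) p(1) by (meson coprime_common_divisor not_prime_unit)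
  qed
  then have d2: "Legendre (d\<^sup>2) p = 1"
    using jac_square[OF odd, of d] p(1) prime_imp_coprime[of p d]
    by (simp add: jac_prime coprime_commute)
  have "\<not> p dvd c"
  proof
    assume "p dvd c"
    then have "p dvd (c\<^sup>2 + d\<^sup>2) - c\<^sup>2"
      using p by (intro dvd_diff) (auto simp: power2_eq_square)
    then have "p dvd d"
      using p(1) by (simp add: prime_dvd_power)
    then show False
      using \<open>\<not> p dvd d\<close> by simp
  qed
  then have "Legendre (c\<^sup>2) p = 1"
    using jac_square[OF odd, of c] p(1) prime_imp_coprime[of p c]
    by (simp add: jac_prime coprime_commute)
  moreover have "[c\<^sup>2 = -1 * d\<^sup>2] (mod p)"
    using p(2) by (simp add: cong_iff_dvd_diff)
  ultimately have L: "Legendre (-1) p = 1"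
    using Legendre_cong Legendre_mult[OF p(1) odd, of "-1" "d\<^sup>2"] d2 by auto
  have p2: "p > 2"
    using odd p(1) prime_ge_2_int[of p] by (cases "p = 2") auto
  have "[1 = (-1) ^ nat ((p - 1) div 2)] (mod p)"
    using euler_criterion_int[OF p(1) odd, of "-1"] unfolding L .
  then have "even (nat ((p - 1) div 2))"
    using small_cong_eq[of 1 "-1" p] p2 by (auto simp: minus_one_power_iff split: if_splits)
  then show "p mod 4 = 1"
    using p2 odd by (simp add: even_nat_iff) presburger
qed

subsection \<open>The quadratic symbol in the Gaussian integers\<close>

definition gprim :: "gint \<Rightarrow> bool" where "gprim z \<longleftrightarrow> odd (gRe z) \<and> even (gIm z)"

text \<open>Write \<open>\<beta> = n \<beta>\<^sub>0\<close> with \<open>\<beta>\<^sub>0 = c + di\<close> primitive. The residue ring of \<open>\<beta>\<^sub>0\<close> is the ring of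
  integers modulo its norm, with \<open>i\<close> going to \<open>d/c\<close>. Since \<open>c\<close> is a residue modulo \<open>c\<^sup>2 + d\<^sup>2\<close>, the
  symbol of \<open>a + bi\<close> modulo \<open>\<beta>\<^sub>0\<close> is the Jacobi symbol of \<open>ac + bd = Re (\<alpha> \<beta>\<^sub>0\<^sup>*)\<close>. Modulo \<open>n\<close> it is
  the Jacobi symbol of the norm.\<close>

definition gjac :: "gint \<Rightarrow> gint \<Rightarrow> int" where
  "gjac \<alpha> \<beta> = (let n = gcd (gRe \<beta>) (gIm \<beta>); c = gRe \<beta> div n; d = gIm \<beta> div n
     in jac (gnorm \<alpha>) n * jac (gRe \<alpha> * c + gIm \<alpha> * d) (c\<^sup>2 + d\<^sup>2))"

lemma primes14_neq_0: "primes14 n \<Longrightarrow> n \<noteq> 0"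
  by (auto simp: primes14_def)

lemma gprim_decomp:
  assumes "gprim \<beta>"
  obtains n c d where "gRe \<beta> = n * c" "gIm \<beta> = n * d" "odd n" "odd c" "even d" "coprime c d" "n > 0"
    "\<And>\<alpha>. gjac \<alpha> \<beta> = jac (gnorm \<alpha>) n * jac (gRe \<alpha> * c + gIm \<alpha> * d) (c\<^sup>2 + d\<^sup>2)"
proof -
  define n where "n = gcd (gRe \<beta>) (gIm \<beta>)"
  define c d where "c = gRe \<beta> div n" and "d = gIm \<beta> div n"
  have "gRe \<beta> \<noteq> 0"
    using assms by (auto simp: gprim_def)
  then have "n > 0"
    by (simp add: n_def)
  have e: "gRe \<beta> = n * c" "gIm \<beta> = n * d"
    by (simp_all add: c_def d_def n_def)
  have "coprime c d"
    unfolding c_def d_def n_def by (rule div_gcd_coprime) (use \<open>gRe \<beta> \<noteq> 0\<close> in simp)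
  moreover have "odd n" "odd c" "even d"
    using assms e by (auto simp: gprim_def)
  moreover have "gjac \<alpha> \<beta> = jac (gnorm \<alpha>) n * jac (gRe \<alpha> * c + gIm \<alpha> * d) (c\<^sup>2 + d\<^sup>2)" for \<alpha>
    by (simp add: gjac_def Let_def c_def d_def n_def)
  ultimately show ?thesis
    using that e \<open>n > 0\<close> by blast
qed

text \<open>Flip the symbol: modulo c the sum is the square of d.\<close>

lemma jac_sum_squares_self:
  assumes "coprime c d" "odd c" "even (d :: int)"
  shows "jac c (c\<^sup>2 + d\<^sup>2) = 1"
proof -
  have "jac c (c\<^sup>2 + d\<^sup>2) = jac (c\<^sup>2 + d\<^sup>2) c"
    using jac_reciprocity[OF primes14_sum_squares[OF assms] assms(2)] .
  also have "\<dots> = jac (d\<^sup>2) c"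
    using assms(2) by (intro jac_cong) (auto simp: cong_iff_dvd_diff power2_eq_square)
  also have "\<dots> = 1"
    using assms by (intro jac_square) (simp_all add: coprime_commute)
  finally show ?thesis .
qed

lemma gjac_mult:
  assumes "gprim \<beta>"
  shows "gjac (\<alpha> * \<alpha>') \<beta> = gjac \<alpha> \<beta> * gjac \<alpha>' \<beta>"
proof -
  from assms obtain n c d where D: "odd n" "odd c" "even d" "coprime c d"
    "\<And>\<alpha>. gjac \<alpha> \<beta> = jac (gnorm \<alpha>) n * jac (gRe \<alpha> * c + gIm \<alpha> * d) (c\<^sup>2 + d\<^sup>2)"
    by (rule gprim_decomp) blast
  define h where "h \<alpha> = gRe \<alpha> * c + gIm \<alpha> * d" for \<alpha>
  let ?N = "c\<^sup>2 + d\<^sup>2"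
  have N: "primes14 ?N"
    using primes14_sum_squares D by blast
  then have "odd ?N" "?N \<noteq> 0"
    by (fact primes14_odd, rule primes14_neq_0)
  \<comment> \<open>The linear form is multiplicative only up to the factor c, whose symbol is
    1.\<close>
  have "h \<alpha> * h \<alpha>' - c * h (\<alpha> * \<alpha>') = gIm \<alpha> * gIm \<alpha>' * ?N"
    by (simp add: h_def power2_eq_square algebra_simps)
  then have "[c * h (\<alpha> * \<alpha>') = h \<alpha> * h \<alpha>'] (mod ?N)"
    by (metis cong_iff_dvd_diff cong_sym dvd_triv_right)
  then have "jac (c * h (\<alpha> * \<alpha>')) ?N = jac (h \<alpha> * h \<alpha>') ?N"
    using jac_cong \<open>?N \<noteq> 0\<close> by blast
  then have "jac (h (\<alpha> * \<alpha>')) ?N = jac (h \<alpha>) ?N * jac (h \<alpha>') ?N"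
    using jac_sum_squares_self[OF D(4,2,3)] by (simp add: jac_mult_left[OF \<open>odd ?N\<close>])
  then show ?thesis
    using D(1) unfolding D(5) h_def by (simp add: gnorm_mult jac_mult_left)
qed

lemma gjac_cong:
  assumes "gprim \<beta>" "\<beta> dvd \<alpha> - \<alpha>'"
  shows "gjac \<alpha> \<beta> = gjac \<alpha>' \<beta>"
proof -
  from assms(1) obtain n c d where D: "gRe \<beta> = n * c" "gIm \<beta> = n * d" "odd n" "odd c" "even d"
    "coprime c d"
    "\<And>\<alpha>. gjac \<alpha> \<beta> = jac (gnorm \<alpha>) n * jac (gRe \<alpha> * c + gIm \<alpha> * d) (c\<^sup>2 + d\<^sup>2)"
    by (rule gprim_decomp) blast
  let ?N = "c\<^sup>2 + d\<^sup>2"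
  have "?N \<noteq> 0"
    by (rule primes14_neq_0[OF primes14_sum_squares[OF D(6,4,5)]])
  obtain \<gamma> where "\<alpha> - \<alpha>' = \<beta> * \<gamma>"
    using assms(2) ..
  then have \<alpha>: "\<alpha> = \<alpha>' + \<beta> * \<gamma>"
    by (simp add: algebra_simps)
  define x y where "x = c * gRe \<gamma> - d * gIm \<gamma>" and "y = c * gIm \<gamma> + d * gRe \<gamma>"
  have r: "gRe \<alpha> = gRe \<alpha>' + n * x" "gIm \<alpha> = gIm \<alpha>' + n * y"
    by (simp_all add: \<alpha> D(1,2) x_def y_def algebra_simps)
  have "gnorm \<alpha> - gnorm \<alpha>' = n * (x * (2 * gRe \<alpha>' + n * x) + y * (2 * gIm \<alpha>' + n * y))"
    unfolding gnorm_def r by (simp add: power2_eq_square algebra_simps)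
  then have "[gnorm \<alpha> = gnorm \<alpha>'] (mod n)"
    by (metis cong_iff_dvd_diff dvd_triv_left)
  moreover have "(gRe \<alpha> * c + gIm \<alpha> * d) - (gRe \<alpha>' * c + gIm \<alpha>' * d) = ?N * (n * gRe \<gamma>)"
    unfolding r x_def y_def by (simp add: power2_eq_square algebra_simps)
  then have "[gRe \<alpha> * c + gIm \<alpha> * d = gRe \<alpha>' * c + gIm \<alpha>' * d] (mod ?N)"
    by (metis cong_iff_dvd_diff dvd_triv_left)
  moreover have "n \<noteq> 0"
    using D(3) by auto
  ultimately show ?thesis
    unfolding D(7) using jac_cong \<open>?N \<noteq> 0\<close> by metis
qed

lemma gjac_1:
  assumes "gprim \<beta>"
  shows "gjac 1 \<beta> = 1"
proof -
  from assms obtain n c d where D: "odd n" "odd c" "even d" "coprime c d"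
    "\<And>\<alpha>. gjac \<alpha> \<beta> = jac (gnorm \<alpha>) n * jac (gRe \<alpha> * c + gIm \<alpha> * d) (c\<^sup>2 + d\<^sup>2)"
    by (rule gprim_decomp) blast
  then show ?thesis
    by (simp add: jac_one jac_sum_squares_self)
qed

lemma gjac_values:
  assumes "gprim \<beta>"
  shows "gjac \<alpha> \<beta> \<in> {-1, 0, 1}"
proof -
  from assms obtain n c d where D: "odd n" "odd c" "even d" "coprime c d"
    "\<And>\<alpha>. gjac \<alpha> \<beta> = jac (gnorm \<alpha>) n * jac (gRe \<alpha> * c + gIm \<alpha> * d) (c\<^sup>2 + d\<^sup>2)"
    by (rule gprim_decomp) blast
  have "n \<noteq> 0" "c\<^sup>2 + d\<^sup>2 \<noteq> 0"
    using primes14_neq_0[OF primes14_sum_squares[OF D(4,2,3)]] D(1) by auto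
  then show ?thesis
    using jac_values[of n "gnorm \<alpha>"] jac_values[of "c\<^sup>2 + d\<^sup>2" "gRe \<alpha> * c + gIm \<alpha> * d"]
    unfolding D(5) by auto
qed

lemma gjac_coprime:
  assumes "gprim \<beta>" "coprime \<alpha> \<beta>"
  shows "gjac \<alpha> \<beta> = 1 \<or> gjac \<alpha> \<beta> = -1"
proof -
  obtain \<gamma> \<delta> where "\<gamma> * \<alpha> + \<delta> * \<beta> = 1"
    using assms(2) bezout_coefficients_fst_snd[of \<alpha> \<beta>] by (metis coprime_iff_gcd_eq_1)
  then have "\<gamma> * \<alpha> - 1 = \<beta> * (- \<delta>)"
    by (simp add: algebra_simps eq_diff_eq)
  then have "gjac (\<gamma> * \<alpha>) \<beta> = gjac 1 \<beta>"
    by (intro gjac_cong[OF assms(1)]) simp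
  then have "gjac \<gamma> \<beta> * gjac \<alpha> \<beta> = 1"
    using gjac_1 gjac_mult assms(1) by simp
  then show ?thesis
    using gjac_values[OF assms(1), of \<alpha>] by auto
qed

lemma gjac_square: "gprim \<beta> \<Longrightarrow> coprime \<alpha> \<beta> \<Longrightarrow> gjac (\<alpha>\<^sup>2) \<beta> = 1"
  using gjac_coprime[of \<beta> \<alpha>] by (auto simp: power2_eq_square gjac_mult)

text \<open>Both symbols contain the Jacobi symbol of the same R, the real part of one primitive
  part times the conjugate of the other, modulo M and modulo N. As MN = R^2 + I^2 is a square modulo
  R, these agree; the remaining factors match by Jacobi reciprocity.\<close>

lemma gjac_reciprocity:
  assumes "gprim \<alpha>" "gprim \<beta>" "coprime \<alpha> \<beta>"
  shows "gjac \<alpha> \<beta> = gjac \<beta> \<alpha>"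
proof -
  from assms(1) obtain m a b where A: "gRe \<alpha> = m * a" "gIm \<alpha> = m * b" "odd m" "odd a" "even b"
    "coprime a b"
    "\<And>\<gamma>. gjac \<gamma> \<alpha> = jac (gnorm \<gamma>) m * jac (gRe \<gamma> * a + gIm \<gamma> * b) (a\<^sup>2 + b\<^sup>2)"
    by (rule gprim_decomp) blast
  from assms(2) obtain n c d where B: "gRe \<beta> = n * c" "gIm \<beta> = n * d" "odd n" "odd c" "even d"
    "coprime c d"
    "\<And>\<gamma>. gjac \<gamma> \<beta> = jac (gnorm \<gamma>) n * jac (gRe \<gamma> * c + gIm \<gamma> * d) (c\<^sup>2 + d\<^sup>2)"
    by (rule gprim_decomp) blast
  let ?M = "a\<^sup>2 + b\<^sup>2" and ?N = "c\<^sup>2 + d\<^sup>2"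
  define R I where "R = a * c + b * d" and "I = b * c - a * d"
  have M: "primes14 ?M" "odd ?M" "?M \<noteq> 0" and N: "primes14 ?N" "odd ?N" "?N \<noteq> 0"
    using primes14_sum_squares A(4-6) B(4-6) primes14_odd primes14_neq_0 by blast+
  have n: "n \<noteq> 0" "m \<noteq> 0"
    using A(3) B(3) by auto
  have "odd R"
    using A B by (simp add: R_def)
  then have "R \<noteq> 0"
    by auto
  have 1: "gjac \<alpha> \<beta> = jac (m\<^sup>2) n * jac ?M n * (jac m ?N * jac R ?N)"
  proof -
    have "gnorm \<alpha> = m\<^sup>2 * ?M" "gRe \<alpha> * c + gIm \<alpha> * d = m * R"
      by (simp_all add: A(1,2) gnorm_def R_def power2_eq_square algebra_simps)
    then show ?thesis
      unfolding B(7) by (simp add: jac_mult_left[OF B(3)] jac_mult_left[OF N(2)])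
  qed
  have 2: "gjac \<beta> \<alpha> = jac (n\<^sup>2) m * jac ?N m * (jac n ?M * jac R ?M)"
  proof -
    have "gnorm \<beta> = n\<^sup>2 * ?N" "gRe \<beta> * a + gIm \<beta> * b = n * R"
      by (simp_all add: B(1,2) gnorm_def R_def power2_eq_square algebra_simps)
    then show ?thesis
      unfolding A(7) by (simp add: jac_mult_left[OF A(3)] jac_mult_left[OF M(2)])
  qed
  have "gjac \<alpha> \<beta> \<noteq> 0" "gjac \<beta> \<alpha> \<noteq> 0"
    using gjac_coprime[OF assms(2,3)] gjac_coprime[OF assms(1), of \<beta>] assms(3)
    by (auto simp: coprime_commute)
  then have nz: "jac (m\<^sup>2) n \<noteq> 0" "jac (n\<^sup>2) m \<noteq> 0" "jac R ?N \<noteq> 0" "jac R ?M \<noteq> 0"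
    unfolding 1 2 by auto
  then have "coprime m n" "coprime R ?N" "coprime R ?M"
    using jac_eq_0_iff n M(3) N(3) by auto
  have sq: "jac (m\<^sup>2) n = 1" "jac (n\<^sup>2) m = 1"
    using jac_square A(3) B(3) \<open>coprime m n\<close> by (simp_all add: coprime_commute)
  have "?M * ?N = R\<^sup>2 + I\<^sup>2"
    by (simp add: R_def I_def power2_eq_square algebra_simps)
  then have MN: "?M * ?N = I\<^sup>2 + R * R"
    by (simp add: power2_eq_square)
  have "coprime I R"
  proof (rule coprimeI)
    fix e
    assume "e dvd I" "e dvd R"
    then have "e dvd I\<^sup>2 + R * R"
      by (intro dvd_add) (simp_all add: power2_eq_square)
    then have "e dvd ?M * ?N"
      unfolding MN .
    moreover have "coprime e (?M * ?N)"
      using \<open>e dvd R\<close> \<open>coprime R ?N\<close> \<open>coprime R ?M\<close>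
      by (meson coprime_divisors coprime_mult_right_iff dvd_refl)
    ultimately show "is_unit e"
      using coprime_absorb_left by blast
  qed
  have "jac R ?M * jac R ?N = jac ?M R * jac ?N R"
    using jac_reciprocity[OF M(1) \<open>odd R\<close>] jac_reciprocity[OF N(1) \<open>odd R\<close>] by simp
  also have "\<dots> = jac (?M * ?N) R"
    by (simp add: jac_mult_left[OF \<open>odd R\<close>])
  also have "\<dots> = jac (I\<^sup>2) R"
    unfolding MN using \<open>R \<noteq> 0\<close> by (intro jac_cong) (simp_all add: cong_iff_dvd_diff)
  also have "\<dots> = 1"
    using jac_square[OF \<open>odd R\<close> \<open>coprime I R\<close>] .
  finally have "jac R ?M = jac R ?N"
    using jac_values[OF M(3), of R] by auto
  moreover have "jac m ?N = jac ?N m" "jac n ?M = jac ?M n"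
    using jac_reciprocity A(3) B(3) M(1) N(1) by blast+
  ultimately show ?thesis
    unfolding 1 2 sq by simp
qed

text \<open>The symbol is that of d modulo c^2 + d^2. Since c has symbol 1, it equals that of d/c, a
  square root of -1, and the sum modulo 8 decides.\<close>

lemma gjac_gi:
  assumes "gprim \<beta>"
  shows "gjac gi \<beta> = (if 4 dvd gIm \<beta> then 1 else -1)"
proof -
  from assms obtain n c d where D: "gRe \<beta> = n * c" "gIm \<beta> = n * d" "odd n" "odd c" "even d"
    "coprime c d"
    "\<And>\<alpha>. gjac \<alpha> \<beta> = jac (gnorm \<alpha>) n * jac (gRe \<alpha> * c + gIm \<alpha> * d) (c\<^sup>2 + d\<^sup>2)"
    by (rule gprim_decomp) blast
  let ?N = "c\<^sup>2 + d\<^sup>2"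
  have N: "primes14 ?N" "odd ?N" "?N \<noteq> 0"
    using primes14_sum_squares D(4-6) primes14_odd primes14_neq_0 by blast+
  have g: "gjac gi \<beta> = jac d ?N"
    unfolding D(7) by (simp add: jac_one[OF D(3)])
  have "coprime c ?N"
    using jac_sum_squares_self[OF D(6,4,5)] jac_eq_0_iff[OF N(3), of c] by auto
  then obtain c' where c': "[c * c' = 1] (mod ?N)"
    using cong_solve_coprime_int by blast
  define w where "w = d * c'"
  have "[w\<^sup>2 = -1] (mod ?N)"
  proof -
    have "?N dvd c * c' - 1"
      using c' by (simp add: cong_iff_dvd_diff)
    then have "?N dvd ?N * c'\<^sup>2 - (c * c' - 1) * (c * c' + 1)"
      using dvd_diff[OF dvd_triv_left dvd_mult2] by blast
    also have "\<dots> = w\<^sup>2 - (-1)"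
      unfolding w_def by (simp add: power2_eq_square algebra_simps)
    finally show ?thesis
      by (simp only: cong_iff_dvd_diff)
  qed
  from jac_sqrt_minus_one[OF N(1) this]
  have w: "jac w ?N = (if ?N mod 8 = 1 then 1 else -1)" by blast
  have "[w * c = d * 1] (mod ?N)"
    unfolding w_def using cong_scalar_left[OF c', of d] by (simp add: mult_ac)
  then have "jac (w * c) ?N = jac d ?N"
    using jac_cong N(3) by simp
  then have "jac d ?N = jac w ?N"
    using jac_sum_squares_self[OF D(6,4,5)] by (simp add: jac_mult_left[OF N(2)])
  moreover have "?N mod 8 = 1 \<longleftrightarrow> 4 dvd d"
  proof -
    obtain j where j: "c = 2 * j + 1"
      using D(4) by (elim oddE)
    have "even (j * (j + 1))"
      by simp
    then obtain i where i: "j * (j + 1) = 2 * i" by (elim evenE)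
    have c2: "c\<^sup>2 = 1 + 8 * i"
      using i by (simp add: j power2_eq_square algebra_simps)
    obtain k where k: "d = 2 * k"
      using D(5) by (elim evenE)
    have d2: "d\<^sup>2 = 4 * k\<^sup>2"
      by (simp add: k power_mult_distrib)
    have "even (k\<^sup>2) \<longleftrightarrow> 4 dvd d"
      unfolding k by (auto elim!: evenE)
    moreover have "(1 + 8 * i + 4 * K) mod 8 = 1 \<longleftrightarrow> even K" for K :: int
      by presburger
    ultimately show ?thesis
      unfolding c2 d2 by simp
  qed
  moreover have "4 dvd gIm \<beta> \<longleftrightarrow> 4 dvd d"
  proof -
    have "coprime 2 n"
      using D(3) by simp
    then have "coprime (2 ^ 2) n"
      by (simp only: coprime_power_left_iff) simp
    then have "coprime 4 n"
      by simp
    then show ?thesis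
      unfolding D(2) by (simp add: coprime_dvd_mult_right_iff)
  qed
  ultimately show ?thesis
    unfolding g w by simp
qed

text \<open>The content n enters the norm squared and the symbol through k^2, so it contributes 1 on
  both sides.\<close>

lemma gjac_of_int:
  assumes "gprim \<beta>" "coprime k (gnorm \<beta>)"
  shows "gjac (of_int k) \<beta> = jac k (gnorm \<beta>)"
proof -
  from assms(1) obtain n c d where D: "gRe \<beta> = n * c" "gIm \<beta> = n * d" "odd n" "odd c" "even d"
    "coprime c d"
    "\<And>\<alpha>. gjac \<alpha> \<beta> = jac (gnorm \<alpha>) n * jac (gRe \<alpha> * c + gIm \<alpha> * d) (c\<^sup>2 + d\<^sup>2)"
    by (rule gprim_decomp) blast
  let ?N = "c\<^sup>2 + d\<^sup>2"
  have N: "primes14 ?N" "odd ?N" "?N \<noteq> 0"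
    using primes14_sum_squares D(4-6) primes14_odd primes14_neq_0 by blast+
  have n: "n \<noteq> 0"
    using D(3) by auto
  have g: "gnorm \<beta> = n * n * ?N"
    by (simp add: gnorm_def D(1,2) power2_eq_square algebra_simps)
  have "coprime k n"
    using assms(2) unfolding g by simp
  then have "jac (k\<^sup>2) n = 1"
    by (intro jac_square D(3))
  moreover have "jac k n * jac k n = 1"
    using jac_values[OF n, of k] jac_eq_0_iff[OF n, of k] \<open>coprime k n\<close> by auto
  ultimately show ?thesis
    unfolding D(7) g using n N(3)
    by (simp add: jac_mult_right jac_mult_left[OF N(2)] jac_sum_squares_self[OF D(6,4,5)])
qed

section \<open>Symbols of repunits\<close>

lemma gsum_add: "gsum t 1 (m + n) = gsum t 1 m + t ^ m * gsum t 1 n"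
proof -
  have "gsum t 1 (n + m) = gsum t 1 m + t ^ m * gsum t 1 n"
    by (induction m) (simp_all add: algebra_simps)
  then show ?thesis
    by (simp add: add.commute)
qed

lemma coprime_base_gsum: "coprime t (gsum t 1 (Suc n))"
  using coprime_addI[of 1 t "t * gsum t 1 n"] by (simp add: coprime_commute add.commute)

text \<open>Subtracting indices imitates the Euclidean algorithm, as the base is a unit modulo each
  repunit.\<close>

lemma coprime_gsum:
  assumes "coprime m n" "m > 0" "n > 0"
  shows "coprime (gsum t 1 m) (gsum t 1 n)"
  using assms
proof (induction "m + n" arbitrary: m n rule: less_induct)
  case less
  have step: "coprime (gsum t 1 m) (gsum t 1 n)"
    if "m < n" "coprime m n" "m > 0" and IH: "coprime (gsum t 1 m) (gsum t 1 (n - m))" for m n :: nat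
  proof -
    have "gsum t 1 n = gsum t 1 m + t ^ m * gsum t 1 (n - m)"
      using that(1) gsum_add[of t m "n - m"] by simp
    moreover have "coprime (t ^ m * gsum t 1 (n - m) + gsum t 1 m) (gsum t 1 m)"
    proof (rule coprime_addI)
      have "coprime t (gsum t 1 m)"
        using coprime_base_gsum[of t "m - 1"] that(3) by simp
      then show "coprime (t ^ m * gsum t 1 (n - m)) (gsum t 1 m)"
        using IH by (simp add: coprime_commute)
    qed simp
    ultimately show ?thesis
      by (simp add: coprime_commute add.commute)
  qed
  consider "m < n" | "n < m" | "m = 1" "n = 1"
    using less.prems by (cases m n rule: linorder_cases) auto
  then show ?case
  proof cases
    case 1
    have c: "coprime (n - m) m"
      using less.prems 1 by (metis coprime_iff_gcd_eq_1 gcd_diff1_nat less_imp_le_nat gcd.commute)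
    then have "coprime m (n - m)"
      by (simp add: coprime_commute)
    then have "coprime (gsum t 1 m) (gsum t 1 (n - m))"
      using less.hyps[of m "n - m"] 1 less.prems by simp
    then show ?thesis
      using step[OF 1] less.prems by blast
  next
    case 2
    have "coprime (m - n) n" and c: "coprime n m"
      using less.prems 2 by (metis coprime_iff_gcd_eq_1 gcd_diff1_nat less_imp_le_nat gcd.commute)+
    then have "coprime n (m - n)"
      by (simp add: coprime_commute)
    then have "coprime (gsum t 1 n) (gsum t 1 (m - n))"
      using less.hyps[of n "m - n"] 2 less.prems by simp
    then have "coprime (gsum t 1 n) (gsum t 1 m)"
      using step[OF 2 c] less.prems by blast
    then show ?thesis
      by (simp add: coprime_commute)
  qed simp
qed

text \<open>Elementary, without Dirichlet: k = r + qm, where m is the product of the primes of N not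
  dividing r. Those primes divide qm but not r; the other primes of N divide r but neither q nor
  m.\<close>

lemma ex_coprime_progression:
  fixes r q N :: nat
  assumes "coprime r q" "N > 0" "r > 0"
  obtains k where "[k = r] (mod q)" "k \<ge> q" "coprime k N" "coprime k q" "k > 0"
proof -
  define m where "m = \<Prod>{p \<in> prime_factors N. \<not> p dvd r}"
  define k where "k = r + q * m"
  have "m > 0"
    unfolding m_def by (intro prod_pos) (auto intro: prime_gt_0_nat simp: in_prime_factors_iff)
  have "coprime k N"
  proof (rule ccontr)
    assume "\<not> coprime k N"
    then have "gcd k N \<noteq> 1"
      using coprime_iff_gcd_eq_1 by blast
    then obtain p where p: "prime p" "p dvd k" "p dvd N"
      using prime_factor_nat[of "gcd k N"] by auto
    have pN: "p \<in> prime_factors N"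
      using p assms(2) by (simp add: in_prime_factors_iff)
    show False
    proof (cases "p dvd r")
      case False
      then have "p dvd m"
        unfolding m_def using pN by (intro dvd_prodI) auto
      then have "p dvd r"
        using p(2) unfolding k_def by (simp add: dvd_add_left_iff)
      then show False
        using False by simp
    next
      case True
      then have "p dvd q * m"
        using p(2) unfolding k_def by (simp add: dvd_add_right_iff)
      moreover have "\<not> p dvd q"
        using True assms(1) p(1) by (meson coprime_common_divisor_nat not_prime_unit coprime_common_divisor)
      ultimately have "p dvd m"
        using p(1) prime_dvd_mult_iff by blast
      then obtain p' where "p' \<in> {p \<in> prime_factors N. \<not> p dvd r}" "p dvd p'"
        unfolding m_def using p(1) by (subst (asm) prime_dvd_prod_iff) auto
      then show False
        using True p(1) primes_dvd_imp_eq by (metis (mono_tags) in_prime_factors_iff mem_Collect_eq)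
    qed
  qed
  moreover have "[k = r] (mod q)"
    by (simp add: k_def cong_def)
  moreover have "coprime k q"
    using assms(1) calculation(2) cong_imp_coprime cong_sym by blast
  moreover have "q * 1 \<le> q * m"
    using \<open>m > 0\<close> by (intro mult_le_mono) auto
  then have "k \<ge> q" "k > 0"
    using assms(3) unfolding k_def by linarith+
  ultimately show ?thesis
    using that by blast
qed

lemma gsum_mod_cong: "gsum t 1 n dvd gsum t 1 (r + n * j) - gsum t 1 r"
proof (induction j)
  case (Suc j)
  have "r + n * Suc j = n + (r + n * j)"
    by simp
  then have "gsum t 1 (r + n * Suc j) - gsum t 1 r =
      gsum t 1 n + (t ^ n * (gsum t 1 (r + n * j) - gsum t 1 r) + (t ^ n - 1) * gsum t 1 r)"
    by (simp only: gsum_add) (simp add: algebra_simps)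
  moreover have "gsum t 1 n dvd t ^ n - 1"
    using diff_mult_gsum[of t 1 n] by (metis dvd_triv_right power_one)
  ultimately show ?case
    using Suc by (metis dvd_add dvd_mult dvd_mult2 dvd_refl)
qed simp

lemma gsum_mod_cong': "gsum t 1 n dvd gsum t 1 m - gsum t 1 (m mod n)"
  using gsum_mod_cong[of t n "m mod n" "m div n"] by (simp add: mult.commute)

lemma gnorm_dvd_gint: "z dvd of_int (gnorm z)"
  by (metis dvd_triv_left mult_gcnj)

lemma coprime_nat_gint:
  fixes k l :: int
  assumes "coprime k l"
  shows "coprime (of_int k :: gint) (of_int l)"
proof -
  obtain a b where "a * k + b * l = 1"
    using assms bezout_int[of k l] by auto
  then have *: "of_int a * of_int k + of_int b * of_int l = (1 :: gint)"
    by (metis of_int_1 of_int_add of_int_mult)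
  show ?thesis
  proof (rule coprimeI)
    fix c :: gint
    assume "c dvd of_int k" "c dvd of_int l"
    then have "c dvd of_int a * of_int k + of_int b * of_int l"
      by (intro dvd_add dvd_mult)
    then show "is_unit c"
      unfolding * .
  qed
qed

lemma coprime_one_minus_gsum:
  assumes "coprime (of_nat k) (1 - t)" "k > 0"
  shows "coprime (1 - t) (gsum t 1 k)"
proof -
  obtain n where n: "k = Suc n"
    using \<open>k > 0\<close> by (cases k) auto
  obtain W where W: "gsum t 1 (Suc n) = of_nat (Suc n) * 1 ^ n + (t - 1) * W"
    using gsum_cong_linear[of t 1 n] by blast
  have "coprime (of_nat k + (t - 1) * W) (1 - t)"
  proof (rule coprime_addI[OF assms(1)])
    have "(t - 1) * W = (1 - t) * (- W)"
      by (simp add: algebra_simps)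
    then show "1 - t dvd (t - 1) * W"
      by (metis dvd_triv_left)
  qed
  moreover have "gsum t 1 k = of_nat k + (t - 1) * W"
    unfolding n W by simp
  ultimately show ?thesis
    by (metis coprime_commute)
qed

lemma coprime_root_gsum:
  assumes eq: "x\<^sup>2 = (1 - t) * gsum t 1 q" and "coprime k q" "k > 0" "q > 0"
    and kN: "coprime (int k) (gnorm (1 - t))"
  shows "coprime (1 - t) (gsum t 1 k)" "coprime x (gsum t 1 k)" "coprime (of_nat k) (1 - t)"
proof -
  have "coprime (of_int (int k)) (of_int (gnorm (1 - t)) :: gint)"
    by (rule coprime_nat_gint[OF kN])
  then show k: "coprime (of_nat k) (1 - t)"
    using gnorm_dvd_gint[of "1 - t"] by (metis coprime_divisors dvd_refl of_int_of_nat_eq)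
  show 1: "coprime (1 - t) (gsum t 1 k)"
    by (rule coprime_one_minus_gsum[OF k \<open>k > 0\<close>])
  have "coprime (gsum t 1 q) (gsum t 1 k)"
    using coprime_gsum[of q k] assms(2-4) by (simp add: coprime_commute)
  then have "coprime (x\<^sup>2) (gsum t 1 k)"
    unfolding eq using 1 by simp
  then show "coprime x (gsum t 1 k)"
    by (simp only: coprime_power_left_iff) simp
qed

subsection \<open>Base divisible by 2\<close>

lemma gprim_gsum:
  assumes "2 dvd t"
  shows "gprim (gsum t 1 (Suc n))"
proof -
  obtain s where "t = 2 * s"
    using assms ..
  then have "gsum t 1 (Suc n) = 1 + 2 * (s * gsum t 1 n)"
    by (simp add: algebra_simps)
  then show ?thesis
    unfolding gprim_def by (simp only: gRe_gIm_simps gRe_gIm_numeral) simp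
qed

text \<open>The Euclidean algorithm on indices, each swap by reciprocity. No signs arise because
  repunits in a base divisible by 2 are 1 modulo 2.\<close>

lemma gjac_gsum:
  assumes "2 dvd t" "coprime m k" "m > 0" "k > 0"
  shows "gjac (gsum t 1 m) (gsum t 1 k) = 1"
  using assms(2-4)
proof (induction "m + k" arbitrary: m k rule: less_induct)
  case less
  have prim: "gprim (gsum t 1 n)" if "n > 0" for n
    using gprim_gsum[OF assms(1), of "n - 1"] that by simp
  have step: "gjac (gsum t 1 m) (gsum t 1 k) = 1"
    if "k < m" "coprime m k" "k > 0" "gjac (gsum t 1 (m - k)) (gsum t 1 k) = 1" for m k
  proof -
    have "gsum t 1 m = gsum t 1 (m - k) + t ^ (m - k) * gsum t 1 k"
      using that(1) gsum_add[of t "m - k" k] by simp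
    then have "gjac (gsum t 1 m) (gsum t 1 k) = gjac (gsum t 1 (m - k)) (gsum t 1 k)"
      using prim[OF that(3)] by (intro gjac_cong) simp_all
    then show ?thesis
      using that(4) by simp
  qed
  consider "k < m" | "m < k" | "m = 1" "k = 1"
    using less.prems by (cases m k rule: linorder_cases) auto
  then show ?case
  proof cases
    case 1
    have "coprime (m - k) k"
      using less.prems 1 by (metis coprime_iff_gcd_eq_1 gcd_diff1_nat less_imp_le_nat)
    then have "gjac (gsum t 1 (m - k)) (gsum t 1 k) = 1"
      using less.hyps[of "m - k" k] 1 less.prems by simp
    then show ?thesis
      using step[OF 1] less.prems by blast
  next
    case 2
    have c: "coprime (k - m) m" "coprime k m"
      using less.prems 2 by (metis coprime_iff_gcd_eq_1 gcd_diff1_nat less_imp_le_nat gcd.commute)+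
    then have "gjac (gsum t 1 (k - m)) (gsum t 1 m) = 1"
      using less.hyps[of "k - m" m] 2 less.prems by simp
    then have "gjac (gsum t 1 k) (gsum t 1 m) = 1"
      using step[OF 2 c(2)] less.prems by blast
    then show ?thesis
      using gjac_reciprocity prim less.prems coprime_gsum[of m k t] by metis
  next
    case 3
    then show ?thesis
      using gjac_1[OF prim[of 1]] by simp
  qed
qed

text \<open>Modulo the repunit of index k the square and the repunit of index q have symbol 1, hence
  so has 1 - t. Flipping, and reducing that repunit to k modulo 1 - t, gives the symbol of
  k.\<close>

lemma jac_norm_one:
  assumes eq: "x\<^sup>2 = (1 - t) * gsum t 1 q" and t: "2 dvd t" and k: "coprime k q" "k > 0" "q > 0"
    "coprime (int k) (gnorm (1 - t))"
  shows "jac (int k) (gnorm (1 - t)) = 1"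
proof -
  note c = coprime_root_gsum[OF eq k]
  have prim: "gprim (gsum t 1 k)"
    using gprim_gsum[OF t, of "k - 1"] k(2) by simp
  have prim': "gprim (1 - t)"
    using t by (auto simp: gprim_def)
  have "gjac (1 - t) (gsum t 1 k) * gjac (gsum t 1 q) (gsum t 1 k) = 1"
    using gjac_square[OF prim c(2)] unfolding eq gjac_mult[OF prim] .
  then have "gjac (1 - t) (gsum t 1 k) = 1"
    using gjac_gsum[OF t, of q k] k by (simp add: coprime_commute)
  then have "gjac (gsum t 1 k) (1 - t) = 1"
    using gjac_reciprocity[OF prim' prim c(1)] by simp
  moreover have "gjac (gsum t 1 k) (1 - t) = gjac (of_nat k) (1 - t)"
  proof (rule gjac_cong[OF prim'])
    obtain n where n: "k = Suc n"
      using \<open>k > 0\<close> by (cases k) auto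
    obtain W where W: "gsum t 1 (Suc n) = of_nat (Suc n) * 1 ^ n + (t - 1) * W"
      using gsum_cong_linear[of t 1 n] by blast
    then have "gsum t 1 k - of_nat k = (1 - t) * (- W)"
      by (simp add: n algebra_simps)
    then show "1 - t dvd gsum t 1 k - of_nat k"
      by (metis dvd_triv_left)
  qed
  ultimately show ?thesis
    using gjac_of_int[OF prim' k(4)] by simp
qed

text \<open>Squaring on the nonzero residues identifies 1 with q - 1, so it is not injective and,
  the set being finite, not surjective.\<close>

lemma ex_nonresidue:
  assumes "prime (q :: nat)" "odd q"
  obtains k where "coprime k q" "k > 0" "Legendre (int k) (int q) = -1"
proof -
  define S where "S = {0<..<q}"
  define f where "f = (\<lambda>y. y\<^sup>2 mod q)"
  have q: "q > 2"
    using assms prime_ge_2_nat[of q] by (cases "q = 2") auto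
  have "f ` S \<subseteq> S"
  proof
    fix z assume "z \<in> f ` S"
    then obtain y where y: "y \<in> S" "z = y\<^sup>2 mod q"
      by (auto simp: f_def)
    have "\<not> q dvd y"
      using y(1) by (auto simp: S_def dest: dvd_imp_le)
    then have "\<not> q dvd y\<^sup>2"
      using assms(1) prime_dvd_power by blast
    then show "z \<in> S"
      using y q by (auto simp: S_def dvd_eq_mod_eq_0)
  qed
  moreover have "\<not> inj_on f S"
  proof
    assume inj: "inj_on f S"
    obtain j where "q = 2 + j"
      using q le_Suc_ex[of 2 q] by auto
    then have "(q - 1)\<^sup>2 = 1 + q * (q - 2)"
      by (simp add: power2_eq_square algebra_simps)
    then have "f (q - 1) = f 1"
      unfolding f_def by (simp only: mod_mult_self2) simp
    then have "q - 1 = 1"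
      using inj q by (auto simp: inj_on_def S_def)
    then show False
      using q by simp
  qed
  moreover have "finite S"
    by (simp add: S_def)
  ultimately have "f ` S \<noteq> S"
    using finite_surj_inj[of S f] by auto
  then obtain k where k: "k \<in> S" "k \<notin> f ` S"
    using \<open>f ` S \<subseteq> S\<close> by auto
  have "\<not> q dvd k"
    using k(1) by (auto simp: S_def dest: dvd_imp_le)
  then have "coprime k q"
    using assms(1) by (metis coprime_commute prime_imp_coprime)
  have "\<not> QuadRes (int q) (int k)"
  proof
    assume "QuadRes (int q) (int k)"
    then obtain y where "[y\<^sup>2 = int k] (mod int q)"
      by (auto simp: QuadRes_def)
    then have "[(y mod int q)\<^sup>2 = int k] (mod int q)"
      by (simp add: cong_def power_mod)
    moreover define z where "z = nat (y mod int q)"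
    moreover have "int z = y mod int q"
      using q by (simp add: z_def)
    ultimately have "[int (z\<^sup>2) = int k] (mod int q)"
      by simp
    then have zk: "[z\<^sup>2 = k] (mod q)"
      by (simp only: cong_int_iff)
    then have "f z = k"
      using k(1) by (simp add: f_def cong_def S_def)
    moreover have "z < q"
      using q by (simp add: z_def nat_less_iff)
    moreover have "z \<noteq> 0"
      using \<open>f z = k\<close> k(1) by (auto simp: f_def S_def intro!: Nat.gr0I)
    ultimately show False
      using k(2) by (auto simp: S_def)
  qed
  moreover have "\<not> int q dvd int k"
    using \<open>\<not> q dvd k\<close> by simp
  ultimately have "Legendre (int k) (int q) = -1"
    by (simp add: Legendre_def cong_0_iff)
  then show ?thesis
    using that \<open>coprime k q\<close> k(1) by (auto simp: S_def)
qed

text \<open>Modulo q times a square the symbol of k is its Legendre symbol modulo q; a non-residue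
  can be moved within its class to be prime to the norm.\<close>

lemma norm_not_prime_times_square:
  assumes eq: "x\<^sup>2 = (1 - t) * gsum t 1 q" and t: "2 dvd t" and q: "prime q" "odd q"
    and N: "gnorm (1 - t) = int q * M\<^sup>2"
  shows False
proof -
  obtain k0 where k0: "coprime k0 q" "k0 > 0" "Legendre (int k0) (int q) = -1"
    using ex_nonresidue[OF q] .
  have odd: "odd (gnorm (1 - t))"
    using t unfolding gl_dvd_gnorm[symmetric] numeral_dvd_gint_iff by (auto simp: gl_dvd_iff)
  have "1 - t \<noteq> 0"
  proof
    assume "1 - t = 0"
    then show False
      using odd by (simp only: gnorm_simps dvd_0_right simp_thms)
  qed
  then have pos: "gnorm (1 - t) > 0"
    by (simp only: gnorm_pos_iff simp_thms)
  then have posN: "nat (gnorm (1 - t)) > 0"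
    by linarith
  have pos2: "odd (int q * M\<^sup>2)"
    using odd by (simp only: N simp_thms)
  obtain k where k: "[k = k0] (mod q)" "coprime k (nat (gnorm (1 - t)))" "coprime k q" "k > 0"
    using ex_coprime_progression[OF k0(1) posN k0(2)] by blast
  have kN: "coprime (int k) (gnorm (1 - t))"
    using k(2) by (metis coprime_int_iff gnorm_nonneg int_nat_eq)
  have "jac (int k) (int q * M\<^sup>2) = 1"
    using jac_norm_one[OF eq t k(3,4) _ kN] prime_gt_0_nat[OF q(1)] unfolding N by blast
  moreover have "M \<noteq> 0" "odd M"
    using pos2 by auto
  moreover have "coprime (int k) M"
    using kN unfolding N by simp
  then have "jac (int k) M * jac (int k) M = 1"
    using jac_values[OF \<open>M \<noteq> 0\<close>, of "int k"] jac_eq_0_iff[OF \<open>M \<noteq> 0\<close>, of "int k"] by auto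
  ultimately have "Legendre (int k) (int q) = 1"
    using q(1) prime_gt_0_nat[OF q(1)]
    by (simp add: jac_mult_right power2_eq_square jac_prime)
  moreover have "[int k = int k0] (mod int q)"
    using k(1) by (simp only: cong_int_iff)
  ultimately show False
    using k0(3) Legendre_cong by fastforce
qed

subsection \<open>Base divisible by \<open>1 + i\<close> only\<close>

context
  fixes t :: gint
  assumes t_even: "gl dvd t" and t_not2: "\<not> 2 dvd t"
begin

private lemma t_coords: "odd (gRe t)" "odd (gIm t)"
  using t_even t_not2 unfolding gl_dvd_iff numeral_dvd_gint_iff by auto

text \<open>Repunits of index at least 2 have even real and odd imaginary part here; the factor -i
  makes them admissible as moduli.\<close>

private definition F :: "nat \<Rightarrow> gint" where "F n = - gi * gsum t 1 n"

private lemma gsum_F: "gsum t 1 n = gi * F n"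
  by (simp add: F_def gi_mult flip: mult.assoc)

text \<open>Modulo 4 the square of t is 2i and its fourth power 0, so repunits are constant, equal
  to t - 1, from index 4 on; indices 2 and 3 give 1 + t and 1 + t + 2i.\<close>

private lemma gsum_shape_aux:
  "odd (gIm (gsum t 1 (n + 2)))" "even (gRe (gsum t 1 (n + 2)))"
  "4 dvd gRe (gsum t 1 (n + 2)) \<longleftrightarrow> (if n < 2 then gRe t mod 4 = 3 else gRe t mod 4 = 1)"
proof -
  obtain p q where pq: "gRe t = 2 * p + 1" "gIm t = 2 * q + 1"
    using t_coords by (elim oddE)
  have t: "t = Gint (2 * p + 1) (2 * q + 1)"
    by (simp add: gint_eq_iff pq)
  have e2: "gsum t 1 2 = 1 + t"
    by (simp add: numeral_2_eq_2)
  have t2: "\<exists>w. t\<^sup>2 = 2 * gi + 4 * w"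
    by (intro exI[of _ "Gint (p * p + p - q * q - q) (2 * p * q + p + q)"])
      (simp add: t gint_eq_iff power2_eq_square algebra_simps)
  then obtain w where w: "t\<^sup>2 = 2 * gi + 4 * w" ..
  have e3: "gsum t 1 3 = 1 + t + 2 * gi + 4 * w"
    using w by (simp add: eval_nat_numeral power2_eq_square algebra_simps)
  have "\<exists>v. gsum t 1 (4 + j) = t - 1 + 4 * v" for j
  proof -
    have "t ^ 4 = 4 * (- 1 + 4 * gi * w + 4 * w\<^sup>2)"
    proof -
      have "t ^ 4 = (t\<^sup>2)\<^sup>2" by simp
      then show ?thesis
        unfolding w by (simp add: power2_eq_square gi_mult algebra_simps flip: mult.assoc)
    qed
    then obtain r where r: "t ^ 4 = 4 * r" by blast
    have "gsum t 1 4 = 1 + t + t\<^sup>2 * (1 + t)"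
      by (simp add: eval_nat_numeral power2_eq_square algebra_simps)
    also have "\<dots> = t - 1 + 4 * (Gint (- q) (p + 1) + w * (1 + t))"
      unfolding w by (simp add: t gint_eq_iff algebra_simps)
    finally have "gsum t 1 (4 + j) = t - 1 + 4 * (Gint (- q) (p + 1) + w * (1 + t) + r * gsum t 1 j)"
      unfolding gsum_add r by (simp add: algebra_simps)
    then show ?thesis ..
  qed
  then obtain v where v: "gsum t 1 (4 + j) = t - 1 + 4 * v j" for j
    by metis
  consider "n = 0" | "n = 1" | j where "n = j + 2"
    by (metis One_nat_def Suc_1 add_2_eq_Suc' less_2_cases_iff not_less_iff_gr_or_eq old.nat.exhaust)
  then have "odd (gIm (gsum t 1 (n + 2))) \<and> even (gRe (gsum t 1 (n + 2))) \<and>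
    (4 dvd gRe (gsum t 1 (n + 2)) \<longleftrightarrow> (if n < 2 then gRe t mod 4 = 3 else gRe t mod 4 = 1))"
  proof cases
    case 1
    have "4 dvd gRe t + 1 \<longleftrightarrow> gRe t mod 4 = 3"
      by presburger
    then show ?thesis
      using t_coords by (simp add: \<open>n = 0\<close> e2)
  next
    case 2
    have e: "n + 2 = 3"
      using 2 by simp
    have "4 dvd 1 + gRe t + 4 * gRe w \<longleftrightarrow> gRe t mod 4 = 3"
      by presburger
    then show ?thesis
      using t_coords \<open>n = 1\<close> unfolding e e3 by simp
  next
    case (3 j)
    have e: "n + 2 = 4 + j"
      using 3 by simp
    have "4 dvd gRe t - 1 + 4 * gRe (v j) \<longleftrightarrow> gRe t mod 4 = 1"
      by presburger
    then show ?thesis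
      using t_coords \<open>n = j + 2\<close> unfolding e v by simp
  qed
  then show "odd (gIm (gsum t 1 (n + 2)))" "even (gRe (gsum t 1 (n + 2)))"
    "4 dvd gRe (gsum t 1 (n + 2)) \<longleftrightarrow> (if n < 2 then gRe t mod 4 = 3 else gRe t mod 4 = 1)"
    by blast+
qed

private lemma gsum_shape:
  assumes "n \<ge> 2"
  shows "odd (gIm (gsum t 1 n))" "even (gRe (gsum t 1 n))"
    "4 dvd gRe (gsum t 1 n) \<longleftrightarrow> (if n < 4 then gRe t mod 4 = 3 else gRe t mod 4 = 1)"
proof -
  obtain m where m: "n = m + 2"
    using assms by (metis le_add_diff_inverse2)
  have 4: "m + 2 < 4 \<longleftrightarrow> m < 2"
    by simp
  show "odd (gIm (gsum t 1 n))" "even (gRe (gsum t 1 n))"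
    "4 dvd gRe (gsum t 1 n) \<longleftrightarrow> (if n < 4 then gRe t mod 4 = 3 else gRe t mod 4 = 1)"
    unfolding m 4 by (fact gsum_shape_aux)+
qed

private lemma gprim_F: "n \<ge> 2 \<Longrightarrow> gprim (F n)"
  using gsum_shape(1,2)[of n] unfolding gprim_def F_def by simp

private lemma gjac_gi_F:
  assumes "n \<ge> 2"
  shows "gjac gi (F n) = (if n < 4 \<longleftrightarrow> gRe t mod 4 = 3 then 1 else -1)"
proof -
  have "4 dvd gIm (F n) \<longleftrightarrow> 4 dvd gRe (gsum t 1 n)"
    by (simp add: F_def)
  also have "\<dots> \<longleftrightarrow> (if n < 4 then gRe t mod 4 = 3 else gRe t mod 4 = 1)"
    by (rule gsum_shape(3)[OF assms])
  also have "\<dots> \<longleftrightarrow> (n < 4 \<longleftrightarrow> gRe t mod 4 = 3)"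
    using t_coords(1) by (cases "n < 4"; simp; presburger)
  finally show ?thesis
    using gjac_gi[OF gprim_F[OF assms]] by simp
qed

private definition R :: "nat \<Rightarrow> nat \<Rightarrow> int" where "R m k = gjac (gsum t 1 m) (F k)"

text \<open>The normalized repunits obey reciprocity without sign. The sign compares the symbols of
  i modulo the two, which depend only on whether the index is below 4.\<close>

private lemma R_swap:
  assumes "m \<ge> 2" "k \<ge> 2" "coprime m k"
  shows "R m k = (if m < 4 \<longleftrightarrow> k < 4 then 1 else -1) * R k m"
proof -
  have "coprime (gi * F m) (gi * F k)"
    using coprime_gsum[of m k t] assms unfolding gsum_F by simp
  then have "coprime (F m) (F k)"
    by simp
  then have "gjac (F m) (F k) = gjac (F k) (F m)"
    using gjac_reciprocity gprim_F assms(1,2) by blast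
  then show ?thesis
    unfolding R_def gsum_F gjac_mult[OF gprim_F[OF assms(1)]] gjac_mult[OF gprim_F[OF assms(2)]]
      gjac_gi_F[OF assms(1)] gjac_gi_F[OF assms(2)] by auto
qed

private lemma R_mod:
  assumes "k \<ge> 2"
  shows "R m k = R (m mod k) k"
proof -
  have "F k dvd gsum t 1 k"
    unfolding gsum_F by simp
  then show ?thesis
    unfolding R_def using gjac_cong[OF gprim_F[OF assms]] gsum_mod_cong'[of t k m] dvd_trans by blast
qed

private lemma R_1: "k \<ge> 2 \<Longrightarrow> R 1 k = 1"
  unfolding R_def using gjac_1[OF gprim_F] by simp

private lemma R_small:
  assumes "odd q"
  shows "R q 2 = 1"
  using R_mod[of 2 q] R_1[of 2] assms by (simp add: odd_iff_mod_2_eq_one)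

text \<open>For k at least 4 and prime to q and the norm, the symbol R q k is multiplicative in k,
  being the symbol of k modulo a fixed G; for k at least q it depends only on k modulo q. The
  classes 2, 5, 10 then yield a relation that the values at these small indices violate.\<close>

lemma gl_exact_no_square:
  assumes eq: "x\<^sup>2 = (1 - t) * gsum t 1 q" and q: "odd q" "q \<ge> 7" "\<not> 5 dvd q"
  shows False
proof -
  define G where "G = - gi * (1 - t)"
  have G: "1 - t = gi * G"
    by (simp add: G_def gi_mult flip: mult.assoc)
  have primG: "gprim G"
    using t_coords by (simp add: gprim_def G_def)
  have "4 dvd gIm G \<longleftrightarrow> gRe t mod 4 = 1"
  proof -
    have "gIm G = gRe t - 1"
      by (simp add: G_def)
    then show ?thesis
      by presburger
  qed
  then have giG: "gjac gi G = (if gRe t mod 4 = 1 then 1 else -1)"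
    using gjac_gi[OF primG] by simp
  have key: "R q k = gjac (of_nat k) G"
    if k: "k \<ge> 4" "coprime k q" "coprime (int k) (gnorm (1 - t))" for k
  proof -
    have k2: "k \<ge> 2" "k > 0" and "q > 0"
      using k(1) q(2) by simp_all
    note c = coprime_root_gsum[OF eq k(2) \<open>k > 0\<close> \<open>q > 0\<close> k(3)]
    have prim: "gprim (F k)"
      by (rule gprim_F[OF k2(1)])
    have cF: "coprime x (F k)" "coprime (gi * G) (F k)"
      using c(1,2) unfolding G gsum_F by simp_all
    have "gjac (1 - t) (F k) * R q k = 1"
      using gjac_square[OF prim cF(1)] unfolding R_def eq gjac_mult[OF prim] .
    then have "R q k = gjac (gi * G) (F k)"
      using gjac_coprime[OF prim cF(2)] unfolding G by auto
    also have "\<dots> = gjac gi (F k) * gjac (F k) G"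
      using gjac_reciprocity[OF primG prim] cF(2) by (simp add: gjac_mult[OF prim])
    \<comment> \<open>For k at least 4 the symbols of i modulo \<open>F k\<close> and modulo
      \<open>G\<close> coincide; this lets the factor i be moved back onto \<open>F k\<close> to
      restore the repunit.\<close>
    also have "gjac gi (F k) = gjac gi G"
      unfolding gjac_gi_F[OF k2(1)] giG using k(1) t_coords(1) by (simp; presburger)
    also have "gjac gi G * gjac (F k) G = gjac (gsum t 1 k) G"
      by (simp add: gsum_F gjac_mult[OF primG])
    also have "\<dots> = gjac (of_nat k) G"
    proof (rule gjac_cong[OF primG])
      obtain n where n: "k = Suc n"
        using \<open>k > 0\<close> by (cases k) auto
      obtain W where W: "gsum t 1 (Suc n) = of_nat (Suc n) * 1 ^ n + (t - 1) * W"
        using gsum_cong_linear[of t 1 n] by blast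
      then have "gsum t 1 k - of_nat k = (1 - t) * (- W)"
        by (simp add: n algebra_simps)
      then have "gsum t 1 k - of_nat k = G * (gi * (- W))"
        unfolding G by (simp add: mult_ac)
      then show "G dvd gsum t 1 k - of_nat k"
        by (metis dvd_triv_left)
    qed
    finally show ?thesis .
  qed
  have "gnorm (1 - t) > 0"
    using primG by (auto simp: G gprim_def gint_eq_iff[of gi])
  then have N: "nat (gnorm (1 - t)) > 0"
    by simp
  have c2: "coprime 2 q"
    using q(1) by simp
  have c5: "coprime 5 q"
    using q(3) by (intro prime_imp_coprime) simp_all
  \<comment> \<open>Large representatives of the classes 2 and 5, prime to the norm, since the
    symbol formula \<open>key\<close> excludes small or non-coprime indices.\<close>
  obtain k1 where k1: "[k1 = 2] (mod q)" "k1 \<ge> q" "coprime k1 (nat (gnorm (1 - t)))" "coprime k1 q"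
    using ex_coprime_progression[OF c2 N] by (metis zero_less_numeral)
  obtain k2 where k2: "[k2 = 5] (mod q)" "k2 \<ge> q" "coprime k2 (nat (gnorm (1 - t)))" "coprime k2 q"
    using ex_coprime_progression[OF c5 N] by (metis zero_less_numeral)
  have int_cop: "coprime (int k) (gnorm (1 - t))" if "coprime k (nat (gnorm (1 - t)))" for k
    using that by (metis coprime_int_iff gnorm_nonneg int_nat_eq)
  have R_q: "R q k = R r q" if "[k = r] (mod q)" "k \<ge> q" "coprime k q" for k r
  proof -
    have "R q k = R k q"
      using R_swap[of q k] that q(2) by (simp add: coprime_commute)
    also have "\<dots> = R (r mod q) q"
      using R_mod[of q k] that(1) q(2) by (simp add: cong_def)
    also have "\<dots> = R r q"
      using R_mod[of q r] q(2) by simp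
    finally show ?thesis .
  qed
  have "R q (k1 * k2) = R q k1 * R q k2"
  proof -
    have "k1 * k2 \<ge> 4" "k1 \<ge> 4" "k2 \<ge> 4"
      using k1(2) k2(2) q(2) mult_le_mono[of 1 k1 4 k2] by auto
    then show ?thesis
      using k1 k2 int_cop by (simp add: key gjac_mult[OF primG] del: int_ops(7))
  qed
  moreover have "R q k1 = R 2 q"
    using R_q k1 by blast
  moreover have "R q k2 = R 5 q"
    using R_q k2 by blast
  moreover have "R q (k1 * k2) = R 10 q"
  proof (rule R_q)
    show "[k1 * k2 = 10] (mod q)"
      using cong_mult[OF k1(1) k2(1)] by simp
    show "k1 * k2 \<ge> q"
      using k1(2) k2(2) q(2) mult_le_mono[of q k1 1 k2] by simp
    show "coprime (k1 * k2) q"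
      using k1(4) k2(4) by simp
  qed
  ultimately have mult: "R 10 q = R 2 q * R 5 q"
    by simp
  have R2: "R 2 q = -1"
    using R_swap[of 2 q] q R_small[OF q(1)] by simp
  have "coprime 10 q"
    using c2 c5 coprime_mult_left_iff[of 2 5 q] by simp
  then have R10: "R 10 q = R (q mod 10) 10"
    using R_swap[of 10 q] R_mod[of 10 q] q(2) by simp
  have R5: "R 5 q = R (q mod 5) 5"
    using R_swap[of 5 q] R_mod[of 5 q] q(2) c5 by simp
  have cop: "coprime (2 :: nat) 5" "coprime (2 :: nat) 3" "coprime (3 :: nat) 5" "coprime (4 :: nat) 5"
    "coprime (3 :: nat) 10" "coprime (7 :: nat) 10" "coprime (9 :: nat) 10" "coprime (3 :: nat) 7"
    by (simp_all add: coprime_iff_gcd_eq_1 gcd_non_0_nat)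
  have "R 2 3 = 1"
    using R_swap[of 2 3] R_small[of 3] cop(2) by simp
  have "R 3 7 = -1"
    using R_swap[of 3 7] R_mod[of 3 7] R_1[of 3] cop(8) by simp
  have base: "R 2 5 = -1" "R 3 5 = -1" "R 4 5 = 1" "R 3 10 = -1" "R 7 10 = -1" "R 9 10 = 1"
    using R_swap[of 2 5] R_small[of 5] cop(1) R_swap[of 3 5] R_mod[of 3 5] cop(3) \<open>R 2 3 = 1\<close>
      R_swap[of 4 5] R_mod[of 4 5] R_1[of 4] cop(4) R_swap[of 3 10] R_mod[of 3 10] R_1[of 3] cop(5)
      R_swap[of 7 10] R_mod[of 7 10] \<open>R 3 7 = -1\<close> cop(6) R_swap[of 9 10] R_mod[of 9 10] R_1[of 9]
      cop(7)
    by simp_all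
  have m: "q mod 5 = (q mod 10) mod 5"
    by (simp add: mod_mod_cancel)
  have "(q mod 10) mod 2 = q mod 2"
    by (simp add: mod_mod_cancel)
  then have "odd (q mod 10)"
    using q(1) by (simp only: odd_iff_mod_2_eq_one)
  moreover have "(q mod 10) mod 5 \<noteq> 0"
    using q(3) unfolding dvd_eq_mod_eq_0 m .
  moreover have "q mod 10 < 10"
    by simp
  ultimately have "q mod 10 = 1 \<or> q mod 10 = 3 \<or> q mod 10 = 7 \<or> q mod 10 = 9"
    by presburger
  \<comment> \<open>In all four classes of q modulo 10 the values R 5 q and R 10 q agree, whereas R
    2 q = -1.\<close>
  then show False
    using mult R2 R10 R5 base R_1[of 5] R_1[of 10] unfolding m by auto
qed

end

section \<open>The equation \<open>x\<^sup>2 = y\<^sup>q + 1\<close>\<close>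

lemma unit_times_square:
  assumes "is_unit u" "\<not> gl dvd z" "even (gIm (u * z\<^sup>2))"
  obtains z' where "u * z\<^sup>2 = z'\<^sup>2" "\<not> gl dvd z'"
proof -
  have "u \<noteq> gi" "u \<noteq> - gi"
    using odd_square_coords(1)[OF assms(2)] assms(3) by auto
  then have "u = 1 \<or> u = -1"
    using assms(1) by (simp add: gunit_iff)
  then show ?thesis
  proof
    assume "u = 1"
    then show ?thesis
      using that[of z] assms(2) by simp
  next
    assume "u = -1"
    then have "u * z\<^sup>2 = (gi * z)\<^sup>2"
      by (simp add: power_mult_distrib gi_sq)
    then show ?thesis
      using that[of "gi * z"] assms(2) by simp
  qed
qed

text \<open>Putting y = 3Y - 1 gives Y(3Y^2 - 3Y + 1) as a square with coprime factors. Then Y is a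
  square, -1 being absorbed by i, and the cofactor is the quartic with e = 1. The leftover Y = -1
  would need an element of norm 63.\<close>

lemma catalan_3:
  fixes x y :: gint
  assumes eq: "x\<^sup>2 = y ^ 3 + 1" and y: "2 dvd y" "3 dvd y + 1"
  shows "y = 2 \<and> (x = 3 \<or> x = -3)"
proof -
  obtain Y where Y: "y + 1 = 3 * Y"
    using y(2) ..
  then have y': "y = 3 * Y - 1"
    by (simp add: eq_diff_eq)
  have "x\<^sup>2 = 3 * (3 * (Y * (3 * Y\<^sup>2 - 3 * Y + 1)))"
    unfolding eq y' by (simp add: power2_eq_square eval_nat_numeral algebra_simps)
  moreover from this have "3 dvd x\<^sup>2"
    by (metis dvd_triv_left)
  then have "3 dvd x"
    by (rule prime_elem_dvd_power[OF prime_elem_3])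
  then obtain x1 where x1: "x = 3 * x1" ..
  ultimately have "9 * x1\<^sup>2 = 9 * (Y * (3 * Y\<^sup>2 - 3 * Y + 1))"
    by (simp add: power_mult_distrib)
  then have prod: "Y * (3 * Y\<^sup>2 - 3 * Y + 1) = x1\<^sup>2"
    by (metis mult_left_cancel zero_neq_numeral)
  have "coprime (1 + Y * (3 * Y - 3)) Y"
    by (rule coprime_addI) simp_all
  then have "coprime Y (3 * Y\<^sup>2 - 3 * Y + 1)"
    by (simp add: coprime_commute power2_eq_square algebra_simps)
  then obtain u z where u: "is_unit u" "Y = u * z\<^sup>2"
    using coprime_mult_eq_power[OF _ prod] by auto
  have ev: "even (gRe y)" "even (gIm y)"
    using y(1) unfolding numeral_dvd_gint_iff by simp_all
  then have "\<not> gl dvd y + 1"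
    by (simp add: gl_dvd_iff)
  then have Y_odd: "\<not> gl dvd Y"
    unfolding Y by simp
  then have "\<not> gl dvd z"
    unfolding u(2) by auto
  moreover have "even (gIm (3 * Y))"
    using ev unfolding Y[symmetric] by simp
  then have "even (gIm (u * z\<^sup>2))"
    unfolding u(2) by simp
  ultimately obtain z' where z': "Y = z'\<^sup>2" "\<not> gl dvd z'"
    using unit_times_square[OF u(1)] u(2) by metis
  have "z'\<^sup>2 dvd x1\<^sup>2"
    unfolding prod[symmetric] z'(1) by simp
  then have "z' dvd x1"
    by simp
  then obtain w where w: "x1 = z' * w" ..
  have "z'\<^sup>2 * (3 * Y\<^sup>2 - 3 * Y + 1) = z'\<^sup>2 * w\<^sup>2"
    using prod unfolding w z'(1) by (simp add: power_mult_distrib)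
  moreover have "z' \<noteq> 0"
    using z'(2) by auto
  ultimately have "w\<^sup>2 = 3 * Y\<^sup>2 - 3 * Y + 1"
    by simp
  then have "w\<^sup>2 = 3 * z' ^ 4 - 3 * z'\<^sup>2 * 1\<^sup>2 + 1 ^ 4"
    unfolding z'(1) by (simp flip: power_mult)
  then have "is_unit z'"
    using quartic_3 z'(2) by (metis coprime_1_right)
  then have "Y = 1 \<or> Y = -1"
    unfolding z'(1) by (rule gunit_square)
  moreover have "Y \<noteq> -1"
  proof
    assume "Y = -1"
    then have "x\<^sup>2 = -63"
      unfolding eq y' by simp
    then have "(gnorm x)\<^sup>2 = 63\<^sup>2"
      unfolding gnorm_power[symmetric] by simp
    then have "gnorm x = 63"
      using gnorm_nonneg[of x] by (simp only: power2_eq_iff_nonneg zero_le_numeral)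
    then show False
      using gnorm_mod_4[of x] by simp
  qed
  ultimately have "Y = 1"
    by blast
  then have "y = 2"
    using y' by simp
  moreover from this have "x\<^sup>2 = 3\<^sup>2"
    using eq by simp
  ultimately show ?thesis
    by (simp only: power2_eq_iff simp_thms)
qed

lemma catalan_base_divisible_by_2:
  fixes x y :: gint
  assumes eq: "x\<^sup>2 = y ^ q + 1" and q: "prime q" "odd q" and y: "2 dvd y" "y \<noteq> 0"
  shows "q = 3 \<and> y = 2 \<and> (x = 3 \<or> x = -3)"
proof -
  have q3: "q \<ge> 3"
    using q prime_ge_2_nat[of q] by (cases "q = 2") auto
  have ev: "even (gRe y)" "even (gIm y)"
    using y(1) unfolding numeral_dvd_gint_iff by simp_all
  then have y_even: "gl dvd y" and y1_odd: "\<not> gl dvd y + 1"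
    by (simp_all add: gl_dvd_iff)
  define t where "t = - y"
  have t: "2 dvd t" "1 - t = y + 1"
    using y(1) by (simp_all add: t_def)
  have prod: "x\<^sup>2 = (1 - t) * gsum t 1 q"
  proof -
    have "(1 - t) * gsum t 1 q = - ((t - 1) * gsum t 1 q)"
      by (simp add: algebra_simps)
    also have "\<dots> = 1 - t ^ q"
      unfolding diff_mult_gsum by simp
    finally show ?thesis
      using eq \<open>odd q\<close> by (simp add: t_def)
  qed
  have not_square: "y + 1 \<noteq> z\<^sup>2" for z
    using catalan_pell[OF eq \<open>odd q\<close> q3, of z] y_even y(2) by (auto simp: eq_diff_eq)
  have not_cop: "\<not> coprime (of_nat q) (1 - t)"
  proof
    assume "coprime (of_nat q) (1 - t)"
    then have "coprime (1 - t) (gsum t 1 q)"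
      using q3 by (intro coprime_one_minus_gsum) simp_all
    then obtain u z where u: "is_unit u" "1 - t = u * z\<^sup>2"
      using coprime_mult_eq_power[of "1 - t" "gsum t 1 q" x 2] prod by auto
    have "\<not> gl dvd z"
      using y1_odd u(2) unfolding t(2) by auto
    moreover have "even (gIm (u * z\<^sup>2))"
      unfolding u(2)[symmetric] t(2) using ev by simp
    ultimately obtain z' where "y + 1 = z'\<^sup>2"
      using unit_times_square[OF u(1)] u(2) t(2) by metis
    then show False
      using not_square by blast
  qed
  \<comment> \<open>A proper common divisor of q and 1 - t has norm q. Its cofactor in 1 - t is then
    a unit times a square, so the norm of 1 - t is q times a square.\<close>
  have "of_nat q dvd 1 - t"
  proof (rule ccontr)
    assume ndvd: "\<not> of_nat q dvd 1 - t"
    define d where "d = gcd (of_nat q) (1 - t)"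
    obtain e where e: "of_nat q = d * e"
      unfolding d_def by (metis dvdE gcd_dvd1)
    have ed: "gnorm d * gnorm e = (int q)\<^sup>2"
      unfolding gnorm_mult[symmetric] e[symmetric] by (simp add: gnorm_def)
    have qpos: "int q > 0"
      using q3 by simp
    have "\<not> is_unit d"
      using not_cop unfolding d_def is_unit_gcd .
    then have d1: "gnorm d \<noteq> 1"
      by (simp add: gunit_iff_gnorm)
    have "\<not> is_unit e"
    proof
      assume "is_unit e"
      then have "of_nat q dvd d"
        unfolding e by (simp only: mult_unit_dvd_iff dvd_refl)
      moreover have "d dvd 1 - t"
        by (simp add: d_def)
      ultimately show False
        using ndvd dvd_trans by blast
    qed
    then have e1: "gnorm e \<noteq> 1"
      by (simp add: gunit_iff_gnorm)
    have "gnorm d dvd (int q)\<^sup>2"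
      unfolding ed[symmetric] by simp
    moreover have "prime (int q)"
      using q(1) by simp
    ultimately obtain i where i: "i \<le> 2" "normalize (gnorm d) = normalize (int q ^ i)"
      using divides_primepow_weak[of "int q" "gnorm d" 2] by blast
    then have i': "gnorm d = int q ^ i"
      by simp
    have "i \<noteq> 0"
      using d1 unfolding i' by (intro notI) simp
    moreover have "i \<noteq> 2"
      using e1 ed qpos unfolding i' by (intro notI) simp
    ultimately have "i = 1"
      using i(1) by linarith
    then have Nd: "gnorm d = int q"
      using i' by simp
    then have "int q * gnorm e = int q * int q"
      using ed by (simp add: power2_eq_square)
    then have Ne: "gnorm e = int q"
      using qpos by simp
    have prime_e: "prime_elem e"
      using q(1) by (intro prime_elem_if_gnorm_prime) (simp add: Ne)
    obtain y1 where y1: "1 - t = d * y1"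
      unfolding d_def by (metis dvdE gcd_dvd2)
    have "\<not> e dvd y1"
    proof
      assume "e dvd y1"
      then have "d * e dvd d * y1"
        by simp
      then show False
        using ndvd unfolding e y1 by blast
    qed
    then have cop: "coprime e y1"
      using prime_e by (rule prime_elem_imp_coprime[rotated])
    obtain c where c: "q choose 2 = q * c"
    proof -
      obtain k where "q = 2 * k + 1"
        using \<open>odd q\<close> by (elim oddE)
      then have "q choose 2 = q * k"
        by (simp add: choose_two)
      then show ?thesis
        using that by blast
    qed
    obtain W where W: "gsum t 1 q = of_nat q + of_nat (q choose 2) * (t - 1) + (t - 1)\<^sup>2 * W"
      using gsum_cong_quadratic[of t q] by blast
    have t1: "t - 1 = - (d * y1)"
      using y1 by (simp add: algebra_simps eq_diff_eq)
    \<comment> \<open>The repunit divided by d: it is congruent to e modulo y1, hence coprime to y1,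
      because e is a prime not dividing y1.\<close>
    define E where "E = e + y1 * (- (e * of_nat c * d) + d * y1 * W)"
    have gE: "gsum t 1 q = d * E"
      unfolding W c of_nat_mult e t1 E_def by (simp add: power2_eq_square algebra_simps)
    have "coprime E y1"
      unfolding E_def by (rule coprime_addI[OF cop]) simp
    have x2: "x\<^sup>2 = d\<^sup>2 * (y1 * E)"
      unfolding prod y1 gE by (simp add: power2_eq_square mult_ac)
    then have "d\<^sup>2 dvd x\<^sup>2"
      by simp
    then have "d dvd x"
      by simp
    then obtain x1 where x1: "x = d * x1" ..
    have "d\<^sup>2 * x1\<^sup>2 = d\<^sup>2 * (y1 * E)"
      using x2 unfolding x1 by (simp add: power_mult_distrib)
    moreover have "d \<noteq> 0"
      using Nd qpos by auto
    ultimately have "y1 * E = x1\<^sup>2"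
      by simp
    then obtain u z where u: "is_unit u" "y1 = u * z\<^sup>2"
      using coprime_mult_eq_power[of y1 E x1 2] \<open>coprime E y1\<close> by (auto simp: coprime_commute)
    have "gnorm (1 - t) = int q * (gnorm z)\<^sup>2"
      unfolding y1 u(2) gnorm_mult gnorm_power Nd using u(1) by (simp add: gunit_iff_gnorm)
    then show False
      using norm_not_prime_times_square[OF prod t(1) q] by blast
  qed
  then have qy: "of_nat q dvd y + 1"
    by (simp add: t(2))
  show ?thesis
  proof (cases "q = 3")
    case True
    then have "3 dvd y + 1" "x\<^sup>2 = y ^ 3 + 1"
      using qy eq by simp_all
    then show ?thesis
      using catalan_3 y(1) True by blast
  next
    case False
    then have q5: "q \<ge> 5"
      using q q3 by (cases "q = 4") auto
    obtain a B x' where d: "x' = x \<or> x' = - x" "x' = 2 * a ^ q - 1" "B ^ q = 4 * (a ^ q - 1)"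
      "y = a * B" "\<not> gl dvd a"
      using catalan_even_base_decomp[OF eq \<open>odd q\<close> q3 y_even] .
    have "coprime 2 a"
      using d(5) by (intro gint_coprimeI) (auto dest: prime_elem_dvd_two)
    then have "2 dvd B"
      using y(1) unfolding d(4) by (simp add: coprime_dvd_mult_right_iff)
    moreover have "B \<noteq> 0"
      using y(2) d(4) by auto
    \<comment> \<open>Such a prime divides y + 1 and so x; since x' = 2(a^q - 2) + 3, it would also
      divide 3, which is coprime to q.\<close>
    moreover have "\<not> p dvd a ^ q - 2" if p: "prime_elem p" "p dvd of_nat q" for p
    proof
      assume pa: "p dvd a ^ q - 2"
      have "p dvd y + 1"
        using p(2) qy by (rule dvd_trans)
      then have "p dvd x\<^sup>2"
        unfolding prod t(2) by simp
      then have "p dvd x'"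
        using d(1) prime_elem_dvd_power[OF p(1)] by auto
      then have "p dvd x' - 2 * (a ^ q - 2)"
        by (rule dvd_diff[OF _ dvd_mult[OF pa]])
      then have "p dvd 3"
        unfolding d(2) by simp
      moreover have "coprime (of_int (int q) :: gint) (of_int 3)"
      proof (rule coprime_nat_gint)
        have "coprime q 3"
          using False q(1) by (intro primes_coprime) simp_all
        then show "coprime (int q) 3"
          by (metis coprime_int_iff of_nat_numeral)
      qed
      then have "coprime (of_nat q :: gint) 3"
        by simp
      ultimately show False
        using p by (meson coprime_common_divisor prime_elem_not_unit)
    qed
    ultimately show ?thesis
      using catalan_no_common_q[OF d(3) \<open>odd q\<close> q5 _ _ d(5)] by blast
  qed
qed

lemma catalan_gl_exact:
  fixes x y :: gint
  assumes eq: "x\<^sup>2 = y ^ q + 1" and q: "prime q" "odd q" and y: "gl dvd y" "\<not> 2 dvd y"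
  shows "q = 5 \<and> (y = 1 + gi \<and> (x = -1 + 2 * gi \<or> x = 1 - 2 * gi) \<or>
    y = 1 - gi \<and> (x = -1 - 2 * gi \<or> x = 1 + 2 * gi))"
proof -
  have q3: "q \<ge> 3"
    using q prime_ge_2_nat[of q] by (cases "q = 2") auto
  obtain a B x' where d: "x' = x \<or> x' = - x" "x' = 2 * a ^ q - 1" "B ^ q = 4 * (a ^ q - 1)"
    "y = a * B" "\<not> gl dvd a"
    using catalan_even_base_decomp[OF eq \<open>odd q\<close> q3 y(1)] .
  have B: "gl dvd B" "\<not> 2 dvd B"
    using y d(4,5) by auto
  \<comment> \<open>For q = 3 the factor 4, a unit times \<open>gl ^ 4\<close>, carries more than
    the three factors \<open>gl\<close> of an exact B^3.\<close>
  have "q \<noteq> 3"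
  proof
    assume "q = 3"
    obtain b where b: "B = gl * b"
      using B(1) ..
    have "gl ^ 3 * b ^ 3 = gl ^ 3 * (- gl * (a ^ 3 - 1))"
    proof -
      have "gl ^ 3 * (- gl * (a ^ 3 - 1)) = - (gl ^ 4) * (a ^ 3 - 1)"
        by (simp add: eval_nat_numeral mult_ac)
      then show ?thesis
        using d(3) \<open>q = 3\<close> by (simp add: b power_mult_distrib gl_pow4)
    qed
    then have "b ^ 3 = - gl * (a ^ 3 - 1)"
      by (metis gl_neq_0 mult_left_cancel power_not_zero)
    then have "gl dvd b ^ 3"
      by simp
    then have "gl dvd b"
      by simp
    then obtain c where "b = gl * c" ..
    then have "B = 2 * (gi * c)"
      using b gl_sq by (metis mult.assoc power2_eq_square)
    then show False
      using B(2) by simp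
  qed
  moreover have "q < 7"
  proof (rule ccontr)
    assume "\<not> q < 7"
    then have "q \<ge> 7"
      by simp
    then have "\<not> 5 dvd q"
      using q(1) by (auto simp: prime_nat_iff)
    define t where "t = - y"
    have "(1 - t) * gsum t 1 q = - ((t - 1) * gsum t 1 q)"
      by (simp add: algebra_simps)
    also have "\<dots> = 1 - t ^ q"
      unfolding diff_mult_gsum by simp
    finally have "x\<^sup>2 = (1 - t) * gsum t 1 q"
      using eq \<open>odd q\<close> by (simp add: t_def)
    then show False
      using gl_exact_no_square[of t x q] y \<open>odd q\<close> \<open>q \<ge> 7\<close> \<open>\<not> 5 dvd q\<close> by (simp add: t_def)
  qed
  ultimately have "q = 5"
    using q3 \<open>odd q\<close> by presburger
  have "a\<^sup>2 = -1"
    using catalan_5_exact[OF _ B d(5)] d(3) \<open>q = 5\<close> by simp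
  then have "(a - gi) * (a + gi) = 0"
    by (simp add: power2_eq_square gi_mult algebra_simps)
  then have a: "a = gi \<or> a = - gi"
    by (auto simp: eq_neg_iff_add_eq_0)
  have y5: "y ^ 5 = x'\<^sup>2 - 1"
    using eq \<open>q = 5\<close> d(1) by auto
  from a show ?thesis
  proof
    assume "a = gi"
    then have x': "x' = -1 + 2 * gi"
      using d(2) \<open>q = 5\<close> by (simp add: gint_eq_iff eval_nat_numeral)
    have "y ^ 5 = (1 + gi) ^ 5"
      unfolding y5 x' by (simp add: gint_eq_iff eval_nat_numeral)
    then have "y = 1 + gi"
      using odd_power_inject_gint[of y 5 "1 + gi"] by simp
    moreover have "x = -1 + 2 * gi \<or> x = 1 - 2 * gi"
      using d(1) unfolding x' by (auto simp: gint_eq_iff)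
    ultimately show ?thesis
      using \<open>q = 5\<close> by blast
  next
    assume "a = - gi"
    then have x': "x' = -1 - 2 * gi"
      using d(2) \<open>q = 5\<close> by (simp add: gint_eq_iff eval_nat_numeral)
    have "y ^ 5 = (1 - gi) ^ 5"
      unfolding y5 x' by (simp add: gint_eq_iff eval_nat_numeral)
    then have "y = 1 - gi"
      using odd_power_inject_gint[of y 5 "1 - gi"] by simp
    moreover have "x = -1 - 2 * gi \<or> x = 1 + 2 * gi"
      using d(1) unfolding x' by (auto simp: gint_eq_iff)
    ultimately show ?thesis
      using \<open>q = 5\<close> by blast
  qed
qed

proposition catalan_square_prime:
  fixes x y :: gint
  assumes eq: "x\<^sup>2 = y ^ q + 1" and q: "prime q" "odd q" and nz: "x \<noteq> 0" "y \<noteq> 0"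
  shows "q = 3 \<and> y = 2 \<and> (x = 3 \<or> x = -3) \<or>
    q = 5 \<and> (y = 1 + gi \<and> (x = -1 + 2 * gi \<or> x = 1 - 2 * gi) \<or>
      y = 1 - gi \<and> (x = -1 - 2 * gi \<or> x = 1 + 2 * gi))"
proof -
  have "q > 1"
    using q(1) prime_gt_1_nat by blast
  then have "gl dvd y"
    using catalan_odd_base[OF eq \<open>odd q\<close>] nz(1) by blast
  then show ?thesis
    using catalan_gl_exact[OF eq q] catalan_base_divisible_by_2[OF eq q _ nz(2)] by blast
qed

section \<open>Catalan's equation\<close>

text \<open>None of these norms is a proper power of a norm: 3 is not a norm, so 9 is excluded, and
  4 = 2^2 has an even exponent.\<close>

lemma norm_power_exponent:
  assumes "gnorm X ^ j = N" "j > 0" "N = 2 \<or> N = 4 \<and> odd j \<or> N = 5 \<or> N = 9"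
  shows "j = 1"
proof (rule ccontr)
  assume "j \<noteq> 1"
  then have "j \<ge> 2"
    using assms(2) by simp
  define g where "g = gnorm X"
  have g: "g ^ j = N" "g \<ge> 0"
    using assms(1) by (simp_all add: g_def)
  have "g \<noteq> 0" "g \<noteq> 1"
    using g(1) assms(2,3) by (auto simp: power_0_left)
  then have "g \<ge> 2"
    using g(2) by simp
  have "j < 4"
  proof (rule ccontr)
    assume "\<not> j < 4"
    then have "(2 :: int) ^ 4 \<le> 2 ^ j"
      by (intro power_increasing) auto
    also have "\<dots> \<le> g ^ j"
      using \<open>g \<ge> 2\<close> by (intro power_mono) auto
    finally show False
      using g(1) assms(3) by auto
  qed
  then have j: "j = 2 \<or> j = 3"
    using \<open>j \<ge> 2\<close> by linarith
  have "g < 4"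
  proof (rule ccontr)
    assume "\<not> g < 4"
    then have "(4 :: int) ^ 2 \<le> g ^ 2"
      by (intro power_mono) auto
    also have "\<dots> \<le> g ^ j"
      using \<open>g \<ge> 2\<close> \<open>j \<ge> 2\<close> by (intro power_increasing) auto
    finally show False
      using g(1) assms(3) by auto
  qed
  then have "g = 2 \<or> g = 3"
    using \<open>g \<ge> 2\<close> by linarith
  moreover have "g \<noteq> 3"
    using gnorm_mod_4[of X] by (auto simp: g_def)
  ultimately show False
    using g(1) assms(3) j by auto
qed

lemma catalan_square_prime_exponents:
  fixes P Q :: gint
  assumes "P\<^sup>2 = Q ^ p + 1" "prime p" "odd p" "P \<noteq> 0" "Q \<noteq> 0"
    and "gnorm P = gnorm X ^ j" "gnorm Q = gnorm Y ^ k" "j > 0" "odd k"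
  shows "j = 1" "k = 1"
proof -
  have "(gnorm P = 9 \<and> gnorm Q = 4) \<or> (gnorm P = 5 \<and> gnorm Q = 2)"
    using catalan_square_prime[OF assms(1-5)] by (auto simp: gnorm_def)
  then show "j = 1" "k = 1"
    using norm_power_exponent[of X j] norm_power_exponent[of Y k] assms(6-9) odd_pos by auto
qed

lemma catalan_gint:
  fixes X Y :: gint
  assumes eq: "X ^ m = Y ^ n + 1" and "m > 1" "n > 1" "even m \<or> even n" and nz: "X \<noteq> 0" "Y \<noteq> 0"
  shows "(X, Y, m, n) \<in>
    {(-2, 3 * gi, 3, 2), (-2, -3 * gi, 3, 2), (3, 2, 2, 3), (-3, 2, 2, 3),
     (gi - 1, gi - 2, 5, 2), (-gi - 1, -gi - 2, 5, 2),
     (-1 - 2 * gi, -gi + 1, 2, 5), (-1 + 2 * gi, gi + 1, 2, 5),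
     (gi - 1, 2 - gi, 5, 2), (-gi - 1, 2 + gi, 5, 2),
     (2 * gi + 1, 1 - gi, 2, 5), (-2 * gi + 1, 1 + gi, 2, 5)}"
proof -
  have odd_factor: "\<exists>p k. prime p \<and> odd p \<and> odd k \<and> n = p * k" if n: "odd n" "n > 1" for n :: nat
  proof -
    obtain p where "prime p" "p dvd n"
      using prime_factor_nat[of n] n(2) by auto
    then show ?thesis
      using n(1) by (auto elim!: dvdE)
  qed
  consider "even m" "even n" | "even m" "odd n" | "odd m" "even n"
    using assms(4) by blast
  then show ?thesis
  proof cases
    case 1
    obtain i j where ij: "m = 2 * i" "n = 2 * j"
      using 1 by (elim evenE)
    \<comment> \<open>Inverse units are either equal or opposite, so the difference or the sum of
      the two factors vanishes.\<close>
    have "(X ^ i - Y ^ j) * (X ^ i + Y ^ j) = 1"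
      using eq by (simp add: ij power_mult power2_eq_square algebra_simps flip: power_mult_distrib)
    then have "(X ^ i - Y ^ j) + (X ^ i + Y ^ j) = 0 \<or> (X ^ i + Y ^ j) - (X ^ i - Y ^ j) = 0"
      by (cases rule: gunit_pair_cases) auto
    then have "2 * X ^ i = 0 \<or> 2 * Y ^ j = 0"
      by (simp add: algebra_simps)
    then show ?thesis
      using nz by simp
  next
    case 2
    obtain j where j: "m = 2 * j"
      using 2(1) by (elim evenE)
    obtain p k where p: "prime p" "odd p" "odd k" "n = p * k"
      using odd_factor[OF 2(2) \<open>n > 1\<close>] by blast
    have e: "(X ^ j)\<^sup>2 = (Y ^ k) ^ p + 1"
      using eq by (simp add: j p(4) mult.commute flip: power_mult)
    have jk: "j = 1" "k = 1"
      using catalan_square_prime_exponents[OF e p(1,2), of X j Y k] nz j \<open>m > 1\<close> p(3)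
      by (simp_all add: gnorm_power)
    then show ?thesis
      using catalan_square_prime[OF _ p(1,2) nz] e j p(4) by (auto simp: add.commute)
  next
    case 3
    obtain j where j: "n = 2 * j"
      using 3(2) by (elim evenE)
    obtain p k where p: "prime p" "odd p" "odd k" "m = p * k"
      using odd_factor[OF 3(1) \<open>m > 1\<close>] by blast
    have "Y ^ n = X ^ m - 1"
      using eq by simp
    \<comment> \<open>The unit i exchanges the two roles: negating the equation turns -Y^n into the
      square of i Y^j and, as p is odd, -X^m into a p-th power.\<close>
    then have e: "(gi * Y ^ j)\<^sup>2 = (- (X ^ k)) ^ p + 1"
      using p(2) by (simp add: j p(4) power_mult_distrib gi_sq mult.commute flip: power_mult)
    have jk: "j = 1" "k = 1"
      using catalan_square_prime_exponents[OF e p(1,2), of Y j X k] nz j \<open>n > 1\<close> p(3)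
      by (simp_all add: gnorm_power gnorm_mult gint_eq_iff[of gi])
    have Y: "Y = - gi * (gi * Y)"
      by (simp add: gi_mult flip: mult.assoc)
    have X: "X = - (- X)"
      by simp
    have *: "gi * Y \<noteq> 0" "- X \<noteq> 0"
      using nz by (simp_all add: gint_eq_iff[of gi])
    have e': "(gi * Y)\<^sup>2 = (- X) ^ p + 1"
      using e jk by simp
    have "X = - 2 \<and> (Y = - gi * 3 \<or> Y = - gi * -3) \<and> p = 3 \<or>
      p = 5 \<and> (X = - (1 + gi) \<and> (Y = - gi * (-1 + 2 * gi) \<or> Y = - gi * (1 - 2 * gi)) \<or>
        X = - (1 - gi) \<and> (Y = - gi * (-1 - 2 * gi) \<or> Y = - gi * (1 + 2 * gi)))"
      using catalan_square_prime[OF e' p(1,2) *] X Y by metis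
    then show ?thesis
      using j p(4) jk by (auto simp: gint_eq_iff)
  qed
qed

section \<open>Transfer to the complex numbers\<close>

definition of_gint :: "gint \<Rightarrow> complex" where
  "of_gint z = of_int (gRe z) + of_int (gIm z) * \<i>"

lemma of_gint_mult: "of_gint (z * w) = of_gint z * of_gint w"
  by (simp add: of_gint_def complex_eq_iff algebra_simps)

lemma of_gint_power: "of_gint (z ^ n) = of_gint z ^ n"
  by (induction n) (simp_all add: of_gint_mult, simp add: of_gint_def)

lemma of_gint_add: "of_gint (z + w) = of_gint z + of_gint w"
  by (simp add: of_gint_def algebra_simps)

lemma of_gint_inject: "of_gint z = of_gint w \<longleftrightarrow> z = w"
  by (auto simp: of_gint_def complex_eq_iff gint_eq_iff)

lemma gaussian_intsE:
  assumes "x \<in> gaussian_ints"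
  obtains X where "x = of_gint X"
proof -
  obtain a b :: int where "x = of_int a + of_int b * \<i>"
    using assms unfolding gaussian_ints_def by blast
  then show ?thesis
    using that[of "Gint a b"] by (simp add: of_gint_def)
qed

theorem theorem1:
  fixes x y :: complex and m n :: nat
  assumes "x \<in> gaussian_ints" and "y \<in> gaussian_ints"
    and "m > 1" and "n > 1" and "even m \<or> even n"
  shows "nontrivial_catalan_solution x y m n \<longleftrightarrow>
    (x, y, m, n) \<in>
      {(-2, 3 * \<i>, 3, 2), (-2, -3 * \<i>, 3, 2), (3, 2, 2, 3), (-3, 2, 2, 3),
       (\<i> - 1, \<i> - 2, 5, 2), (-\<i> - 1, -\<i> - 2, 5, 2),
       (-1 - 2 * \<i>, -\<i> + 1, 2, 5), (-1 + 2 * \<i>, \<i> + 1, 2, 5),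
       (\<i> - 1, 2 - \<i>, 5, 2), (-\<i> - 1, 2 + \<i>, 5, 2),
       (2 * \<i> + 1, 1 - \<i>, 2, 5), (-2 * \<i> + 1, 1 + \<i>, 2, 5)}"
    (is "_ \<longleftrightarrow> _ \<in> ?S")
proof
  assume "nontrivial_catalan_solution x y m n"
  then have eq: "x ^ m = y ^ n + 1" and nz: "x \<noteq> 0" "y \<noteq> 0"
    by (auto simp: nontrivial_catalan_solution_def diff_eq_eq add.commute)
  obtain X Y where XY: "x = of_gint X" "y = of_gint Y"
    using assms(1,2) gaussian_intsE by metis
  have "of_gint (X ^ m) = of_gint (Y ^ n + 1)"
    using eq by (simp add: XY of_gint_power of_gint_add) (simp add: of_gint_def)
  then have "X ^ m = Y ^ n + 1"
    by (simp only: of_gint_inject)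
  moreover have "X \<noteq> 0" "Y \<noteq> 0"
    using nz by (auto simp: XY of_gint_def)
  ultimately have "(X, Y, m, n) \<in>
    {(-2, 3 * gi, 3, 2), (-2, -3 * gi, 3, 2), (3, 2, 2, 3), (-3, 2, 2, 3),
     (gi - 1, gi - 2, 5, 2), (-gi - 1, -gi - 2, 5, 2),
     (-1 - 2 * gi, -gi + 1, 2, 5), (-1 + 2 * gi, gi + 1, 2, 5),
     (gi - 1, 2 - gi, 5, 2), (-gi - 1, 2 + gi, 5, 2),
     (2 * gi + 1, 1 - gi, 2, 5), (-2 * gi + 1, 1 + gi, 2, 5)}"
    by (rule catalan_gint[OF _ assms(3-5)])
  then show "(x, y, m, n) \<in> ?S"
    unfolding XY by (elim insertE emptyE) (simp_all add: of_gint_def)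
next
  assume "(x, y, m, n) \<in> ?S"
  then show "nontrivial_catalan_solution x y m n"
    unfolding nontrivial_catalan_solution_def
    by (elim insertE emptyE; simp add: complex_eq_iff eval_nat_numeral)
qed

end
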